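(* Let $\sigma^+(\cdot)$ and $\sigma^-(\cdot)$ be the zero-temperature Glauber (majority) evolutions on $\mathbb{T}_3$ which use the same Poisson clocks as $\sigma(\cdot)$ but start from the initial configurations $\sigma^{+}(0)$ and $\sigma^-(0)$, where $\sigma^{\pm}_x(0)=\sigma_x(0)$ for all $x\ne o$, $\sigma^+_o(0)=+1$ and $\sigma^-_o(0)=-1$. Let \[ \sigma^+(\cdot)\,\Delta\,\sigma^-(\cdot)=\{y\in\mathcal{V}:\sigma^+_y(t)\ne\sigma^-_y(t)\text{ for some }t\ge 0\}. \] Then for Lebesgue-a.e. $p\in[0,1]$, \[ \mathbb{P}_p\big(\#\,\sigma^+(\cdot)\,\Delta\,\sigma^-(\cdot)<\infty\big)=1. \]
   Context: $\mathbb{T}_3$ is the infinite $3$-regular tree with vertex set $\mathcal{V}$; $o\in\mathcal{V}$ is a distinguished vertex (the root); $\partial x$ is the set of the three neighbors of $x$. Zero-temperature Glauber (majority vote) dynamics: under $\mathbb{P}_p$, $p\in[0,1]$, the initial spins $\sigma_x(0)\in\{-1,+1\}$, $x\in\mathcal{V}$, are i.i.d. with $\mathbb{P}_p(\sigma_x(0)=+1)=p=1-\mathbb{P}_p(\sigma_x(0)=-1)$, and, independently, each vertex carries an independent rate-one Poisson process (its clock). Spins are constant between clock rings; when the clock of $x$ rings at time $t$, the spin of $x$ at time $t$ is set equal to the majority value of the spins of the three neighbors of $x$ at time $t^-$. $\mathbb{P}_p$ denotes the joint law of initial spins and clocks. $\#$ denotes cardinality. *)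

theory Defs
  imports "HOL-Probability.Probability"
begin

section \<open>The 3-regular tree\<close>

text \<open>
  A simple graph is given by its adjacency relation on the vertex type; the vertex set is the
  whole type.
\<close>

definition neighbours :: "('v \<Rightarrow> 'v \<Rightarrow> bool) \<Rightarrow> 'v \<Rightarrow> 'v set" where
  "neighbours E x = {y. E x y}"

definition is_cycle :: "('v \<Rightarrow> 'v \<Rightarrow> bool) \<Rightarrow> 'v list \<Rightarrow> bool" where
  "is_cycle E xs \<longleftrightarrow>
     length xs \<ge> 3 \<and> distinct xs \<and> successively E xs \<and> E (last xs) (hd xs)"

text \<open>
  A 3-regular tree is automatically infinite (and countable), and it is unique up to isomorphism.
\<close>

definition three_regular_tree :: "('v \<Rightarrow> 'v \<Rightarrow> bool) \<Rightarrow> bool" where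
  "three_regular_tree E \<longleftrightarrow>
     symp E \<and> irreflp E \<and>
     (\<forall>x y. E\<^sup>*\<^sup>* x y) \<and>
     (\<nexists>xs. is_cycle E xs) \<and>
     (\<forall>x. card (neighbours E x) = 3)"


section \<open>Initial spins and Poisson clocks\<close>

definition spin_law :: "real \<Rightarrow> int pmf" where
  "spin_law p = map_pmf (\<lambda>b. if b then 1 else - 1) (bernoulli_pmf p)"

text \<open>
  A clock is encoded by its sequence of waiting times. For a rate-one Poisson process these are
  i.i.d. standard exponential variables, and the points of the process are their partial sums.
\<close>

definition clock_law :: "(nat \<Rightarrow> real) measure" where
  "clock_law = PiM UNIV (\<lambda>_. density lborel (\<lambda>t. ennreal (exponential_density 1 t)))"

definition ring_times :: "(nat \<Rightarrow> real) \<Rightarrow> real set" where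
  "ring_times w = range (\<lambda>n. \<Sum>k\<le>n. w k)"

definition glauber_law :: "real \<Rightarrow> (('v \<Rightarrow> int) \<times> ('v \<Rightarrow> nat \<Rightarrow> real)) measure" where
  "glauber_law p =
     PiM UNIV (\<lambda>_. measure_pmf (spin_law p)) \<Otimes>\<^sub>M PiM UNIV (\<lambda>_. clock_law)"


section \<open>Zero-temperature Glauber dynamics\<close>

definition majority :: "('v \<Rightarrow> 'v \<Rightarrow> bool) \<Rightarrow> ('v \<Rightarrow> int) \<Rightarrow> 'v \<Rightarrow> int" where
  "majority E m x =
     (if card {y \<in> neighbours E x. m y = 1} > card {y \<in> neighbours E x. m y = - 1}
      then 1 else - 1)"

text \<open>
  \<open>\<sigma> x t\<close> is the spin of \<open>x\<close> at time \<open>t\<close>, and \<open>w x\<close> holds the waiting times of the clock of \<open>x\<close>.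
  Negative times have no meaning; freezing the spins there makes the evolution unique as a
  function of a real time parameter. The second clause says that spins are constant between
  rings (and right-continuous), the third uses the left limits \<open>\<sigma>\<^sub>y(t\<^sup>-)\<close>.
\<close>

definition majority_evolution ::
  "('v \<Rightarrow> 'v \<Rightarrow> bool) \<Rightarrow> ('v \<Rightarrow> nat \<Rightarrow> real) \<Rightarrow> ('v \<Rightarrow> int) \<Rightarrow> ('v \<Rightarrow> real \<Rightarrow> int) \<Rightarrow> bool" where
  "majority_evolution E w s \<sigma> \<longleftrightarrow>
     (\<forall>x. \<forall>t\<le>0. \<sigma> x t = s x) \<and>
     (\<forall>x a b. 0 \<le> a \<and> a \<le> b \<and> ring_times (w x) \<inter> {a<..b} = {} \<longrightarrow> \<sigma> x b = \<sigma> x a) \<and>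
     (\<forall>x. \<forall>t\<in>ring_times (w x). \<sigma> x t = majority E (\<lambda>y. Lim (at_left t) (\<sigma> y)) x)"

text \<open>
  For almost every realisation of the clocks on the 3-regular tree there is exactly one majority
  evolution from each initial configuration, as almost surely no infinite chain of successive
  neighbours rings at decreasing times within a bounded time interval. On the exceptional null
  set the value below is unspecified.
\<close>

definition glauber ::
  "('v \<Rightarrow> 'v \<Rightarrow> bool) \<Rightarrow> ('v \<Rightarrow> nat \<Rightarrow> real) \<Rightarrow> ('v \<Rightarrow> int) \<Rightarrow> 'v \<Rightarrow> real \<Rightarrow> int" where
  "glauber E w s = (THE \<sigma>. majority_evolution E w s \<sigma>)"

definition disagreement_set ::
  "('v \<Rightarrow> real \<Rightarrow> int) \<Rightarrow> ('v \<Rightarrow> real \<Rightarrow> int) \<Rightarrow> 'v set" where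
  "disagreement_set \<sigma> \<sigma>' = {y. \<exists>t\<ge>0. \<sigma> y t \<noteq> \<sigma>' y t}"

end

theory Submission
  imports Defs
begin

text \<open>
  Idea. Put i.i.d. uniform values on the vertices and let a ringing vertex adopt the median of its
  three neighbours; thresholding this median process at level \<open>p\<close> gives the majority dynamics with
  parameter \<open>p\<close>. If the root is given the value \<open>p\<close> itself, then the two evolutions of the theorem
  are the thresholds \<open>\<le> p\<close> and \<open>< p\<close>, so they disagree exactly on the trace of the root, i.e. at
  the vertices which at some time carry the root's value. By Fubini it suffices that for uniform
  initial values the trace is almost surely finite. Write \<open>D t\<close> for the set of vertices carrying
  the root's value at time \<open>t\<close>; mass transport gives \<open>E |D t| = 1\<close>.

  Call a ring of \<open>x\<close> lonely if just before it \<open>x\<close> agrees with none of its neighbours. A lonely ring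
  increases the number of neighbours agreeing with \<open>x\<close>, and no ring decreases it, so each vertex has
  boundedly many lonely rings in expectation. By mass transport only finitely many lonely rings occur
  next to \<open>D\<close>. Without those, a neighbour of \<open>D\<close> never passes from one side of the root's value to
  the other, and then once every vertex of \<open>D\<close> is stable under updating (\<open>D\<close> is stuck), \<open>D\<close> can only
  grow afterwards; by Fatou's lemma it then stays bounded. Finally \<open>D\<close> does get stuck: from
  \<open>|D n| \<le> k\<close>, with probability at least \<open>c k > 0\<close> the rings near \<open>D n\<close> during the next unit of time
  peel off unstable vertices one after the other until \<open>D\<close> is stuck, while \<open>|D n| > k\<close> has
  probability at most \<open>1 / k\<close>.
\<close>


section \<open>Product measures\<close>

text \<open>The exceptional set of \<open>p\<close> comes from Fubini alone: the root's value plays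
  the part of the level, so a statement about almost all values of the root is one about almost all
  levels. The obstacle is that a bound on the mean size of \<open>D\<close> at each fixed time
  controls neither the union over all times nor a small \<open>D\<close> that wanders off. Growth
  after a stuck time excludes wandering; it could only fail if a neighbour of \<open>D\<close>
  jumped across the root's value, and such a jump needs a lonely ring, since otherwise the new value
  lies between the old one and the root's. Mass transport rests on a group: the tree is a Cayley
  graph of the free product of three groups of order two. Infinitely many vertices ring in every
  interval, so the dynamics is computed by a backward recursion over ring numbers that almost surely
  terminates; medians and majorities are two instances of it. Independence of past and future enters
  as invariance of the clock law under restarting at a fixed time.\<close>

lemma distr_PiM_pairwise:
  fixes M :: "'a measure" and N :: "'b measure" and L :: "'c measure"
  assumes M: "prob_space M" and N: "prob_space N" and L: "prob_space L"
    and g[measurable]: "(\<lambda>(a, b). g a b) \<in> measurable (M \<Otimes>\<^sub>M N) L"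
    and eq: "distr (M \<Otimes>\<^sub>M N) L (\<lambda>(a, b). g a b) = L"
  shows "distr (PiM UNIV (\<lambda>_::'i. M) \<Otimes>\<^sub>M PiM UNIV (\<lambda>_::'i. N)) (PiM UNIV (\<lambda>_. L))
           (\<lambda>(f, h) x. g (f x) (h x)) = PiM UNIV (\<lambda>_. L)"
proof -
  interpret M: product_prob_space "\<lambda>_. M" "UNIV :: 'i set"
    by (intro product_prob_spaceI M)
  interpret N: product_prob_space "\<lambda>_. N" "UNIV :: 'i set"
    by (intro product_prob_spaceI N)
  interpret L: product_prob_space "\<lambda>_. L" "UNIV :: 'i set"
    by (intro product_prob_spaceI L)
  interpret MN: pair_prob_space M N by unfold_locales
  interpret PP: pair_prob_space "PiM UNIV (\<lambda>_::'i. M)" "PiM UNIV (\<lambda>_::'i. N)" by unfold_locales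
  let ?P = "PiM UNIV (\<lambda>_::'i. M) \<Otimes>\<^sub>M PiM UNIV (\<lambda>_::'i. N)"
  let ?t = "\<lambda>(f, h) x. g (f x) (h x)"
  have g': "(\<lambda>x. g (u x) (v x)) \<in> measurable X L"
    if "u \<in> measurable X M" "v \<in> measurable X N" for u v and X :: "'z measure"
    using measurable_compose[OF measurable_Pair[OF that] g] by simp
  have gsp: "a \<in> space M \<Longrightarrow> b \<in> space N \<Longrightarrow> g a b \<in> space L" for a b
    using measurable_space[OF g, of "(a, b)"] by (simp add: space_pair_measure)
  have t[measurable]: "?t \<in> measurable ?P (PiM UNIV (\<lambda>_. L))"
    unfolding case_prod_beta
    by (rule measurable_PiM_single')
      (auto intro!: g' gsp simp: space_PiM space_pair_measure)
  show ?thesis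
  \<comment> \<open>A product measure is determined by its finite cylinders. For fixed
    \<open>f\<close> the conditions on the coordinates of \<open>h\<close> are independent; the
    resulting factors depend on distinct coordinates of \<open>f\<close>, so their integral is again
    a product.\<close>
  proof (rule L.PiM_eq)
    fix J :: "'i set" and F :: "'i \<Rightarrow> 'c set"
    assume J: "finite J" "J \<subseteq> UNIV" and F: "\<And>j. j \<in> J \<Longrightarrow> F j \<in> sets L"
    let ?X = "prod_emb UNIV (\<lambda>_. L) J (\<Pi>\<^sub>E j\<in>J. F j)"
    define G where "G j = {ab \<in> space (M \<Otimes>\<^sub>M N). (\<lambda>(a, b). g a b) ab \<in> F j}" for j
    have G[measurable]: "G j \<in> sets (M \<Otimes>\<^sub>M N)" if "j \<in> J" for j
      unfolding G_def using F[OF that] by measurable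
    have emG: "emeasure (M \<Otimes>\<^sub>M N) (G j) = emeasure L (F j)" if "j \<in> J" for j
    proof -
      have "emeasure L (F j) = emeasure (distr (M \<Otimes>\<^sub>M N) L (\<lambda>(a, b). g a b)) (F j)"
        by (simp add: eq)
      also have "\<dots> = emeasure (M \<Otimes>\<^sub>M N) (G j)"
        using F[OF that] by (subst emeasure_distr) (auto simp: G_def intro!: arg_cong[where f="emeasure (M \<Otimes>\<^sub>M N)"])
      finally show ?thesis by simp
    qed
    have X: "?X \<in> sets (PiM UNIV (\<lambda>_. L))"
      using F J by (intro sets_PiM_I) auto
    have m: "(\<lambda>f. \<Prod>j\<in>J. emeasure N (Pair (f j) -` G j)) \<in> borel_measurable (PiM J (\<lambda>_. M))"
      using G by (intro borel_measurable_prod_ennreal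
        measurable_compose[OF measurable_component_singleton N.M.measurable_emeasure_Pair]) auto
    have "emeasure (distr ?P (PiM UNIV (\<lambda>_. L)) ?t) ?X
        = emeasure ?P {z \<in> space ?P. \<forall>j\<in>J. (fst z j, snd z j) \<in> G j}"
      (is "_ = emeasure ?P ?Y")
      by (subst emeasure_distr[OF t X])
        (auto intro!: arg_cong[where f="emeasure ?P"]
          simp: prod_emb_def space_PiM space_pair_measure G_def PiE_iff gsp)
    also have "\<dots> = (\<integral>\<^sup>+ f. emeasure (PiM UNIV (\<lambda>_. N)) (Pair f -` ?Y) \<partial>PiM UNIV (\<lambda>_. M))"
    proof (rule N.P.emeasure_pair_measure_alt)
      have "Measurable.pred ?P (\<lambda>z. (fst z j, snd z j) \<in> G j)" if "j \<in> J" for j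
        using G[OF that] by measurable
      then show "?Y \<in> sets ?P"
        using J by (intro predE pred_intros_finite) auto
    qed
    also have "\<dots> = (\<integral>\<^sup>+ f. (\<Prod>j\<in>J. emeasure N (Pair (f j) -` G j)) \<partial>PiM UNIV (\<lambda>_. M))"
    proof (rule nn_integral_cong)
      fix f assume f: "f \<in> space (PiM UNIV (\<lambda>_::'i. M))"
      have "Pair f -` ?Y = {h \<in> space (PiM UNIV (\<lambda>_. N)). \<forall>j\<in>J. h j \<in> Pair (f j) -` G j}"
        using f by (auto simp: space_pair_measure)
      then show "emeasure (PiM UNIV (\<lambda>_. N)) (Pair f -` ?Y) = (\<Prod>j\<in>J. emeasure N (Pair (f j) -` G j))"
        using J G by (simp only:) (rule N.emeasure_PiM_Collect, auto intro: sets_Pair1)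
    qed
    also have "\<dots> = (\<integral>\<^sup>+ f. (\<Prod>j\<in>J. emeasure N (Pair (f j) -` G j))
                      \<partial>distr (PiM UNIV (\<lambda>_. M)) (PiM J (\<lambda>_. M)) (\<lambda>x. restrict x J))"
      using J m by (subst nn_integral_distr) (auto intro!: measurable_restrict_subset)
    also have "\<dots> = (\<integral>\<^sup>+ f. (\<Prod>j\<in>J. emeasure N (Pair (f j) -` G j)) \<partial>PiM J (\<lambda>_. M))"
      using J by (simp add: M.distr_PiM_restrict_finite)
    also have "\<dots> = (\<Prod>j\<in>J. \<integral>\<^sup>+ a. emeasure N (Pair a -` G j) \<partial>M)"
      using J G by (intro M.product_nn_integral_prod N.M.measurable_emeasure_Pair) auto
    also have "\<dots> = (\<Prod>j\<in>J. emeasure L (F j))"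
      using G by (intro prod.cong refl) (simp add: emG[symmetric] N.M.emeasure_pair_measure_alt)
    finally show "emeasure (distr ?P (PiM UNIV (\<lambda>_. L)) ?t) ?X = (\<Prod>j\<in>J. emeasure L (F j))" .
  qed simp
qed

section \<open>Poisson clocks\<close>

abbreviation expo :: "real measure" where
  "expo \<equiv> density lborel (\<lambda>t. ennreal (exponential_density 1 t))"

lemma prob_space_expo: "prob_space expo"
  by (rule prob_space_exponential_density) simp

interpretation clock: sequence_space expo
  by (intro sequence_space.intro product_prob_spaceI prob_space_expo)

lemma clock_law_eq: "clock_law = PiM UNIV (\<lambda>_. expo)"
  by (simp add: clock_law_def)

lemma prob_space_clock_law: "prob_space clock_law"
  unfolding clock_law_eq by (rule clock.P.prob_space_axioms)

lemma sets_clock_law[measurable_cong]: "sets clock_law = sets (PiM UNIV (\<lambda>_. borel))"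
  unfolding clock_law_eq by (intro sets_PiM_cong) auto

lemma space_clock_law[simp]: "space clock_law = UNIV"
  unfolding clock_law_eq by (simp add: space_PiM)

definition arrival :: "(nat \<Rightarrow> real) \<Rightarrow> nat \<Rightarrow> real" where
  "arrival w n = (\<Sum>k\<le>n. w k)"

text \<open>The numbers of rings strictly before \<open>t\<close> and up to \<open>t\<close>; unspecified if the arrival times stay
  below \<open>t\<close>.\<close>

definition before :: "(nat \<Rightarrow> real) \<Rightarrow> real \<Rightarrow> nat" where
  "before w t = (LEAST n. t \<le> arrival w n)"

definition upto_time :: "(nat \<Rightarrow> real) \<Rightarrow> real \<Rightarrow> nat" where
  "upto_time w t = (LEAST n. t < arrival w n)"

text \<open>Positivity makes the arrivals strictly increasing; unboundedness makes the least
  elements in \<open>before\<close> and \<open>upto_time\<close> exist.\<close>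

definition regular_clock :: "(nat \<Rightarrow> real) \<Rightarrow> bool" where
  "regular_clock w \<longleftrightarrow> (\<forall>n. 0 < w n) \<and> (\<forall>t. \<exists>n. t < arrival w n)"

lemma ring_times_arrival: "ring_times w = range (arrival w)"
  by (simp add: ring_times_def arrival_def)

lemma arrival_0[simp]: "arrival w 0 = w 0"
  and arrival_Suc: "arrival w (Suc n) = arrival w n + w (Suc n)"
  by (simp_all add: arrival_def)

lemma measurable_arrival[measurable]:
  "(\<lambda>w. arrival w n) \<in> borel_measurable (PiM UNIV (\<lambda>_. borel))"
  unfolding arrival_def by measurable

lemma measurable_before[measurable (raw)]:
  assumes [measurable]: "f \<in> measurable M (PiM UNIV (\<lambda>_. borel))" "t \<in> borel_measurable M"
  shows "(\<lambda>x. before (f x) (t x)) \<in> measurable M (count_space UNIV)"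
  unfolding before_def by measurable

lemma measurable_upto_time[measurable (raw)]:
  assumes [measurable]: "f \<in> measurable M (PiM UNIV (\<lambda>_. borel))" "t \<in> borel_measurable M"
  shows "(\<lambda>x. upto_time (f x) (t x)) \<in> measurable M (count_space UNIV)"
  unfolding upto_time_def by measurable

lemma AE_expo_pos: "AE x in expo. 0 < x"
proof -
  have "AE x in lborel. x \<noteq> (0::real)"
    using AE_lborel_singleton[of "0::real"] by simp
  then show ?thesis
    by (subst AE_density) (auto elim!: eventually_mono simp: exponential_density_def split: if_splits)
qed

section \<open>Lack of memory\<close>

lemma nn_integral_expo_memoryless:
  assumes [measurable]: "h \<in> borel_measurable borel" and \<theta>: "0 \<le> \<theta>"
  shows "(\<integral>\<^sup>+x. indicator {\<theta><..} x * h x \<partial>expo) = ennreal (exp (- \<theta>)) * (\<integral>\<^sup>+x. h (\<theta> + x) \<partial>expo)"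
proof -
  have "(\<integral>\<^sup>+x. indicator {\<theta><..} x * h x \<partial>expo)
      = (\<integral>\<^sup>+x. ennreal (exponential_density 1 x) * (indicator {\<theta><..} x * h x) \<partial>lborel)"
    by (subst nn_integral_density) auto
  also have "\<dots> = (\<integral>\<^sup>+x. ennreal (exponential_density 1 (\<theta> + x)) * (indicator {\<theta><..} (\<theta> + x) * h (\<theta> + x)) \<partial>lborel)"
    by (subst nn_integral_real_affine[where c=1 and t=\<theta>]) auto
  also have "\<dots> = (\<integral>\<^sup>+x. ennreal (exp (- \<theta>)) * (ennreal (exponential_density 1 x) * h (\<theta> + x)) \<partial>lborel)"
  proof (rule nn_integral_cong_AE)
    \<comment> \<open>The two integrands may differ at \<open>x = 0\<close>, where the density is 1
      but the open interval excludes the point.\<close>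
    have "AE x in lborel. x \<noteq> (0::real)"
      using AE_lborel_singleton[of "0::real"] by simp
    then show "AE x in lborel. ennreal (exponential_density 1 (\<theta> + x)) * (indicator {\<theta><..} (\<theta> + x) * h (\<theta> + x))
        = ennreal (exp (- \<theta>)) * (ennreal (exponential_density 1 x) * h (\<theta> + x))"
    proof eventually_elim
      case (elim x)
      show ?case
      proof (cases "0 < x")
        case True
        then have "exponential_density 1 (\<theta> + x) = exp (- \<theta>) * exponential_density 1 x"
          using \<theta> by (simp add: exponential_density_def mult_exp_exp)
        moreover have "0 \<le> exponential_density 1 x"
          by (simp add: exponential_density_nonneg)
        ultimately show ?thesis
          using True by (simp add: ennreal_mult mult.assoc)
      next
        case False
        then have "exponential_density 1 x = 0"
          using elim by (simp add: exponential_density_def)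
        then show ?thesis
          using False by simp
      qed
    qed
  qed
  also have "\<dots> = ennreal (exp (- \<theta>)) * (\<integral>\<^sup>+x. h (\<theta> + x) \<partial>expo)"
    by (subst nn_integral_cmult) (auto simp: nn_integral_density)
  finally show ?thesis .
qed

lemma nn_integral_clock_case:
  assumes [measurable]: "g \<in> borel_measurable clock_law"
  shows "(\<integral>\<^sup>+w. g w \<partial>clock_law) = (\<integral>\<^sup>+x. \<integral>\<^sup>+w. g (case_nat x w) \<partial>clock_law \<partial>expo)"
proof -
  interpret C: prob_space clock_law by (rule prob_space_clock_law)
  interpret E: prob_space expo by (rule prob_space_expo)
  have "(\<integral>\<^sup>+w. g w \<partial>clock_law) = (\<integral>\<^sup>+w. g w \<partial>distr (expo \<Otimes>\<^sub>M clock_law) clock_law (\<lambda>(s, \<omega>). case_nat s \<omega>))"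
    using clock.PiM_iter by (simp add: clock_law_eq)
  also have "\<dots> = (\<integral>\<^sup>+z. g (case_nat (fst z) (snd z)) \<partial>(expo \<Otimes>\<^sub>M clock_law))"
    by (subst nn_integral_distr) (auto simp: case_prod_beta)
  also have "\<dots> = (\<integral>\<^sup>+x. \<integral>\<^sup>+w. g (case_nat x w) \<partial>clock_law \<partial>expo)"
    by (subst C.nn_integral_fst[symmetric]) auto
  finally show ?thesis .
qed

lemma nn_integral_clock_comb:
  assumes [measurable]: "g \<in> borel_measurable clock_law"
  shows "(\<integral>\<^sup>+w. g w \<partial>clock_law) = (\<integral>\<^sup>+v. \<integral>\<^sup>+w. g (comb_seq n v w) \<partial>clock_law \<partial>clock_law)"
proof -
  interpret C: prob_space clock_law by (rule prob_space_clock_law)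
  have "(\<integral>\<^sup>+w. g w \<partial>clock_law) = (\<integral>\<^sup>+w. g w \<partial>distr (clock_law \<Otimes>\<^sub>M clock_law) clock_law (\<lambda>(v, w). comb_seq n v w))"
    using clock.PiM_comb_seq[of n] by (simp add: clock_law_eq)
  also have "\<dots> = (\<integral>\<^sup>+z. g (comb_seq n (fst z) (snd z)) \<partial>(clock_law \<Otimes>\<^sub>M clock_law))"
    by (subst nn_integral_distr) (auto simp: case_prod_beta)
  also have "\<dots> = (\<integral>\<^sup>+v. \<integral>\<^sup>+w. g (comb_seq n v w) \<partial>clock_law \<partial>clock_law)"
    by (subst C.nn_integral_fst[symmetric]) auto
  finally show ?thesis .
qed

text \<open>On the event that nothing has rung by time \<theta>, the residual first waiting time
  together with all later ones can be replaced by a fresh clock.\<close>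

lemma nn_integral_clock_memoryless:
  assumes g[measurable]: "g \<in> borel_measurable clock_law" and \<theta>: "0 \<le> \<theta>"
  shows "(\<integral>\<^sup>+w. indicator {\<theta><..} (w 0) * (\<integral>\<^sup>+v. g (v(0 := \<theta> + v 0)) \<partial>clock_law) \<partial>clock_law)
       = (\<integral>\<^sup>+w. indicator {\<theta><..} (w 0) * g w \<partial>clock_law)"
proof -
  interpret C: prob_space clock_law by (rule prob_space_clock_law)
  interpret E: prob_space expo by (rule prob_space_expo)
  have upd: "(case_nat x w)(0 := \<theta> + x) = case_nat (\<theta> + x) w" for x and w :: "nat \<Rightarrow> real"
    by (auto simp: fun_eq_iff split: nat.split)
  have one: "(\<integral>\<^sup>+x. indicator {\<theta><..} x \<partial>expo) = ennreal (exp (- \<theta>))"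
    using nn_integral_expo_memoryless[of "\<lambda>_. 1" \<theta>] \<theta> by (simp add: prob_space.emeasure_space_1[OF prob_space_expo, simplified])
  have one': "(\<integral>\<^sup>+w. indicator {\<theta><..} (w 0) \<partial>clock_law) = ennreal (exp (- \<theta>))"
    by (subst nn_integral_clock_case) (simp_all add: one C.emeasure_space_1[simplified])
  have [measurable]: "(\<lambda>w. w(0 := \<theta> + w 0)) \<in> measurable (PiM UNIV (\<lambda>_. borel)) (PiM UNIV (\<lambda>_. borel :: real measure))"
    by (rule measurable_PiM_single') (auto simp: space_PiM fun_upd_def)
  have [measurable]: "(\<lambda>x. \<integral>\<^sup>+w. g (case_nat x w) \<partial>clock_law) \<in> borel_measurable borel"
    by (rule C.borel_measurable_nn_integral) measurable
  have "(\<integral>\<^sup>+w. indicator {\<theta><..} (w 0) * (\<integral>\<^sup>+v. g (v(0 := \<theta> + v 0)) \<partial>clock_law) \<partial>clock_law)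
      = ennreal (exp (- \<theta>)) * (\<integral>\<^sup>+v. g (v(0 := \<theta> + v 0)) \<partial>clock_law)"
    by (subst nn_integral_multc) (auto simp: one')
  also have "\<dots> = ennreal (exp (- \<theta>)) * (\<integral>\<^sup>+x. \<integral>\<^sup>+w. g (case_nat (\<theta> + x) w) \<partial>clock_law \<partial>expo)"
    by (subst nn_integral_clock_case) (simp_all add: upd)
  also have "\<dots> = (\<integral>\<^sup>+x. indicator {\<theta><..} x * (\<integral>\<^sup>+w. g (case_nat x w) \<partial>clock_law) \<partial>expo)"
    by (subst nn_integral_expo_memoryless[OF _ \<theta>]) auto
  also have "\<dots> = (\<integral>\<^sup>+w. indicator {\<theta><..} (w 0) * g w \<partial>clock_law)"
    by (subst (2) nn_integral_clock_case) (auto simp: nn_integral_cmult)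
  finally show ?thesis .
qed

section \<open>Intensity of the rings\<close>

lemma distributed_arrival: "distributed clock_law lborel (\<lambda>w. arrival w n) (erlang_density n 1)"
proof -
  interpret C: prob_space clock_law by (rule prob_space_clock_law)
  have comp: "distr clock_law borel (\<lambda>w. w i) = expo" for i
  proof -
    have "distr clock_law borel (\<lambda>w. w i) = distr clock_law expo (\<lambda>w. w i)"
      by (intro distr_cong) auto
    then show ?thesis
      using clock.PiM_component[of i] by (simp add: clock_law_eq)
  qed
  have "distr clock_law (PiM {..n} (\<lambda>_. borel)) (\<lambda>w. restrict w {..n})
      = distr clock_law (PiM {..n} (\<lambda>_. expo)) (\<lambda>w. restrict w {..n})"
    by (intro distr_cong sets_PiM_cong) auto
  also have "\<dots> = PiM {..n} (\<lambda>_. expo)"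
    using clock.distr_PiM_restrict_finite[of "{..n}"] by (simp add: clock_law_eq)
  finally have "C.indep_vars (\<lambda>_. borel) (\<lambda>i w. w i) {..n}"
    by (subst C.indep_vars_iff_distr_eq_PiM') (auto simp: comp restrict_def)
  moreover have "distributed clock_law lborel (\<lambda>w. w i) (exponential_density 1)" for i
  proof -
    have "distr clock_law lborel (\<lambda>w. w i) = distr clock_law borel (\<lambda>w. w i)"
      by (intro distr_cong) auto
    then show ?thesis unfolding distributed_def by (auto simp: comp)
  qed
  ultimately have "distributed clock_law lborel (\<lambda>w. \<Sum>i\<in>{..n}. w i) (erlang_density (card {..n} - 1) 1)"
    by (intro C.exponential_distributed_sum) auto
  then show ?thesis by (simp add: arrival_def)
qed

text \<open>The sum is the intensity of the ring process: the exponential series times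
  \<open>exp (- x)\<close>.\<close>

lemma erlang_density_sums:
  assumes "0 \<le> x" shows "(\<Sum>n. ennreal (erlang_density n 1 x)) = 1"
proof -
  have "(\<lambda>n. x ^ n /\<^sub>R fact n) sums exp x" by (rule exp_converges)
  then have "(\<lambda>n. exp (- x) * (x ^ n /\<^sub>R fact n)) sums (exp (- x) * exp x)" by (rule sums_mult)
  then have "(\<lambda>n. erlang_density n 1 x) sums 1"
    using assms by (simp add: erlang_density_def exp_minus field_simps)
  then show ?thesis
    by (subst suminf_ennreal_eq[where x=1]) auto
qed

text \<open>Summing the densities of the arrival times before integrating bounds the intensity by 1
  on the whole line, with value 0 on the negative axis.\<close>

lemma expected_arrivals_le:
  assumes "a \<le> b"
  shows "(\<integral>\<^sup>+w. (\<Sum>n. indicator {a<..b} (arrival w n)) \<partial>clock_law) \<le> ennreal (b - a)"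
proof -
  have "(\<integral>\<^sup>+w. (\<Sum>n. indicator {a<..b} (arrival w n)) \<partial>clock_law)
      = (\<Sum>n. \<integral>\<^sup>+w. indicator {a<..b} (arrival w n) \<partial>clock_law)"
    by (rule nn_integral_suminf) measurable
  also have "\<dots> = (\<Sum>n. \<integral>\<^sup>+x. ennreal (erlang_density n 1 x) * indicator {a<..b} x \<partial>lborel)"
    by (intro suminf_cong distributed_nn_integral[symmetric] distributed_arrival) auto
  also have "\<dots> = (\<integral>\<^sup>+x. (\<Sum>n. ennreal (erlang_density n 1 x) * indicator {a<..b} x) \<partial>lborel)"
    by (rule nn_integral_suminf[symmetric]) measurable
  also have "\<dots> \<le> (\<integral>\<^sup>+x. indicator {a<..b} x \<partial>lborel)"
  proof (rule nn_integral_mono)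
    fix x :: real
    show "(\<Sum>n. ennreal (erlang_density n 1 x) * indicator {a<..b} x) \<le> indicator {a<..b} x"
    proof -
      have "(\<Sum>n. ennreal (erlang_density n 1 x)) \<le> 1"
      proof (cases "0 \<le> x")
        case True
        show ?thesis by (rule eq_refl[OF erlang_density_sums[OF True]])
      next
        case False
        then have "(\<lambda>n. ennreal (erlang_density n 1 x)) = (\<lambda>_. 0)"
          by (simp add: erlang_density_def fun_eq_iff)
        then show ?thesis by (simp only: suminf_zero) simp
      qed
      then have "(\<Sum>n. ennreal (erlang_density n 1 x)) * indicator {a<..b} x \<le> 1 * indicator {a<..b} x"
        by (rule mult_right_mono) simp
      then show ?thesis by (simp only: ennreal_suminf_multc mult_1_left)
    qed
  qed
  also have "\<dots> = ennreal (b - a)" using assms by simp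
  finally show ?thesis .
qed

lemma AE_regular_clock: "AE w in clock_law. regular_clock w"
proof -
  have pos: "AE w in clock_law. 0 < w n" for n
    unfolding clock_law_eq by (rule AE_PiM_component[OF prob_space_expo _ AE_expo_pos]) auto
  \<comment> \<open>Non-explosion: if all arrivals stayed below \<open>m\<close>, the interval would
    contain infinitely many of them, although their mean number is finite. With the left endpoint -1
    nonnegativity of the arrivals is enough.\<close>
  have "AE w in clock_law. \<exists>n. real m < arrival w n" for m
  proof -
    have "(\<integral>\<^sup>+w. (\<Sum>n. indicator {-1<..real m} (arrival w n)) \<partial>clock_law) \<noteq> \<infinity>"
      using expected_arrivals_le[of "-1" "real m"] by (auto simp: top_unique)
    then have "AE w in clock_law. (\<Sum>n. indicator {-1<..real m} (arrival w n) :: ennreal) \<noteq> \<infinity>"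
      by (intro nn_integral_PInf_AE) auto
    moreover have "AE w in clock_law. \<forall>n. 0 < w n"
      using pos by (simp add: AE_all_countable)
    ultimately show ?thesis
    proof eventually_elim
      case (elim w)
      show ?case
      proof (rule ccontr)
        assume "\<nexists>n. real m < arrival w n"
        then have "arrival w n \<in> {-1<..real m}" for n
          using elim(2) by (auto simp: arrival_def not_less intro!: less_le_trans[OF _ sum_nonneg] less_imp_le)
        moreover have "(\<Sum>n::nat. 1 :: ennreal) = \<infinity>"
          by (subst nn_integral_count_space_nat[symmetric]) simp
        ultimately show False using elim(1) by simp
      qed
    qed
  qed
  then have "AE w in clock_law. \<forall>m. \<exists>n. real m < arrival w n"
    by (simp add: AE_all_countable)
  moreover have "AE w in clock_law. \<forall>n. 0 < w n"
    using pos by (simp add: AE_all_countable)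
  ultimately show ?thesis
  proof eventually_elim
    case (elim w)
    have "\<exists>n. t < arrival w n" for t
      using elim(1) reals_Archimedean2[of t] by (meson less_trans)
    then show ?case using elim by (simp add: regular_clock_def)
  qed
qed

lemma AE_arrival_neq: "AE w in clock_law. arrival w n \<noteq> c"
proof -
  have "AE x in distr clock_law lborel (\<lambda>w. arrival w n). x \<noteq> c"
    unfolding distributed_distr_eq_density[OF distributed_arrival]
    using AE_lborel_singleton[of c] by (subst AE_density) (auto elim!: eventually_mono)
  then show ?thesis
    by (subst (asm) AE_distr_iff) auto
qed


lemma strict_mono_arrival: "regular_clock w \<Longrightarrow> strict_mono (arrival w)"
  by (auto simp: strict_mono_Suc_iff arrival_Suc regular_clock_def)

lemma arrival_pos: "regular_clock w \<Longrightarrow> 0 < arrival w n"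
  by (metis arrival_0 regular_clock_def strict_mono_arrival strict_mono_less_eq le0 less_le_trans)

lemma less_before_iff: "regular_clock w \<Longrightarrow> n < before w t \<longleftrightarrow> arrival w n < t"
  unfolding before_def regular_clock_def
  by (metis (mono_tags, lifting) LeastI_ex less_imp_le not_le not_less_Least order_trans
      strict_mono_arrival[unfolded regular_clock_def] strict_mono_less_eq)

lemma less_upto_time_iff: "regular_clock w \<Longrightarrow> n < upto_time w t \<longleftrightarrow> arrival w n \<le> t"
  unfolding upto_time_def regular_clock_def
  by (metis (mono_tags, lifting) LeastI_ex not_le not_less_Least less_le_trans
      strict_mono_arrival[unfolded regular_clock_def] strict_mono_less_eq)

section \<open>Restarting a clock at a fixed time\<close>

text \<open>Follows \<open>v\<close> up to time \<open>t\<close> and restarts with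
  \<open>v'\<close>. The waiting time that straddles \<open>t\<close> has index
  \<open>upto_time v t\<close>; it becomes the part already elapsed plus the first waiting time of
  \<open>v'\<close>, so the rings after \<open>t\<close> are those of \<open>v'\<close> shifted by
  \<open>t\<close>.\<close>

definition refresh :: "real \<Rightarrow> (nat \<Rightarrow> real) \<Rightarrow> (nat \<Rightarrow> real) \<Rightarrow> nat \<Rightarrow> real" where
  "refresh t v v' =
     comb_seq (upto_time v t) v (v'(0 := t - (\<Sum>k<upto_time v t. v k) + v' 0))"

text \<open>The event splits into a condition on the waiting times before \<open>n\<close> and one
  comparing waiting time \<open>n\<close> with what is left of \<open>t\<close>, the shape to which
  memorylessness applies. The disjunct \<open>n = 0\<close> covers negative \<open>t\<close>, which
  the empty sum would exceed.\<close>

lemma upto_time_eq_iff: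
  assumes "regular_clock w"
  shows "upto_time w t = n \<longleftrightarrow> (n = 0 \<or> (\<Sum>k<n. w k) \<le> t) \<and> t < (\<Sum>k<n. w k) + w n"
proof -
  have *: "upto_time w t = n \<longleftrightarrow> (\<forall>k<n. arrival w k \<le> t) \<and> t < arrival w n"
  proof
    assume "upto_time w t = n"
    then show "(\<forall>k<n. arrival w k \<le> t) \<and> t < arrival w n"
      using less_upto_time_iff[OF assms, of _ t] by (metis less_irrefl not_less)
  next
    assume "(\<forall>k<n. arrival w k \<le> t) \<and> t < arrival w n"
    then have "\<not> n < upto_time w t" "\<forall>k<n. k < upto_time w t"
      using less_upto_time_iff[OF assms, of _ t] by auto
    then show "upto_time w t = n"
      by (metis linorder_neqE_nat less_irrefl)
  qed
  have "(\<Sum>k<n. w k) + w n = arrival w n"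
    by (simp add: arrival_def lessThan_Suc_atMost[symmetric])
  moreover have "(\<forall>k<n. arrival w k \<le> t) \<longleftrightarrow> n = 0 \<or> (\<Sum>k<n. w k) \<le> t"
  proof (cases n)
    case (Suc m)
    have "(\<Sum>k<n. w k) = arrival w m"
      by (simp add: arrival_def Suc lessThan_Suc_atMost[symmetric])
    moreover have "(\<forall>k<n. arrival w k \<le> t) \<longleftrightarrow> arrival w m \<le> t"
      using strict_mono_less_eq[OF strict_mono_arrival[OF assms]] Suc
      by (meson less_Suc_eq_le order_refl order_trans)
    ultimately show ?thesis using Suc by simp
  qed simp
  ultimately show ?thesis using * by simp
qed

lemma measurable_refresh[measurable]:
  "(\<lambda>(v, v'). refresh t v v') \<in> measurable (clock_law \<Otimes>\<^sub>M clock_law) clock_law"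
  unfolding case_prod_beta
proof (rule measurable_compose_countable[where g="\<lambda>z. upto_time (fst z) t"
    and f="\<lambda>n z. comb_seq n (fst z) ((snd z)(0 := t - (\<Sum>k<n. fst z k) + snd z 0))", folded refresh_def])
  show "(\<lambda>z. upto_time (fst z) t) \<in> measurable (clock_law \<Otimes>\<^sub>M clock_law) (count_space UNIV)"
    by measurable
  fix n
  have [measurable]: "(\<lambda>z. (snd z)(0 := t - (\<Sum>k<n. fst z k) + snd z 0))
      \<in> measurable (clock_law \<Otimes>\<^sub>M clock_law) (PiM UNIV (\<lambda>_. borel))"
    by (rule measurable_PiM_single') (auto simp: space_PiM fun_upd_def)
  show "(\<lambda>z. comb_seq n (fst z) ((snd z)(0 := t - (\<Sum>k<n. fst z k) + snd z 0)))
      \<in> measurable (clock_law \<Otimes>\<^sub>M clock_law) clock_law"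
    by measurable
qed

text \<open>Markov property of a Poisson clock. Split by the number \<open>n\<close> of rings up to
  \<open>t\<close>; given the first \<open>n\<close> waiting times, the next one is conditioned to
  exceed the remaining time, and lack of memory replaces its excess and all later waiting times by a
  fresh clock.\<close>

theorem distr_refresh:
  assumes t: "0 \<le> t"
  shows "distr (clock_law \<Otimes>\<^sub>M clock_law) clock_law (\<lambda>(v, v'). refresh t v v') = clock_law"
proof -
  interpret C: prob_space clock_law by (rule prob_space_clock_law)
  have nn: "(\<integral>\<^sup>+v. \<integral>\<^sup>+v'. f (refresh t v v') \<partial>clock_law \<partial>clock_law) = (\<integral>\<^sup>+v. f v \<partial>clock_law)"
    if f[measurable]: "f \<in> borel_measurable clock_law" for f :: "(nat \<Rightarrow> real) \<Rightarrow> ennreal"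
  proof -
    define s where "s n v = (\<Sum>k<n. v k)" for n and v :: "nat \<Rightarrow> real"
    \<comment> \<open>The part of the event that looks only at the first \<open>n\<close> waiting
      times.\<close>
    define b where "b n v = (if n = 0 \<or> s n v \<le> t then 1 else 0 :: ennreal)" for n v
    have [measurable]: "s n \<in> borel_measurable (PiM UNIV (\<lambda>_. borel))" for n
      unfolding s_def by measurable
    have [measurable]: "b n \<in> borel_measurable (PiM UNIV (\<lambda>_. borel))" for n
      unfolding b_def by measurable
    have [measurable]: "(\<lambda>z. (snd z)(0 := t - s n (fst z) + snd z 0))
        \<in> measurable (PiM UNIV (\<lambda>_. borel) \<Otimes>\<^sub>M PiM UNIV (\<lambda>_. borel)) (PiM UNIV (\<lambda>_. borel))" for n
      by (rule measurable_PiM_single') (auto simp: space_PiM fun_upd_def)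
    have [measurable]: "Measurable.pred (PiM UNIV (\<lambda>_. borel)) (\<lambda>x. x n \<in> {t - s n x<..})" for n
      by (simp only: greaterThan_iff) measurable
    have fc[measurable]: "(\<lambda>r. f (comb_seq n a r)) \<in> borel_measurable clock_law" for n a
      by (rule measurable_compose[OF _ f], unfold clock_law_eq)
        (auto intro!: measurable_comb_seq' simp: space_PiM)
    have sp: "s n (comb_seq n a r) = s n a" "comb_seq n a r n = r 0"
      "comb_seq n (comb_seq n a r) x = comb_seq n a x" for n and a r x :: "nat \<Rightarrow> real"
      by (auto simp: s_def comb_seq_def fun_eq_iff)
    have ind: "(\<Sum>n. of_bool (upto_time v t = n) * c) = c" for c :: ennreal and v
      using suminf_finite[of "{upto_time v t}" "\<lambda>n. of_bool (upto_time v t = n) * c"] by simp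
    have ev: "AE v in clock_law. \<forall>n. of_bool (upto_time v t = n) = b n v * indicator {t - s n v<..} (v n)"
      using AE_regular_clock
      by eventually_elim (auto simp: upto_time_eq_iff b_def s_def indicator_def)
    let ?R = "\<lambda>n v v'. f (comb_seq n v (v'(0 := t - s n v + v' 0)))"
    have piece: "(\<integral>\<^sup>+v. of_bool (upto_time v t = n) * (\<integral>\<^sup>+v'. ?R n v v' \<partial>clock_law) \<partial>clock_law)
        = (\<integral>\<^sup>+v. of_bool (upto_time v t = n) * f v \<partial>clock_law)" (is "?lhs = ?rhs") for n
    proof -
      have "?lhs = (\<integral>\<^sup>+v. b n v * indicator {t - s n v<..} (v n) * (\<integral>\<^sup>+v'. ?R n v v' \<partial>clock_law) \<partial>clock_law)"
        by (rule nn_integral_cong_AE, rule eventually_mono[OF ev], simp only:)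
      \<comment> \<open>\<open>a\<close> supplies the first \<open>n\<close> waiting times,
        \<open>r\<close> those from the straddling one on.\<close>
      also have "\<dots> = (\<integral>\<^sup>+a. \<integral>\<^sup>+r. b n a * indicator {t - s n a<..} (r 0)
                        * (\<integral>\<^sup>+v'. f (comb_seq n a (v'(0 := t - s n a + v' 0))) \<partial>clock_law) \<partial>clock_law \<partial>clock_law)"
      proof -
        have inner: "(\<lambda>v. \<integral>\<^sup>+v'. ?R n v v' \<partial>clock_law) \<in> borel_measurable clock_law"
          by (rule C.borel_measurable_nn_integral) measurable
        have "(\<lambda>v. b n v * indicator {t - s n v<..} (v n) * (\<integral>\<^sup>+v'. ?R n v v' \<partial>clock_law)) \<in> borel_measurable clock_law"
          by (rule borel_measurable_times_ennreal[OF _ inner]) measurable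
        from nn_integral_clock_comb[OF this, of n] show ?thesis
          by (simp only: sp b_def)
      qed
      also have "\<dots> = (\<integral>\<^sup>+a. b n a * (\<integral>\<^sup>+r. indicator {t - s n a<..} (r 0)
                        * (\<integral>\<^sup>+v'. f (comb_seq n a (v'(0 := t - s n a + v' 0))) \<partial>clock_law) \<partial>clock_law) \<partial>clock_law)"
        unfolding mult.assoc by (intro nn_integral_cong nn_integral_cmult) measurable
      also have "\<dots> = (\<integral>\<^sup>+a. b n a * (\<integral>\<^sup>+r. indicator {t - s n a<..} (r 0) * f (comb_seq n a r) \<partial>clock_law) \<partial>clock_law)"
      proof (rule nn_integral_cong)
        fix a
        show "b n a * (\<integral>\<^sup>+r. indicator {t - s n a<..} (r 0)
                * (\<integral>\<^sup>+v'. f (comb_seq n a (v'(0 := t - s n a + v' 0))) \<partial>clock_law) \<partial>clock_law)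
            = b n a * (\<integral>\<^sup>+r. indicator {t - s n a<..} (r 0) * f (comb_seq n a r) \<partial>clock_law)"
        proof (cases "b n a = 0")
          case False
          \<comment> \<open>Where \<open>b n a\<close> is nonzero the remaining time is nonnegative;
            for \<open>n = 0\<close> this is the hypothesis on \<open>t\<close>.\<close>
          then have "0 \<le> t - s n a" using t by (auto simp: b_def s_def split: if_splits)
          from nn_integral_clock_memoryless[OF _ this, of "\<lambda>r. f (comb_seq n a r)"]
          show ?thesis by simp
        qed simp
      qed
      also have "\<dots> = (\<integral>\<^sup>+v. b n v * indicator {t - s n v<..} (v n) * f v \<partial>clock_law)"
      proof -
        have "(\<lambda>v. b n v * indicator {t - s n v<..} (v n) * f v) \<in> borel_measurable clock_law"
          by measurable
        from nn_integral_clock_comb[OF this, of n]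
        have "(\<integral>\<^sup>+v. b n v * indicator {t - s n v<..} (v n) * f v \<partial>clock_law)
            = (\<integral>\<^sup>+a. \<integral>\<^sup>+r. b n a * (indicator {t - s n a<..} (r 0) * f (comb_seq n a r)) \<partial>clock_law \<partial>clock_law)"
          by (simp only: sp b_def mult.assoc)
        also have "\<dots> = (\<integral>\<^sup>+a. b n a * (\<integral>\<^sup>+r. indicator {t - s n a<..} (r 0) * f (comb_seq n a r) \<partial>clock_law) \<partial>clock_law)"
          by (intro nn_integral_cong nn_integral_cmult) measurable
        finally show ?thesis by simp
      qed
      also have "\<dots> = ?rhs"
        by (rule nn_integral_cong_AE, rule eventually_mono[OF ev], simp only:)
      finally show ?thesis .
    qed
    have "(\<integral>\<^sup>+v. \<integral>\<^sup>+v'. f (refresh t v v') \<partial>clock_law \<partial>clock_law)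
        = (\<integral>\<^sup>+v. (\<Sum>n. of_bool (upto_time v t = n) * (\<integral>\<^sup>+v'. ?R n v v' \<partial>clock_law)) \<partial>clock_law)"
    proof (rule nn_integral_cong)
      fix v
      have "(\<Sum>n. of_bool (upto_time v t = n) * (\<integral>\<^sup>+v'. ?R n v v' \<partial>clock_law))
          = (\<Sum>n. of_bool (upto_time v t = n) * (\<integral>\<^sup>+v'. ?R (upto_time v t) v v' \<partial>clock_law))"
        by (intro suminf_cong) auto
      then show "(\<integral>\<^sup>+v'. f (refresh t v v') \<partial>clock_law)
          = (\<Sum>n. of_bool (upto_time v t = n) * (\<integral>\<^sup>+v'. ?R n v v' \<partial>clock_law))"
        by (simp only: ind refresh_def s_def)
    qed
    also have "\<dots> = (\<Sum>n. \<integral>\<^sup>+v. of_bool (upto_time v t = n) * (\<integral>\<^sup>+v'. ?R n v v' \<partial>clock_law) \<partial>clock_law)"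
      by (rule nn_integral_suminf) measurable
    also have "\<dots> = (\<Sum>n. \<integral>\<^sup>+v. of_bool (upto_time v t = n) * f v \<partial>clock_law)"
      by (simp only: piece)
    also have "\<dots> = (\<integral>\<^sup>+v. (\<Sum>n. of_bool (upto_time v t = n) * f v) \<partial>clock_law)"
      by (rule nn_integral_suminf[symmetric]) measurable
    finally show ?thesis by (simp only: ind)
  qed
  show ?thesis
  proof (rule measure_eqI)
    fix A assume "A \<in> sets (distr (clock_law \<Otimes>\<^sub>M clock_law) clock_law (\<lambda>(v, v'). refresh t v v'))"
    then have A[measurable]: "A \<in> sets clock_law" by simp
    have "emeasure (distr (clock_law \<Otimes>\<^sub>M clock_law) clock_law (\<lambda>(v, v'). refresh t v v')) A
        = (\<integral>\<^sup>+z. indicator A z \<partial>distr (clock_law \<Otimes>\<^sub>M clock_law) clock_law (\<lambda>(v, v'). refresh t v v'))"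
      by (subst nn_integral_indicator) auto
    also have "\<dots> = (\<integral>\<^sup>+z. indicator A (refresh t (fst z) (snd z)) \<partial>(clock_law \<Otimes>\<^sub>M clock_law))"
      by (subst nn_integral_distr) (auto simp: case_prod_beta)
    also have "\<dots> = (\<integral>\<^sup>+v. \<integral>\<^sup>+v'. indicator A (refresh t v v') \<partial>clock_law \<partial>clock_law)"
    proof (subst C.nn_integral_fst[symmetric])
      have "(\<lambda>z. refresh t (fst z) (snd z)) \<in> measurable (clock_law \<Otimes>\<^sub>M clock_law) clock_law"
        using measurable_refresh[of t] by (simp add: case_prod_beta)
      then show "(\<lambda>z. indicator A (refresh t (fst z) (snd z)) :: ennreal) \<in> borel_measurable (clock_law \<Otimes>\<^sub>M clock_law)"
        by measurable
    qed simp
    also have "\<dots> = emeasure clock_law A" by (subst nn) auto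
    finally show "emeasure (distr (clock_law \<Otimes>\<^sub>M clock_law) clock_law (\<lambda>(v, v'). refresh t v v')) A = emeasure clock_law A" .
  qed simp
qed

context
  fixes t :: real and v v' :: "nat \<Rightarrow> real"
  assumes t: "0 \<le> t" and v: "regular_clock v" and v': "regular_clock v'"
begin

lemma arrival_refresh_less:
  "n < upto_time v t \<Longrightarrow> arrival (refresh t v v') n = arrival v n"
  unfolding arrival_def refresh_def by (intro sum.cong) (auto simp: comb_seq_less)

lemma arrival_refresh_add: "arrival (refresh t v v') (upto_time v t + n) = t + arrival v' n"
proof (induction n)
  case 0
  have "arrival (refresh t v v') (upto_time v t)
      = (\<Sum>k<upto_time v t. refresh t v v' k) + refresh t v v' (upto_time v t)"
    by (simp add: arrival_def lessThan_Suc_atMost[symmetric])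
  also have "(\<Sum>k<upto_time v t. refresh t v v' k) = (\<Sum>k<upto_time v t. v k)"
    by (intro sum.cong) (auto simp: refresh_def comb_seq_less)
  also have "refresh t v v' (upto_time v t) = t - (\<Sum>k<upto_time v t. v k) + v' 0"
    by (simp add: refresh_def comb_seq_def)
  finally show ?case by simp
next
  case (Suc n)
  then show ?case by (simp add: arrival_Suc) (simp add: refresh_def comb_seq_def)
qed

lemma regular_refresh: "regular_clock (refresh t v v')"
proof -
  have "0 < refresh t v v' n" for n
  proof (cases "n < upto_time v t")
    case True then show ?thesis using v by (simp add: refresh_def comb_seq_less regular_clock_def)
  next
    case False
    have "(\<Sum>k<upto_time v t. v k) \<le> t"
      using upto_time_eq_iff[OF v, of t "upto_time v t"] t by auto
    moreover have "0 < v' k" for k using v' by (simp add: regular_clock_def)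
    ultimately show ?thesis using False
      by (auto simp: refresh_def comb_seq_def add_nonneg_pos)
  qed
  moreover have "\<exists>n. s < arrival (refresh t v v') n" for s
  proof -
    obtain n where "s - t < arrival v' n" using v' by (auto simp: regular_clock_def)
    then show ?thesis using arrival_refresh_add[of n] by (intro exI[of _ "upto_time v t + n"]) simp
  qed
  ultimately show ?thesis by (simp add: regular_clock_def)
qed

text \<open>An arrival changed by the restart lies after \<open>t\<close> in both clocks, so every
  count up to a time at most \<open>t\<close> is preserved.\<close>

lemma arrival_refresh_cases:
  "arrival (refresh t v v') n = arrival v n \<or> t < arrival (refresh t v v') n \<and> t < arrival v n"
proof (cases "n < upto_time v t")
  case False
  then have "t < arrival (refresh t v v') n"
    using arrival_refresh_add[of "n - upto_time v t"] arrival_pos[OF v'] by simp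
  then show ?thesis
    using False less_upto_time_iff[OF v, of n t] by auto
qed (simp add: arrival_refresh_less)

lemma upto_time_refresh: "s \<le> t \<Longrightarrow> upto_time (refresh t v v') s = upto_time v s"
proof -
  assume "s \<le> t"
  then have "n < upto_time (refresh t v v') s \<longleftrightarrow> n < upto_time v s" for n
    using arrival_refresh_cases[of n]
    by (auto simp: less_upto_time_iff v regular_refresh)
  then show ?thesis by (metis linorder_neqE_nat less_irrefl)
qed

lemma before_refresh: "s \<le> t \<Longrightarrow> before (refresh t v v') s = before v s"
proof -
  assume "s \<le> t"
  then have "n < before (refresh t v v') s \<longleftrightarrow> n < before v s" for n
    using arrival_refresh_cases[of n]
    by (auto simp: less_before_iff v regular_refresh)
  then show ?thesis by (metis linorder_neqE_nat less_irrefl)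
qed

end

section \<open>Automorphisms of the 3-regular tree\<close>

locale cubic_tree =
  fixes E :: "'v \<Rightarrow> 'v \<Rightarrow> bool"
  assumes tree: "three_regular_tree E"
begin

lemma edge_sym: "E x y \<Longrightarrow> E y x"
  and edge_irrefl: "\<not> E x x"
  and connected: "E\<^sup>*\<^sup>* x y"
  and acyclic: "\<not> is_cycle E xs"
  and card_neighbours: "card (neighbours E x) = 3"
  using tree unfolding three_regular_tree_def by (auto dest: sympD irreflpD)

lemma finite_neighbours: "finite (neighbours E x)"
  using card_neighbours[of x] by (intro card_ge_0_finite) simp

section \<open>Closed walks in a tree\<close>

definition nonbacktracking :: "'v list \<Rightarrow> bool" where
  "nonbacktracking xs \<longleftrightarrow>
     (\<forall>i. Suc i < length xs \<longrightarrow> E (xs ! i) (xs ! Suc i)) \<and>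
     (\<forall>i. Suc (Suc i) < length xs \<longrightarrow> xs ! i \<noteq> xs ! Suc (Suc i))"

text \<open>A repeated inner vertex cuts out a shorter closed walk, again nonbacktracking because
  the condition is local. Without repetition the walk is a cycle in the sense of
  \<open>is_cycle\<close>, once one and two edges are ruled out.\<close>

lemma nonbacktracking_not_closed:
  "nonbacktracking xs \<Longrightarrow> 2 \<le> length xs \<Longrightarrow> hd xs \<noteq> last xs"
proof (induction "length xs" arbitrary: xs rule: less_induct)
  case less
  show ?case
  proof
    assume closed: "hd xs = last xs"
    define n where "n = length xs - 1"
    have len: "length xs = Suc n" "0 < n" using less.prems(2) by (auto simp: n_def)
    have ne: "xs \<noteq> []" using less.prems(2) by auto
    have x0: "xs ! 0 = xs ! n" using closed ne by (simp add: hd_conv_nth last_conv_nth n_def)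
    have edge: "E (xs ! i) (xs ! Suc i)" if "i < n" for i
      using less.prems(1) that len by (auto simp: nonbacktracking_def)
    have dist: "distinct (butlast xs)"
    proof (rule ccontr)
      assume "\<not> distinct (butlast xs)"
      then obtain i j where ij: "i < j" "j < n" "xs ! i = xs ! j"
        unfolding distinct_conv_nth using len by (auto simp: nth_butlast) (metis linorder_neqE_nat)
      define ys where "ys = take (Suc (j - i)) (drop i xs)"
      have ly: "length ys = Suc (j - i)" using ij len by (simp add: ys_def)
      have ny: "ys ! k = xs ! (i + k)" if "k \<le> j - i" for k
        using that ij len by (simp add: ys_def)
      have "nonbacktracking ys"
        using less.prems(1) ly ny ij len by (auto simp: nonbacktracking_def)
      moreover have "hd ys = last ys"
        using ly ny ij by (subst hd_conv_nth, force, subst last_conv_nth, force, simp)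
      ultimately show False
        using less.hyps[of ys] ly ij len by simp
    qed
    \<comment> \<open>One edge would be a loop, and two edges would go out and back.\<close>
    have "n \<noteq> 1" using edge[of 0] x0 edge_irrefl len by auto
    moreover have "n \<noteq> 2" using less.prems(1) x0 len by (auto simp: nonbacktracking_def numeral_2_eq_2)
    ultimately have "3 \<le> length (butlast xs)" using len by simp
    moreover have "successively E (butlast xs)"
      unfolding successively_conv_nth using edge len by (auto simp: nth_butlast)
    moreover have "E (last (butlast xs)) (hd (butlast xs))"
    proof -
      have "butlast xs \<noteq> []" using len by (metis length_butlast length_0_conv diff_Suc_1 less_irrefl)
      then have "last (butlast xs) = xs ! (n - 1)" "hd (butlast xs) = xs ! 0"
        using len by (auto simp: last_conv_nth hd_conv_nth nth_butlast)
      then show ?thesis using edge[of "n - 1"] len x0 by simp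
    qed
    ultimately show False using acyclic[of "butlast xs"] dist by (auto simp: is_cycle_def)
  qed
qed

text \<open>Vertices are addressed by reduced words in three involutions, read from the vertex back to the
  root: the head of a word is the label of the last edge.\<close>

definition words :: "nat list set" where
  "words = {w. set w \<subseteq> {..<3} \<and> distinct_adj w}"

lemma words_Nil[simp]: "[] \<in> words"
  and words_Cons: "i # w \<in> words \<longleftrightarrow> i < 3 \<and> w \<in> words \<and> (w = [] \<or> i \<noteq> hd w)"
  by (cases w; auto simp: words_def)+

lemma words_append: "a @ b \<in> words \<Longrightarrow> a \<in> words" "a @ b \<in> words \<Longrightarrow> b \<in> words"
  by (auto simp: words_def distinct_adj_append_iff)

definition labelling :: "'v \<Rightarrow> (nat \<Rightarrow> 'v) \<Rightarrow> bool" where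
  "labelling x h \<longleftrightarrow> bij_betw h {..<3} (neighbours E x)"

text \<open>The condition \<open>h j = vertex r w\<close> gives every edge the same label from both
  ends, so following a label twice is a return and each label acts as an involution. At the root any
  labelling will do.\<close>

fun vertex :: "'v \<Rightarrow> nat list \<Rightarrow> 'v" where
  "vertex r [] = r"
| "vertex r [i] = (SOME h. labelling r h) i"
| "vertex r (i # j # w) =
     (SOME h. labelling (vertex r (j # w)) h \<and> h j = vertex r w) i"

lemma ex_labelling:
  assumes "y \<in> neighbours E x" "j < 3"
  shows "\<exists>h. labelling x h \<and> h j = y"
proof -
  obtain h where h: "bij_betw h {..<3::nat} (neighbours E x)"
    using finite_same_card_bij[of "{..<3::nat}" "neighbours E x"] finite_neighbours card_neighbours by auto
  then have "y \<in> h ` {..<3}" using assms by (simp add: bij_betw_def)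
  then obtain k where k: "k < 3" "h k = y" by auto
  have "bij_betw (h \<circ> Transposition.transpose j k) {..<3} (neighbours E x)"
    using assms(2) k by (intro bij_betw_trans[OF _ h]) (simp add: bij_betw_transpose_iff)
  then show ?thesis using k by (intro exI[of _ "h \<circ> Transposition.transpose j k"]) (auto simp: labelling_def)
qed

text \<open>The conditional is the reduced product of the generator \<open>i\<close> with
  \<open>w\<close>: a letter equal to the head cancels it, because the edge to the parent carries
  the same label.\<close>

lemma vertex_labelling:
  "w \<in> words \<Longrightarrow> \<exists>h. labelling (vertex r w) h \<and>
     (\<forall>i<3. vertex r (if w \<noteq> [] \<and> i = hd w then tl w else i # w) = h i)"
proof (induction w)
  case Nil
  have "\<exists>h. labelling r h"
    using finite_same_card_bij[of "{..<3::nat}" "neighbours E r"] finite_neighbours card_neighbours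
    by (auto simp: labelling_def)
  from someI_ex[OF this] show ?case by (intro exI[of _ "SOME h. labelling r h"]) simp
next
  case (Cons j w)
  then have jw: "j < 3" "w \<in> words" "w = [] \<or> j \<noteq> hd w" by (auto simp: words_Cons)
  from Cons.IH[OF jw(2)] obtain h where h: "labelling (vertex r w) h"
    "\<forall>i<3. vertex r (if w \<noteq> [] \<and> i = hd w then tl w else i # w) = h i" by blast
  have "(if w \<noteq> [] \<and> j = hd w then tl w else j # w) = j # w" using jw(3) by auto
  with h(2)[rule_format, OF jw(1)] have "vertex r (j # w) = h j" by (simp only:)
  then have "vertex r (j # w) \<in> neighbours E (vertex r w)"
    using h(1) jw(1) by (auto simp: labelling_def bij_betw_def)
  then have "vertex r w \<in> neighbours E (vertex r (j # w))"
    by (auto simp: neighbours_def edge_sym)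
  from someI_ex[OF ex_labelling[OF this jw(1)]]
  show ?case
    by (intro exI[of _ "SOME h. labelling (vertex r (j # w)) h \<and> h j = vertex r w"]) auto
qed

lemma vertex_edge:
  assumes "i # w \<in> words" shows "E (vertex r (i # w)) (vertex r w)" "E (vertex r w) (vertex r (i # w))"
proof -
  from assms have w: "i < 3" "w \<in> words" "w = [] \<or> i \<noteq> hd w" by (auto simp: words_Cons)
  from vertex_labelling[OF w(2), of r] obtain h where h: "labelling (vertex r w) h"
    "\<forall>i<3. vertex r (if w \<noteq> [] \<and> i = hd w then tl w else i # w) = h i" by blast
  have "(if w \<noteq> [] \<and> i = hd w then tl w else i # w) = i # w" using w(3) by auto
  with h(2)[rule_format, OF w(1)] have "vertex r (i # w) = h i" by (simp only:)
  then show "E (vertex r w) (vertex r (i # w))"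
    using h(1) w(1) by (auto simp: labelling_def bij_betw_def neighbours_def)
  then show "E (vertex r (i # w)) (vertex r w)" by (rule edge_sym)
qed

lemma vertex_neq_siblings:
  assumes "i # w \<in> words" "j # w \<in> words" "i \<noteq> j"
  shows "vertex r (i # w) \<noteq> vertex r (j # w)"
proof -
  from assms have w: "i < 3" "j < 3" "w \<in> words" "w = [] \<or> i \<noteq> hd w" "w = [] \<or> j \<noteq> hd w"
    by (auto simp: words_Cons)
  from vertex_labelling[OF w(3), of r] obtain h where h: "labelling (vertex r w) h"
    "\<forall>i<3. vertex r (if w \<noteq> [] \<and> i = hd w then tl w else i # w) = h i" by blast
  have "(if w \<noteq> [] \<and> i = hd w then tl w else i # w) = i # w"
    "(if w \<noteq> [] \<and> j = hd w then tl w else j # w) = j # w" using w(4,5) by auto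
  with h(2)[rule_format, OF w(1)] h(2)[rule_format, OF w(2)]
  have "vertex r (i # w) = h i" "vertex r (j # w) = h j" by (simp_all only:)
  then show ?thesis using h(1) w(1,2) assms(3) by (auto simp: labelling_def bij_betw_def inj_on_def)
qed

lemma vertex_neq_grandparent:
  assumes "i # j # w \<in> words" shows "vertex r (i # j # w) \<noteq> vertex r w"
proof -
  from assms have w: "i < 3" "j < 3" "j # w \<in> words" "i \<noteq> j" by (auto simp: words_Cons)
  from vertex_labelling[OF w(3), of r] obtain h where h: "labelling (vertex r (j # w)) h"
    "\<forall>i<3. vertex r (if j # w \<noteq> [] \<and> i = hd (j # w) then tl (j # w) else i # j # w) = h i" by blast
  have "(if j # w \<noteq> [] \<and> i = hd (j # w) then tl (j # w) else i # j # w) = i # j # w"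
    "(if j # w \<noteq> [] \<and> j = hd (j # w) then tl (j # w) else j # j # w) = w" using w(4) by auto
  with h(2)[rule_format, OF w(1)] h(2)[rule_format, OF w(2)]
  have "vertex r (i # j # w) = h i" "vertex r w = h j" by (simp_all only:)
  then show ?thesis using h(1) w by (auto simp: labelling_def bij_betw_def inj_on_def)
qed

lemma words_dropI: "a @ c \<in> words \<Longrightarrow> drop i a @ c \<in> words"
  by (rule words_append(2)[of "take i a"]) (simp only: append.assoc[symmetric] append_take_drop_id)

text \<open>Two words for one vertex would give a closed nonbacktracking walk: strip the common
  suffix, which is the common stretch next to the root, go down from one word to it and up to the
  other.\<close>

lemma inj_vertex: "inj_on (vertex r) words"
proof (rule inj_onI, rule ccontr)
  fix w w' assume w: "w \<in> words" "w' \<in> words" and eq: "vertex r w = vertex r w'" and neq: "w \<noteq> w'"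
  obtain a b c where abc: "w = a @ c" "w' = b @ c" "a = [] \<or> b = [] \<or> last a \<noteq> last b"
  proof -
    obtain ps as bs where "rev w = ps @ as" "rev w' = ps @ bs" "as = [] \<or> bs = [] \<or> hd as \<noteq> hd bs"
      using longest_common_prefix[of "rev w" "rev w'"] by blast
    then show ?thesis
      by (intro that[of "rev as" "rev ps" "rev bs"]) (auto simp: last_rev rev_swap)
  qed
  define m n where "m = length a" and "n = length b"
  \<comment> \<open>The walk removes the letters of \<open>a\<close> one by one and then restores
    those of \<open>b\<close>; it turns at index \<open>m\<close>.\<close>
  define g where "g i = (if i \<le> m then vertex r (drop i a @ c) else vertex r (drop (m + n - i) b @ c))" for i
  define xs where "xs = map g [0..<Suc (m + n)]"
  have a: "drop i a @ c = a ! i # drop (Suc i) a @ c" if "i < m" for i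
    using that by (simp add: m_def Cons_nth_drop_Suc[symmetric])
  have b: "drop k b @ c = b ! k # drop (Suc k) b @ c" if "k < n" for k
    using that by (simp add: n_def Cons_nth_drop_Suc[symmetric])
  have gm: "g i = vertex r (drop (m + n - i) b @ c)" if "m \<le> i" for i
    using that by (cases "i = m") (auto simp: g_def m_def n_def)
  have wa: "drop i a @ c \<in> words" and wb: "drop i b @ c \<in> words" for i
    using w abc by (auto intro: words_dropI)
  have edges: "E (g i) (g (Suc i))" if "i < m + n" for i
  proof (cases "i < m")
    case True
    then show ?thesis using vertex_edge(1) wa[of i] a[of i] by (simp add: g_def)
  next
    case False
    then have "m + n - Suc i < n" "Suc (m + n - Suc i) = m + n - i" using that by auto
    then show ?thesis using vertex_edge(2) wb[of "m + n - Suc i"] b[of "m + n - Suc i"] gm[of i] gm[of "Suc i"] False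
      by simp
  qed
  have nb: "g i \<noteq> g (Suc (Suc i))" if "Suc i < m + n" for i
  proof -
    consider "Suc i < m" | "Suc i = m" | "m \<le> i" by linarith
    then show ?thesis
    proof cases
      case 1
      then show ?thesis using vertex_neq_grandparent wa[of i] a[of i] a[of "Suc i"] by (simp add: g_def)
    next
      \<comment> \<open>At the turning point the vertex of \<open>c\<close> is entered and left by
        different labels, \<open>last a\<close> and \<open>last b\<close>.\<close>
      case 2
      then have "g i = vertex r (last a # c)"
        using a[of i] by (auto simp: g_def m_def last_conv_nth) (metis diff_Suc_1 last_conv_nth length_0_conv nat.distinct(1))
      moreover have "n - 1 < n" "b \<noteq> []" "a \<noteq> []" using that 2 by (auto simp: n_def m_def)
      moreover have "g (Suc (Suc i)) = vertex r (last b # c)"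
        using gm[of "Suc (Suc i)"] b[of "n - 1"] 2 calculation by (simp add: n_def last_conv_nth)
      moreover have "last a # c \<in> words" "last b # c \<in> words"
      proof -
        have e: "butlast a @ last a # c = a @ c" "butlast b @ last b # c = b @ c"
          using \<open>b \<noteq> []\<close> \<open>a \<noteq> []\<close> by (metis append.assoc append_Cons append_Nil append_butlast_last_id)+
        have "a @ c \<in> words" "b @ c \<in> words" using w abc by simp_all
        then show "last a # c \<in> words" "last b # c \<in> words"
          using words_append(2)[of "butlast a" "last a # c"] words_append(2)[of "butlast b" "last b # c"]
          by (simp_all only: e)
      qed
      ultimately show ?thesis using vertex_neq_siblings abc(3) by metis
    next
      case 3
      let ?k = "m + n - Suc (Suc i)"
      have "Suc ?k < n" "Suc (Suc ?k) = m + n - i" using 3 that by auto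
      then show ?thesis
        using vertex_neq_grandparent[of "b ! ?k" "b ! Suc ?k" "drop (Suc (Suc ?k)) b @ c" r]
          wb[of ?k] b[of ?k] b[of "Suc ?k"] gm[of i] gm[of "Suc (Suc i)"] 3 by simp
    qed
  qed
  have "nonbacktracking xs"
    unfolding nonbacktracking_def using edges nb by (auto simp: xs_def nth_append simp del: upt_Suc)
  moreover have "2 \<le> length xs" using neq abc by (cases a; cases b) (auto simp: xs_def m_def n_def)
  moreover have "hd xs = last xs"
    using eq abc gm[of "m + n"] by (simp add: xs_def last_map hd_map g_def del: upt_Suc)
  ultimately show False using nonbacktracking_not_closed by blast
qed

lemma surj_vertex: "vertex r ` words = UNIV"
proof -
  have "x \<in> vertex r ` words" for x
    using connected[of r x]
  proof (induction rule: rtranclp_induct)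
    case base
    have "vertex r [] \<in> vertex r ` words" by (rule imageI) simp
    then show ?case by simp
  next
    case (step y z)
    then obtain w where w: "w \<in> words" "y = vertex r w" by auto
    from vertex_labelling[OF w(1), of r] obtain h where h: "labelling (vertex r w) h"
      "\<forall>i<3. vertex r (if w \<noteq> [] \<and> i = hd w then tl w else i # w) = h i" by blast
    have "z \<in> neighbours E (vertex r w)" using step w by (simp add: neighbours_def)
    then obtain i where i: "i < 3" "z = h i" using h(1) by (auto simp: labelling_def bij_betw_def)
    then have "z = vertex r (if w \<noteq> [] \<and> i = hd w then tl w else i # w)" using h(2) by simp
    moreover have "(if w \<noteq> [] \<and> i = hd w then tl w else i # w) \<in> words"
      using w(1) i(1) by (cases w) (auto simp: words_Cons)
    ultimately show ?case by blast
  qed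
  then show ?thesis by auto
qed

lemma countable_vertices: "countable (UNIV :: 'v set)"
  using surj_vertex by (metis countable_image countableI_type)

definition adjacent_words :: "nat list \<Rightarrow> nat list \<Rightarrow> bool" where
  "adjacent_words w w' \<longleftrightarrow> (\<exists>i. w' = i # w) \<or> (\<exists>i. w = i # w')"

lemma edge_vertex_iff:
  assumes "w \<in> words" "w' \<in> words"
  shows "E (vertex r w) (vertex r w') \<longleftrightarrow> adjacent_words w w'"
proof
  assume "adjacent_words w w'"
  then show "E (vertex r w) (vertex r w')"
    using assms vertex_edge by (auto simp: adjacent_words_def)
next
  assume edge: "E (vertex r w) (vertex r w')"
  from vertex_labelling[OF assms(1), of r] obtain h where h: "labelling (vertex r w) h"
    "\<forall>i<3. vertex r (if w \<noteq> [] \<and> i = hd w then tl w else i # w) = h i" by blast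
  have "vertex r w' \<in> neighbours E (vertex r w)" using edge by (simp add: neighbours_def)
  then obtain i where i: "i < 3" "vertex r w' = h i" using h(1) by (auto simp: labelling_def bij_betw_def)
  then have "vertex r w' = vertex r (if w \<noteq> [] \<and> i = hd w then tl w else i # w)" using h(2) by simp
  moreover have "(if w \<noteq> [] \<and> i = hd w then tl w else i # w) \<in> words"
    using assms(1) i(1) by (cases w) (auto simp: words_Cons)
  ultimately have "w' = (if w \<noteq> [] \<and> i = hd w then tl w else i # w)"
    using assms(2) by (intro inj_onD[OF inj_vertex])
  then show "adjacent_words w w'"
    by (cases w) (auto simp: adjacent_words_def split: if_splits)
qed

end

text \<open>Multiplying the far end of a word by a generator commutes with the edge moves at its head.\<close>

definition flip_last :: "nat \<Rightarrow> nat list \<Rightarrow> nat list" where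
  "flip_last j w = (if w \<noteq> [] \<and> last w = j then butlast w else w @ [j])"

context cubic_tree
begin

lemma flip_last_words: "w \<in> words \<Longrightarrow> j < 3 \<Longrightarrow> flip_last j w \<in> words"
  by (cases w rule: rev_cases) (auto simp: flip_last_def words_def distinct_adj_append_iff)

lemma flip_last_flip_last: "w \<in> words \<Longrightarrow> flip_last j (flip_last j w) = w"
  by (cases w rule: rev_cases) (auto simp: flip_last_def words_def distinct_adj_append_iff butlast_append)

lemma adjacent_flip_last:
  assumes "adjacent_words w w'" shows "adjacent_words (flip_last j w) (flip_last j w')"
proof -
  have "adjacent_words (flip_last j w) (flip_last j (i # w)) \<and> adjacent_words (flip_last j (i # w)) (flip_last j w)" for i w
    by (cases w) (auto simp: flip_last_def adjacent_words_def)
  then show ?thesis using assms by (auto simp: adjacent_words_def)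
qed

text \<open>\<open>flips u w\<close> is the reduced form of \<open>w @ u\<close>, that is, right
  multiplication by \<open>u\<close> in the free product.\<close>

definition flips :: "nat list \<Rightarrow> nat list \<Rightarrow> nat list" where
  "flips u = fold flip_last u"

lemma flips_words: "set u \<subseteq> {..<3} \<Longrightarrow> w \<in> words \<Longrightarrow> flips u w \<in> words"
  by (induction u arbitrary: w) (auto simp: flips_def flip_last_words)

lemma flips_rev_flips: "set u \<subseteq> {..<3} \<Longrightarrow> w \<in> words \<Longrightarrow> flips (rev u) (flips u w) = w"
  by (induction u arbitrary: w) (auto simp: flips_def flip_last_words flip_last_flip_last)

lemma adjacent_flips: "adjacent_words w w' \<Longrightarrow> adjacent_words (flips u w) (flips u w')"
  by (induction u arbitrary: w w') (auto simp: flips_def adjacent_flip_last)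

lemma flips_Nil: "u \<in> words \<Longrightarrow> flips u [] = u"
  by (induction u rule: rev_induct)
    (auto simp: flips_def flip_last_def words_def distinct_adj_append_iff)

lemma rev_words: "u \<in> words \<Longrightarrow> rev u \<in> words"
  by (auto simp: words_def distinct_adj_rev)

lemma flips_rev_self: "u \<in> words \<Longrightarrow> flips (rev u) u = []"
  using flips_rev_flips[of u "[]"] flips_Nil[of u] by (auto simp: words_def)

definition automorphism :: "('v \<Rightarrow> 'v) \<Rightarrow> bool" where
  "automorphism \<phi> \<longleftrightarrow> bij \<phi> \<and> (\<forall>x y. E (\<phi> x) (\<phi> y) \<longleftrightarrow> E x y)"

text \<open>With vertices read as group elements, \<iota> is inversion and \<open>A y\<close> is
  right multiplication by the inverse of \<open>y\<close>; it carries the pair \<open>r\<close>,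
  \<open>y\<close> to the pair \<open>\<iota> y\<close>, \<open>r\<close>. This is the unimodularity
  behind mass transport. Generators are involutions, so \<open>A y\<close> exchanges the ends of an
  edge at \<open>r\<close>.\<close>

lemma inversion:
  fixes r :: 'v
  obtains \<iota> :: "'v \<Rightarrow> 'v" and A :: "'v \<Rightarrow> 'v \<Rightarrow> 'v" where "bij \<iota>" "\<And>y. automorphism (A y)"
    "\<And>y. A y r = \<iota> y" "\<And>y. A y y = r" "\<And>y. E r y \<Longrightarrow> \<iota> y = y"
proof -
  define wd where "wd = inv_into words (vertex r)"
  have wd[simp]: "wd x \<in> words" "vertex r (wd x) = x" for x
    using surj_vertex[of r] by (auto simp: wd_def inv_into_into f_inv_into_f)
  have wv[simp]: "wd (vertex r w) = w" if "w \<in> words" for w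
    using that inj_vertex by (simp add: wd_def)
  have wr: "wd r = []" using wv[of "[]"] by simp
  define \<iota> where "\<iota> y = vertex r (rev (wd y))" for y
  define A where "A y x = vertex r (flips (rev (wd y)) (wd x))" for y x
  have st: "set (rev (wd y)) \<subseteq> {..<3}" "set (wd y) \<subseteq> {..<3}" for y
    using wd(1)[of y] by (auto simp: words_def)
  have ii: "\<iota> (\<iota> y) = y" for y by (simp add: \<iota>_def rev_words)
  have bi: "bij \<iota>" by (rule o_bij[of \<iota>]) (auto simp: fun_eq_iff ii)
  have bA: "bij (A y)" for y
  proof (rule bij_betw_byWitness[where f'="\<lambda>x. vertex r (flips (wd y) (wd x))"])
    have "vertex r (flips (wd y) (wd (A y a))) = a" for a
      using flips_rev_flips[OF st(1)[of y], of "wd a"] flips_words[OF st(1)[of y], of "wd a"] by (simp add: A_def)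
    then show "\<forall>a\<in>UNIV. vertex r (flips (wd y) (wd (A y a))) = a" by simp
    have "A y (vertex r (flips (wd y) (wd a))) = a" for a
      using flips_rev_flips[OF st(2)[of y], of "wd a"] flips_words[OF st(2)[of y], of "wd a"] by (simp add: A_def)
    then show "\<forall>a\<in>UNIV. A y (vertex r (flips (wd y) (wd a))) = a" by simp
  qed auto
  have "E (A y a) (A y b) \<longleftrightarrow> E a b" for y a b
  proof -
    have "E a b \<longleftrightarrow> adjacent_words (wd a) (wd b)"
      using edge_vertex_iff[of "wd a" "wd b" r] by simp
    also have "\<dots> \<longleftrightarrow> adjacent_words (flips (rev (wd y)) (wd a)) (flips (rev (wd y)) (wd b))"
      using adjacent_flips flips_rev_flips[OF st(1)[of y]] wd(1) by metis
    also have "\<dots> \<longleftrightarrow> E (A y a) (A y b)"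
      using edge_vertex_iff[of "flips (rev (wd y)) (wd a)" "flips (rev (wd y)) (wd b)" r]
        flips_words[OF st(1)] wd(1) by (simp add: A_def)
    finally show ?thesis by simp
  qed
  then have aA: "automorphism (A y)" for y using bA by (simp add: automorphism_def)
  show thesis
  proof (rule that[OF bi aA])
    show "A y r = \<iota> y" for y by (simp add: A_def \<iota>_def wr flips_Nil rev_words)
    show "A y y = r" for y by (simp add: A_def flips_rev_self)
    show "\<iota> y = y" if "E r y" for y
    proof -
      have "adjacent_words [] (wd y)"
        using edge_vertex_iff[of "[]" "wd y" r] that by simp
      then obtain i where "wd y = [i]" by (auto simp: adjacent_words_def)
      then show ?thesis using wd(2)[of y] by (simp add: \<iota>_def)
    qed
  qed
qed

end

section \<open>Medians and the graphical construction\<close>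

definition med3 :: "'a::linorder \<Rightarrow> 'a \<Rightarrow> 'a \<Rightarrow> 'a" where
  "med3 a b c = max (min a b) (min (max a b) c)"

lemma med3_le_iff: "med3 a b c \<le> u \<longleftrightarrow> a \<le> u \<and> b \<le> u \<or> a \<le> u \<and> c \<le> u \<or> b \<le> u \<and> c \<le> u"
  by (auto simp: med3_def min_le_iff_disj)

lemma le_med3_iff: "u \<le> med3 a b c \<longleftrightarrow> u \<le> a \<and> u \<le> b \<or> u \<le> a \<and> u \<le> c \<or> u \<le> b \<and> u \<le> c"
  by (auto simp: med3_def le_max_iff_disj)

lemma downward_med3_iff:
  fixes P :: "'a::linorder \<Rightarrow> bool"
  assumes P: "\<And>a b. a \<le> b \<Longrightarrow> P b \<Longrightarrow> P a"
  shows "P (med3 a b c) \<longleftrightarrow> P a \<and> P b \<or> P a \<and> P c \<or> P b \<and> P c"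
proof -
  have "P (max x y) \<longleftrightarrow> P x \<and> P y" "P (min x y) \<longleftrightarrow> P x \<or> P y" for x y
    using P[of x y] P[of y x] linorder_linear[of x y] by (auto simp: max_def min_def)
  then show ?thesis by (auto simp: med3_def)
qed

context cubic_tree
begin

text \<open>A chosen order of the neighbours turns the median into a formula; \<open>med_eq\<close>
  shows that the order is immaterial.\<close>

definition nbr_triple :: "'v \<Rightarrow> 'v \<times> 'v \<times> 'v" where
  "nbr_triple x = (SOME (a, b, c). neighbours E x = {a, b, c} \<and> a \<noteq> b \<and> a \<noteq> c \<and> b \<noteq> c)"

lemma nbr_triple:
  obtains a b c where "nbr_triple x = (a, b, c)" "neighbours E x = {a, b, c}" "a \<noteq> b" "a \<noteq> c" "b \<noteq> c"
proof -
  obtain a b c where "neighbours E x = {a, b, c} \<and> a \<noteq> b \<and> a \<noteq> c \<and> b \<noteq> c"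
    using card_neighbours[of x] unfolding card_3_iff by blast
  then have "\<exists>t. case t of (a, b, c) \<Rightarrow> neighbours E x = {a, b, c} \<and> a \<noteq> b \<and> a \<noteq> c \<and> b \<noteq> c"
    by auto
  from someI_ex[OF this] show ?thesis
    by (auto simp: nbr_triple_def[symmetric] intro: that split: prod.splits)
qed

definition med :: "('v \<Rightarrow> 'a::linorder) \<Rightarrow> 'v \<Rightarrow> 'a" where
  "med m x = (case nbr_triple x of (a, b, c) \<Rightarrow> med3 (m a) (m b) (m c))"

lemma med_eq:
  assumes "neighbours E x = {a, b, c}" "a \<noteq> b" "a \<noteq> c" "b \<noteq> c"
  shows "med m x = med3 (m a) (m b) (m c)"
proof (rule nbr_triple[of x])
  fix a' b' c' assume *: "nbr_triple x = (a', b', c')" "neighbours E x = {a', b', c'}" "a' \<noteq> b'" "a' \<noteq> c'" "b' \<noteq> c'"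
  then have "a' \<in> {a, b, c}" "b' \<in> {a, b, c}" "c' \<in> {a, b, c}"
    using assms(1) by auto
  then have "(a' = a \<and> b' = b \<and> c' = c) \<or> (a' = a \<and> b' = c \<and> c' = b) \<or> (a' = b \<and> b' = a \<and> c' = c)
    \<or> (a' = b \<and> b' = c \<and> c' = a) \<or> (a' = c \<and> b' = a \<and> c' = b) \<or> (a' = c \<and> b' = b \<and> c' = a)"
    using *(3-5) by auto
  moreover have "med m x = med3 (m a') (m b') (m c')"
    by (simp add: med_def *(1))
  ultimately show ?thesis
    by (auto simp: order_eq_iff med3_le_iff le_med3_iff)
qed

lemma nbrs_cases:
  obtains a b c where "neighbours E x = {a, b, c}" "a \<noteq> b" "a \<noteq> c" "b \<noteq> c"
  by (rule nbr_triple[of x]) (auto intro: that)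

lemma med_cong: "(\<And>y. y \<in> neighbours E x \<Longrightarrow> m y = m' y) \<Longrightarrow> med m x = med m' x"
  by (rule nbrs_cases[of x]) (auto simp: med_eq)

lemma med_in: "\<exists>y\<in>neighbours E x. med m x = m y"
  by (rule nbrs_cases[of x]) (simp add: med_eq, simp add: med3_def max_def min_def)

text \<open>The median is \<open>u\<close> exactly when at least two values are
  \<open>\<le> u\<close> and at least two are \<open>\<ge> u\<close>; both survive if no neighbour
  crosses \<open>u\<close>.\<close>

lemma med_stable:
  assumes "med m x = u"
    and "\<And>y. y \<in> neighbours E x \<Longrightarrow> m y \<le> u \<Longrightarrow> m' y \<le> u"
    and "\<And>y. y \<in> neighbours E x \<Longrightarrow> u \<le> m y \<Longrightarrow> u \<le> m' y"
  shows "med m' x = u"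
proof (rule nbrs_cases[of x])
  fix a b c assume N: "neighbours E x = {a, b, c}" "a \<noteq> b" "a \<noteq> c" "b \<noteq> c"
  note * = N(1) med_eq[OF N]
  have le: "m a \<le> u \<longrightarrow> m' a \<le> u" "m b \<le> u \<longrightarrow> m' b \<le> u" "m c \<le> u \<longrightarrow> m' c \<le> u"
    and ge: "u \<le> m a \<longrightarrow> u \<le> m' a" "u \<le> m b \<longrightarrow> u \<le> m' b" "u \<le> m c \<longrightarrow> u \<le> m' c"
    using assms(2,3) * by auto
  have m: "med3 (m a) (m b) (m c) \<le> u" "u \<le> med3 (m a) (m b) (m c)"
    using assms(1) by (simp_all add: *)
  have "med3 (m' a) (m' b) (m' c) \<le> u" using m(1) le unfolding med3_le_iff by argo
  moreover have "u \<le> med3 (m' a) (m' b) (m' c)" using m(2) ge unfolding le_med3_iff by argo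
  ultimately show ?thesis by (simp add: *)
qed

text \<open>The median of three lies between any two of them; distinct values ensure that
  \<open>y\<close> and \<open>z\<close> are two different neighbours. It prevents a vertex next to
  the trace from jumping across its value.\<close>

lemma med_between:
  assumes "y \<in> neighbours E x" "z \<in> neighbours E x" "m y \<noteq> m z"
  shows "min (m y) (m z) \<le> med m x \<and> med m x \<le> max (m y) (m z)"
proof (rule nbrs_cases[of x])
  fix a b c assume N: "neighbours E x = {a, b, c}" "a \<noteq> b" "a \<noteq> c" "b \<noteq> c"
  note * = N(1) med_eq[OF N]
  have "y \<in> {a, b, c}" "z \<in> {a, b, c}" "y \<noteq> z" using assms * by auto
  then have "y = a \<and> z = b \<or> y = a \<and> z = c \<or> y = b \<and> z = a \<or> y = b \<and> z = c \<or> y = c \<and> z = a \<or> y = c \<and> z = b"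
    by auto
  then show ?thesis
    by (elim disjE conjE; hypsubst) (unfold *(2) med3_le_iff le_med3_iff, simp_all)
qed

text \<open>The energy inequality of a single ring. The median is attained by a neighbour, and if
  two neighbours agree it is their common value; so no value occurs more often, and a value that
  does not occur at all is strictly beaten.\<close>

lemma card_agree_med:
  "card {y \<in> neighbours E x. m y = a} + of_bool (\<forall>y\<in>neighbours E x. m y \<noteq> a)
     \<le> card {y \<in> neighbours E x. m y = med m x}"
proof (rule nbrs_cases[of x])
  fix a' b c assume N: "neighbours E x = {a', b, c}" "a' \<noteq> b" "a' \<noteq> c" "b \<noteq> c"
  note * = N(1) med_eq[OF N] N(2-4)
  have "{y \<in> neighbours E x. m y = v} = (if m a' = v then {a'} else {}) \<union> (if m b = v then {b} else {}) \<union> (if m c = v then {c} else {})" for v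
    using * by auto
  then have **: "card {y \<in> neighbours E x. m y = v} = of_bool (m a' = v) + of_bool (m b = v) + of_bool (m c = v)" for v
    using * by auto
  show ?thesis unfolding ** *(2) using N by (auto simp: med3_def max_def min_def)
qed

lemma majority_cong: "(\<And>y. y \<in> neighbours E x \<Longrightarrow> m y = m' y) \<Longrightarrow> majority E m x = majority E m' x"
  unfolding majority_def by (intro if_cong arg_cong2[where f="(<)"] arg_cong[where f=card]) auto

text \<open>The median lies in a down-set exactly when at least two of the three values do, and
  three neighbours cannot tie.\<close>

lemma majority_threshold:
  fixes P :: "'a::linorder \<Rightarrow> bool"
  assumes P: "\<And>a b. a \<le> b \<Longrightarrow> P b \<Longrightarrow> P a"
  shows "majority E (\<lambda>y. if P (m y) then 1 else - 1) x = (if P (med m x) then 1 else - 1)"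
proof (rule nbrs_cases[of x])
  fix a b c assume N: "neighbours E x = {a, b, c}" "a \<noteq> b" "a \<noteq> c" "b \<noteq> c"
  note * = N(1) med_eq[OF N] N(2-4)
  have "{y \<in> neighbours E x. Q y} = (if Q a then {a} else {}) \<union> (if Q b then {b} else {}) \<union> (if Q c then {c} else {})" for Q
    using * by auto
  then have **: "card {y \<in> neighbours E x. Q y} = of_bool (Q a) + of_bool (Q b) + of_bool (Q c)" for Q
    using * by auto
  have dm: "P (med3 p q r) \<longleftrightarrow> P p \<and> P q \<or> P p \<and> P r \<or> P q \<and> P r" for p q r
    by (rule downward_med3_iff) (rule P)
  show ?thesis unfolding majority_def ** *(2) dm
    by (cases "P (m a)"; cases "P (m b)"; cases "P (m c)") auto
qed

text \<open>Spins are indexed by the number of rings the vertex has had, not by time: ring number \<open>n\<close> (counted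
  from 0) of \<open>x\<close> reads each neighbour \<open>y\<close> at its own ring count at that moment. The natural number in
  front of the vertex is fuel; \<open>settled\<close> says that it suffices for the backward recursion.\<close>

fun state :: "(('v \<Rightarrow> 'a) \<Rightarrow> 'v \<Rightarrow> 'a) \<Rightarrow> ('v \<Rightarrow> 'a) \<Rightarrow> ('v \<Rightarrow> nat \<Rightarrow> real) \<Rightarrow> nat \<Rightarrow> 'v \<Rightarrow> nat \<Rightarrow> 'a" where
  "state f i w 0 x n = i x"
| "state f i w (Suc m) x 0 = i x"
| "state f i w (Suc m) x (Suc n) = f (\<lambda>y. state f i w m y (before (w y) (arrival (w x) n))) x"

fun settled :: "('v \<Rightarrow> nat \<Rightarrow> real) \<Rightarrow> nat \<Rightarrow> 'v \<Rightarrow> nat \<Rightarrow> bool" where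
  "settled w 0 x n \<longleftrightarrow> False"
| "settled w (Suc m) x 0 \<longleftrightarrow> True"
| "settled w (Suc m) x (Suc n) \<longleftrightarrow>
     (\<forall>y\<in>neighbours E x. settled w m y (before (w y) (arrival (w x) n)))"

definition depth :: "('v \<Rightarrow> nat \<Rightarrow> real) \<Rightarrow> 'v \<Rightarrow> nat \<Rightarrow> nat" where
  "depth w x n = (LEAST m. settled w m x n)"

definition spin :: "(('v \<Rightarrow> 'a) \<Rightarrow> 'v \<Rightarrow> 'a) \<Rightarrow> ('v \<Rightarrow> 'a) \<Rightarrow> ('v \<Rightarrow> nat \<Rightarrow> real) \<Rightarrow> 'v \<Rightarrow> nat \<Rightarrow> 'a" where
  "spin f i w x n = state f i w (depth w x n) x n"

definition good :: "('v \<Rightarrow> nat \<Rightarrow> real) \<Rightarrow> bool" where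
  "good w \<longleftrightarrow> (\<forall>x. regular_clock (w x)) \<and>
     (\<forall>x y m n. x \<noteq> y \<longrightarrow> arrival (w x) m \<noteq> arrival (w y) n) \<and>
     (\<forall>x n. \<exists>m. settled w m x n)"

text \<open>Lets one recursion serve both \<open>med\<close> and \<open>majority E\<close>.\<close>

definition local_rule :: "(('v \<Rightarrow> 'a) \<Rightarrow> 'v \<Rightarrow> 'a) \<Rightarrow> bool" where
  "local_rule f \<longleftrightarrow> (\<forall>m m' x. (\<forall>y\<in>neighbours E x. m y = m' y) \<longrightarrow> f m x = f m' x)"

lemma local_rule_med: "local_rule med"
  unfolding local_rule_def by (auto intro: med_cong)

lemma local_rule_majority: "local_rule (majority E)"
  unfolding local_rule_def by (auto intro: majority_cong)

lemma settled_Suc: "settled w m x n \<Longrightarrow> settled w (Suc m) x n"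
proof (induction m arbitrary: x n)
  case (Suc m) then show ?case by (cases n) auto
qed simp

lemma settled_mono: "settled w m x n \<Longrightarrow> m \<le> m' \<Longrightarrow> settled w m' x n"
  by (rotate_tac, induction rule: dec_induct) (auto intro: settled_Suc)

lemma before_mono:
  assumes "regular_clock v" "s \<le> t" shows "before v s \<le> before v t"
proof (rule ccontr)
  assume "\<not> ?thesis"
  then have "arrival v (before v t) < s" using less_before_iff[OF assms(1), of "before v t" s] by simp
  then show False using less_before_iff[OF assms(1), of "before v t" t] assms(2) by simp
qed

lemma settled_le:
  assumes "\<forall>x. regular_clock (w x)"
  shows "settled w m x n \<Longrightarrow> n' \<le> n \<Longrightarrow> settled w m x n'"
proof (induction m arbitrary: x n n')
  case (Suc m)
  show ?case
  proof (cases n')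
    case (Suc k')
    then obtain k where k: "n = Suc k" "k' \<le> k" using Suc.prems(2) by (cases n) auto
    have "arrival (w x) k' \<le> arrival (w x) k"
      using k assms strict_mono_arrival strict_mono_less_eq by blast
    then show ?thesis
      using Suc.prems(1) k \<open>n' = Suc k'\<close> Suc.IH before_mono assms by fastforce
  qed simp
qed simp

lemma state_settled:
  assumes "local_rule f"
  shows "settled w m x n \<Longrightarrow> settled w m' x n \<Longrightarrow> state f i w m x n = state f i w m' x n"
proof (induction m arbitrary: m' x n)
  case (Suc m)
  then obtain k where k: "m' = Suc k" by (cases m') auto
  show ?case
  proof (cases n)
    case (Suc l)
    have "state f i w m y (before (w y) (arrival (w x) l)) = state f i w k y (before (w y) (arrival (w x) l))"
      if "y \<in> neighbours E x" for y
      using that Suc.prems k Suc by (intro Suc.IH) auto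
    then show ?thesis using assms k Suc by (simp add: local_rule_def)
  qed (simp add: k)
qed simp

lemma settled_depth: "good w \<Longrightarrow> settled w (depth w x n) x n"
  unfolding depth_def good_def by (auto intro: LeastI_ex)

lemma spin_settled: "local_rule f \<Longrightarrow> good w \<Longrightarrow> settled w m x n \<Longrightarrow> spin f i w x n = state f i w m x n"
  unfolding spin_def by (rule state_settled) (auto intro: settled_depth)

lemma spin_0[simp]: "spin f i w x 0 = i x"
  unfolding spin_def by (cases "depth w x 0") auto

lemma spin_Suc:
  assumes "local_rule f" "good w"
  shows "spin f i w x (Suc n) = f (\<lambda>y. spin f i w y (before (w y) (arrival (w x) n))) x"
proof -
  obtain m where m: "depth w x (Suc n) = Suc m"
    using settled_depth[OF assms(2), of x "Suc n"] by (cases "depth w x (Suc n)") auto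
  have "settled w m y (before (w y) (arrival (w x) n))" if "y \<in> neighbours E x" for y
    using settled_depth[OF assms(2), of x "Suc n"] m that by simp
  then have "\<forall>y\<in>neighbours E x. state f i w m y (before (w y) (arrival (w x) n)) = spin f i w y (before (w y) (arrival (w x) n))"
    by (intro ballI spin_settled[OF assms, symmetric])
  then show ?thesis
    using assms(1) unfolding spin_def[of f i w x] m local_rule_def by simp
qed

text \<open>Induction along the backward recursion. The hypothesis holds for all ring counts of a
  neighbour up to the one that is read, since \<open>settled_le\<close> passes to smaller counts;
  persistence of the trace value relies on these intermediate counts.\<close>

lemma good_induct[consumes 1, case_names 0 Suc]:
  assumes w: "good w" and 0: "\<And>x. P x 0"
    and Suc: "\<And>x n. (\<And>y k. y \<in> neighbours E x \<Longrightarrow> k \<le> before (w y) (arrival (w x) n) \<Longrightarrow> P y k) \<Longrightarrow> P x (Suc n)"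
  shows "P x n"
proof -
  have "settled w m x n \<Longrightarrow> P x n" for m
  proof (induction m arbitrary: x n)
    case (Suc m)
    show ?case
    proof (cases n)
      case (Suc k)
      show ?thesis unfolding Suc
      proof (rule assms(3))
        fix y l assume "y \<in> neighbours E x" "l \<le> before (w y) (arrival (w x) k)"
        then show "P y l"
          using Suc.prems Suc w by (intro Suc.IH settled_le[of w m y _ l]) (auto simp: good_def)
      qed
    qed (simp add: 0)
  qed simp
  then show ?thesis using settled_depth[OF w] by blast
qed

text \<open>One median process contains the majority dynamics of all levels. Arbitrary down-sets
  cover both \<open>a \<le> p\<close> and \<open>a < p\<close>.\<close>

lemma spin_threshold:
  fixes P :: "'a::linorder \<Rightarrow> bool"
  assumes w: "good w" and P: "\<And>a b. a \<le> b \<Longrightarrow> P b \<Longrightarrow> P a"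
  shows "spin (majority E) (\<lambda>x. if P (i x) then 1 else - 1) w x n = (if P (spin med i w x n) then 1 else - 1)"
  using w
proof (induction x n rule: good_induct)
  case (Suc x n)
  have "spin (majority E) (\<lambda>x. if P (i x) then 1 else - 1) w x (Suc n)
      = majority E (\<lambda>y. if P (spin med i w y (before (w y) (arrival (w x) n))) then 1 else - 1) x"
    unfolding spin_Suc[OF local_rule_majority w] by (rule majority_cong) (rule Suc, auto)
  also have "\<dots> = (if P (spin med i w x (Suc n)) then 1 else - 1)"
    unfolding spin_Suc[OF local_rule_med w] by (rule majority_threshold) (rule P)
  finally show ?case .
qed simp

section \<open>Ring counts as functions of real time\<close>

lemma upto_before_between:
  assumes "regular_clock v" "0 \<le> a" "a \<le> b" "\<And>n. \<not> (a < arrival v n \<and> arrival v n \<le> b)"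
  shows "upto_time v a = upto_time v b"
proof -
  have "n < upto_time v a \<longleftrightarrow> n < upto_time v b" for n
    using assms by (auto simp: less_upto_time_iff) (meson not_le)
  then show ?thesis by (metis linorder_neqE_nat less_irrefl)
qed

lemma upto_time_neg:
  assumes "regular_clock v" "t \<le> 0" shows "upto_time v t = 0"
  using less_upto_time_iff[OF assms(1), of 0 t] arrival_pos[OF assms(1), of 0] assms(2)
  by (metis gr0I not_less order_less_le_trans)

lemma upto_time_arrival:
  assumes "regular_clock v" shows "upto_time v (arrival v n) = Suc n"
proof -
  have "k < upto_time v (arrival v n) \<longleftrightarrow> k < Suc n" for k
    using strict_mono_less_eq[OF strict_mono_arrival[OF assms]] by (simp add: less_upto_time_iff assms less_Suc_eq_le)
  then show ?thesis by (metis linorder_neqE_nat less_irrefl)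
qed

lemma before_arrival:
  assumes "regular_clock v" shows "before v (arrival v n) = n"
proof -
  have "k < before v (arrival v n) \<longleftrightarrow> k < n" for k
    using strict_mono_less[OF strict_mono_arrival[OF assms]] by (simp add: less_before_iff assms)
  then show ?thesis by (metis linorder_neqE_nat less_irrefl)
qed

text \<open>From the last ring before \<open>t\<close> up to \<open>t\<close> the ring count equals
  \<open>before v t\<close>, so a function of the ring count is constant there.\<close>

lemma left_limit_step:
  assumes v: "regular_clock v" and t: "0 < t"
    and g: "\<And>s. 0 \<le> s \<Longrightarrow> s < t \<Longrightarrow> before v t = upto_time v s \<Longrightarrow> g s = (c :: int)"
  shows "Lim (at_left t) g = c"
proof -
  \<comment> \<open>Without a ring before \<open>t\<close> the interval starts at 0, because
    \<open>g\<close> is known only at nonnegative times.\<close>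
  define a where "a = (if before v t = 0 then 0 else arrival v (before v t - 1))"
  have a: "0 \<le> a" "a < t"
    using t arrival_pos[OF v] less_before_iff[OF v, of "before v t - 1" t] by (auto simp: a_def intro: less_imp_le)
  have "eventually (\<lambda>s. a < s \<and> s < t) (at_left t)"
    using a by (simp add: eventually_at_left_field) blast
  then have "eventually (\<lambda>s. g s = c) (at_left t)"
  proof eventually_elim
    case (elim s)
    have "n < upto_time v s \<longleftrightarrow> n < before v t" for n
    proof
      assume "n < before v t"
      then have "arrival v n \<le> a"
        using strict_mono_less_eq[OF strict_mono_arrival[OF v]] by (auto simp: a_def)
      then show "n < upto_time v s" using elim by (simp add: less_upto_time_iff v)
    next
      assume "n < upto_time v s"
      then show "n < before v t" using elim by (simp add: less_upto_time_iff less_before_iff v)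
    qed
    then have "before v t = upto_time v s" by (metis linorder_neqE_nat less_irrefl)
    then show ?case using g[of s] elim a by simp
  qed
  then have "(g \<longlongrightarrow> c) (at_left t)"
    by (rule tendsto_eventually)
  then show ?thesis by (rule tendsto_Lim[OF trivial_limit_at_left_real])
qed

text \<open>Existence checks the three clauses. For uniqueness the clauses determine the value at
  each ring count by induction along the backward recursion, whose termination is part of
  \<open>good\<close>.\<close>

theorem glauber_eq_spin:
  assumes w: "good w"
  shows "glauber E w s = (\<lambda>x t. spin (majority E) s w x (upto_time (w x) t))"
  unfolding glauber_def
proof (rule the_equality)
  have reg: "regular_clock (w x)" for x using w by (simp add: good_def)
  have inr: "t \<in> ring_times (w x) \<longleftrightarrow> (\<exists>n. t = arrival (w x) n)" for t x
    by (auto simp: ring_times_arrival)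
  show "majority_evolution E w s (\<lambda>x t. spin (majority E) s w x (upto_time (w x) t))"
    unfolding majority_evolution_def
  proof (intro conjI allI impI ballI)
    fix x and t :: real assume "t \<le> 0"
    then show "spin (majority E) s w x (upto_time (w x) t) = s x" by (simp add: upto_time_neg reg)
  next
    fix x and a b :: real assume "0 \<le> a \<and> a \<le> b \<and> ring_times (w x) \<inter> {a<..b} = {}"
    then have ab: "0 \<le> a" "a \<le> b" and disj: "ring_times (w x) \<inter> {a<..b} = {}" by simp_all
    have "arrival (w x) n \<notin> {a<..b}" for n
    proof
      assume "arrival (w x) n \<in> {a<..b}"
      moreover have "arrival (w x) n \<in> ring_times (w x)" by (simp add: ring_times_arrival)
      ultimately have "arrival (w x) n \<in> ring_times (w x) \<inter> {a<..b}" by (rule IntI[rotated])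
      then show False unfolding disj by (rule emptyE)
    qed
    then have "upto_time (w x) a = upto_time (w x) b"
      using ab by (intro upto_before_between reg) simp_all
    then show "spin (majority E) s w x (upto_time (w x) b) = spin (majority E) s w x (upto_time (w x) a)"
      by simp
  next
    fix x t assume "t \<in> ring_times (w x)"
    then obtain n where n: "t = arrival (w x) n" by (auto simp: inr)
    have "Lim (at_left t) (\<lambda>t. spin (majority E) s w y (upto_time (w y) t)) = spin (majority E) s w y (before (w y) t)" for y
      using arrival_pos[OF reg] by (intro left_limit_step[OF reg[of y]]) (auto simp: n)
    then show "spin (majority E) s w x (upto_time (w x) t)
        = majority E (\<lambda>y. Lim (at_left t) (\<lambda>t. spin (majority E) s w y (upto_time (w y) t))) x"
      by (simp add: n upto_time_arrival reg spin_Suc local_rule_majority w)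
  qed
  fix \<sigma> assume ev: "majority_evolution E w s \<sigma>"
  have "\<forall>t\<ge>0. upto_time (w x) t = n \<longrightarrow> \<sigma> x t = spin (majority E) s w x n" for x n
    using w
  proof (induction x n rule: good_induct)
    case (0 x)
    show ?case
    proof (intro allI impI)
      fix t :: real assume t: "0 \<le> t" "upto_time (w x) t = 0"
      have "ring_times (w x) \<inter> {0<..t} = {}"
        using t less_upto_time_iff[OF reg, of _ x t] by (auto simp: ring_times_arrival)
      then have "\<sigma> x t = \<sigma> x 0" using ev t unfolding majority_evolution_def by blast
      also have "\<dots> = s x" using ev unfolding majority_evolution_def by simp
      finally show "\<sigma> x t = spin (majority E) s w x 0" by simp
    qed
  next
    case (Suc x n)
    show ?case
    proof (intro allI impI)
      fix t :: real assume t: "0 \<le> t" "upto_time (w x) t = Suc n"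
      let ?r = "arrival (w x) n"
      have r: "?r \<le> t" using t less_upto_time_iff[OF reg, of n x t] by simp
      have "ring_times (w x) \<inter> {?r<..t} = {}"
      proof -
        have "\<not> (?r < arrival (w x) k \<and> arrival (w x) k \<le> t)" for k
          using t less_upto_time_iff[OF reg, of k x t] strict_mono_less[OF strict_mono_arrival[OF reg[of x]], of n k] by auto
        then show ?thesis by (auto simp: ring_times_arrival)
      qed
      then have "\<sigma> x t = \<sigma> x ?r"
        using ev r arrival_pos[OF reg, of x n] unfolding majority_evolution_def by (meson less_imp_le)
      also have "\<dots> = majority E (\<lambda>y. Lim (at_left ?r) (\<sigma> y)) x"
      proof -
        have "?r \<in> ring_times (w x)" by (simp add: ring_times_arrival)
        then show ?thesis using ev unfolding majority_evolution_def by blast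
      qed
      also have "\<dots> = majority E (\<lambda>y. spin (majority E) s w y (before (w y) ?r)) x"
      proof (rule majority_cong)
        fix y assume "y \<in> neighbours E x"
        then show "Lim (at_left ?r) (\<sigma> y) = spin (majority E) s w y (before (w y) ?r)"
          using Suc[of y "before (w y) ?r"] arrival_pos[OF reg] by (intro left_limit_step[OF reg[of y]]) auto
      qed
      finally show "\<sigma> x t = spin (majority E) s w x (Suc n)"
        by (simp add: spin_Suc local_rule_majority w)
    qed
  qed
  moreover have "\<sigma> x t = spin (majority E) s w x (upto_time (w x) t)" if "t < 0" for x t
    using ev that unfolding majority_evolution_def by (simp add: upto_time_neg reg)
  ultimately show "\<sigma> = (\<lambda>x t. spin (majority E) s w x (upto_time (w x) t))"
    by (intro ext) (metis not_le)
qed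

section \<open>Relabelling by automorphisms\<close>

definition relabel :: "('v \<Rightarrow> 'v) \<Rightarrow> ('v \<Rightarrow> 'a) \<Rightarrow> 'v \<Rightarrow> 'a" where
  "relabel \<phi> g = (\<lambda>x. g (\<phi> x))"

lemma automorphism_neighbours: "automorphism \<phi> \<Longrightarrow> neighbours E (\<phi> x) = \<phi> ` neighbours E x"
  unfolding automorphism_def neighbours_def by (auto simp: image_iff) (metis bij_pointE)

lemma med_relabel:
  assumes "automorphism \<phi>" shows "med (\<lambda>y. m (\<phi> y)) x = med m (\<phi> x)"
proof (rule nbrs_cases[of x])
  fix a b c assume *: "neighbours E x = {a, b, c}" "a \<noteq> b" "a \<noteq> c" "b \<noteq> c"
  have "inj \<phi>" using assms by (simp add: automorphism_def bij_is_inj)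
  then show ?thesis
    using med_eq[of "\<phi> x" "\<phi> a" "\<phi> b" "\<phi> c" m] automorphism_neighbours[OF assms, of x] *
      med_eq[OF *, of "\<lambda>y. m (\<phi> y)"]
    by (auto simp: inj_eq)
qed

lemma state_relabel:
  assumes "automorphism \<phi>"
  shows "state med (relabel \<phi> i) (relabel \<phi> w) m x n = state med i w m (\<phi> x) n"
proof (induction m arbitrary: x n)
  case (Suc m)
  then show ?case
    by (cases n) (simp_all add: relabel_def med_relabel[OF assms, where m="\<lambda>y. state med i w m y (before (w y) _)", symmetric])
qed (simp add: relabel_def)

lemma settled_relabel:
  assumes "automorphism \<phi>"
  shows "settled (relabel \<phi> w) m x n \<longleftrightarrow> settled w m (\<phi> x) n"
proof (induction m arbitrary: x n)
  case (Suc m)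
  then show ?case
    by (cases n) (auto simp: automorphism_neighbours[OF assms] relabel_def)
qed simp

lemma spin_relabel:
  assumes "automorphism \<phi>"
  shows "spin med (relabel \<phi> i) (relabel \<phi> w) x n = spin med i w (\<phi> x) n"
  by (simp add: spin_def depth_def state_relabel[OF assms] settled_relabel[OF assms])

end

section \<open>Almost every clock realisation is good\<close>

lemma distr_PiM_update:
  assumes "prob_space M"
  shows "distr (M \<Otimes>\<^sub>M PiM UNIV (\<lambda>_. M)) (PiM UNIV (\<lambda>_. M)) (\<lambda>(a, f). f(x := a)) = PiM UNIV (\<lambda>_. M)"
  using distr_pair_PiM_eq_PiM[of UNIV "\<lambda>_. M" x] assms by simp

lemma measurable_PiM_update:
  "(\<lambda>(a, f). f(x := a)) \<in> measurable (M \<Otimes>\<^sub>M PiM UNIV (\<lambda>_. M)) (PiM UNIV (\<lambda>_. M))"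
  unfolding case_prod_beta fun_upd_def
  by (rule measurable_PiM_single') (auto simp: space_PiM space_pair_measure)

text \<open>Coordinate \<open>x\<close> is resampled independently of the rest. Once its new value
  is frozen, \<open>g (w y)\<close> has to avoid a single number.\<close>

lemma AE_PiM_neq:
  fixes f :: "'b \<Rightarrow> real"
  assumes M: "prob_space M" and f[measurable]: "f \<in> borel_measurable M" and g[measurable]: "g \<in> borel_measurable M"
    and neq: "\<And>c. AE a in M. g a \<noteq> c" and xy: "x \<noteq> y"
  shows "AE w in PiM UNIV (\<lambda>_::'i. M). f (w x) \<noteq> g (w y)"
proof -
  interpret M: prob_space M by fact
  interpret P: prob_space "PiM UNIV (\<lambda>_::'i. M)" by (intro prob_space_PiM M)
  interpret PP: pair_prob_space M "PiM UNIV (\<lambda>_::'i. M)" by unfold_locales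
  have m[measurable]: "(\<lambda>w. f (w x)) \<in> borel_measurable (PiM UNIV (\<lambda>_::'i. M))"
      "(\<lambda>w. g (w y)) \<in> borel_measurable (PiM UNIV (\<lambda>_::'i. M))"
    by (auto intro: measurable_compose[OF measurable_component_singleton[of x UNIV "\<lambda>_. M"] f]
      measurable_compose[OF measurable_component_singleton[of y UNIV "\<lambda>_. M"] g])
  have "AE a in M. AE w in PiM UNIV (\<lambda>_::'i. M). f a \<noteq> g (w y)"
  proof (rule AE_I2)
    fix a
    have "AE b in M. f a \<noteq> g b" using neq[of "f a"] by (auto elim: eventually_mono)
    then show "AE w in PiM UNIV (\<lambda>_::'i. M). f a \<noteq> g (w y)"
      by (intro AE_PiM_component[where P="\<lambda>b. f a \<noteq> g b"] M) auto
  qed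
  then have "AE z in M \<Otimes>\<^sub>M PiM UNIV (\<lambda>_::'i. M). f (fst z) \<noteq> g (snd z y)"
    by (intro PP.AE_pair_measure borel_measurable_neq measurable_compose[OF measurable_fst f]
        measurable_compose[OF measurable_snd m(2)]) simp
  then have "AE w in distr (M \<Otimes>\<^sub>M PiM UNIV (\<lambda>_. M)) (PiM UNIV (\<lambda>_. M)) (\<lambda>(a, h). h(x := a)). f (w x) \<noteq> g (w y)"
  proof (subst AE_distr_iff[OF measurable_PiM_update])
    show "{w \<in> space (PiM UNIV (\<lambda>_::'i. M)). f (w x) \<noteq> g (w y)} \<in> sets (PiM UNIV (\<lambda>_. M))"
      by (intro borel_measurable_neq m)
  qed (use xy in \<open>auto simp: case_prod_beta elim!: eventually_mono\<close>)
  then show ?thesis by (simp only: distr_PiM_update[OF M])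
qed

context cubic_tree
begin

definition clocks_law :: "('v \<Rightarrow> nat \<Rightarrow> real) measure" where
  "clocks_law = PiM UNIV (\<lambda>_. clock_law)"

lemma sets_clocks_law[measurable_cong]: "sets clocks_law = sets (PiM UNIV (\<lambda>_. PiM UNIV (\<lambda>_. borel)))"
  unfolding clocks_law_def by (intro sets_PiM_cong sets_clock_law refl)

lemma space_clocks_law[simp]: "space clocks_law = UNIV"
  by (simp add: clocks_law_def space_PiM)

lemma prob_space_clocks_law: "prob_space clocks_law"
  unfolding clocks_law_def by (intro prob_space_PiM prob_space_clock_law)

lemma AE_all_vertices:
  "(\<And>x :: 'v. AE w in M. P x w) \<Longrightarrow> AE w in M. \<forall>x. P x w"
  using AE_ball_countable[OF countable_vertices, where M=M and P="\<lambda>w x. P x w"] by simp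

lemma AE_regular_clocks: "AE w in clocks_law. \<forall>x. regular_clock (w x)"
  unfolding clocks_law_def
  by (intro AE_all_vertices AE_PiM_component[where P=regular_clock] prob_space_clock_law AE_regular_clock) auto

lemma AE_distinct_arrivals:
  "AE w in clocks_law. \<forall>x y m n. x \<noteq> y \<longrightarrow> arrival (w x) m \<noteq> arrival (w y) n"
proof (intro AE_all_vertices)
  fix x y
  have "AE w in clocks_law. arrival (w x) m \<noteq> arrival (w y) n" if "x \<noteq> y" for m n
    unfolding clocks_law_def
    by (intro AE_PiM_neq[where f="\<lambda>v. arrival v m" and g="\<lambda>v. arrival v n"] prob_space_clock_law AE_arrival_neq that) measurable
  then show "AE w in clocks_law. \<forall>m n. x \<noteq> y \<longrightarrow> arrival (w x) m \<noteq> arrival (w y) n"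
    by (cases "x = y") (auto simp: AE_all_countable)
qed

text \<open>The slab length 1/4 is chosen so that a path has at most 3 extensions by a vertex, each
  vertex is active with probability at most 1/4, and the product is below 1.\<close>

definition active :: "('v \<Rightarrow> nat \<Rightarrow> real) \<Rightarrow> nat \<Rightarrow> 'v \<Rightarrow> bool" where
  "active w s v \<longleftrightarrow> (\<exists>k. real s / 4 < arrival (w v) k \<and> arrival (w v) k \<le> real (Suc s) / 4)"

definition paths :: "'v \<Rightarrow> nat \<Rightarrow> 'v list set" where
  "paths a L = {xs. length xs = Suc L \<and> hd xs = a \<and> successively E xs}"

lemma paths_Suc: "paths a (Suc L) \<subseteq> (\<Union>y\<in>neighbours E a. (#) a ` paths y L)"
proof
  fix xs assume "xs \<in> paths a (Suc L)"
  then obtain y ys where "xs = a # y # ys" "length ys = L" "successively E (y # ys)" "E a y"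
    by (auto simp: paths_def length_Suc_conv)
  then show "xs \<in> (\<Union>y\<in>neighbours E a. (#) a ` paths y L)"
    by (auto simp: paths_def neighbours_def)
qed

lemma finite_card_paths: "finite (paths a L) \<and> card (paths a L) \<le> 3 ^ L"
proof (induction L arbitrary: a)
  case 0
  have "paths a 0 = {[a]}" by (auto simp: paths_def length_Suc_conv)
  then show ?case by simp
next
  case (Suc L)
  have fin: "finite (\<Union>y\<in>neighbours E a. (#) a ` paths y L)"
    using Suc finite_neighbours by auto
  have "card (paths a (Suc L)) \<le> card (\<Union>y\<in>neighbours E a. (#) a ` paths y L)"
    by (rule card_mono[OF fin paths_Suc])
  also have "\<dots> \<le> (\<Sum>y\<in>neighbours E a. card ((#) a ` paths y L))"
    by (rule card_UN_le[OF finite_neighbours])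
  also have "\<dots> \<le> (\<Sum>y\<in>neighbours E a. 3 ^ L)"
    using Suc by (intro sum_mono order_trans[OF card_image_le]) auto
  also have "\<dots> = 3 ^ Suc L" by (simp add: card_neighbours)
  finally show ?case using finite_subset[OF paths_Suc fin] by simp
qed

lemma measurable_active[measurable]: "Measurable.pred clocks_law (\<lambda>w. active w s v)"
  unfolding active_def by measurable

text \<open>Distinct vertices have independent clocks, and the probability of a ring in a slab is at
  most the mean number of rings in it.\<close>

lemma emeasure_active_path:
  assumes "distinct xs"
  shows "emeasure clocks_law {w. \<forall>v\<in>set xs. active w s v} \<le> ennreal ((1/4) ^ length xs)"
proof -
  interpret P: product_prob_space "\<lambda>_. clock_law" "UNIV :: 'v set"
    by (intro product_prob_spaceI prob_space_clock_law)
  let ?A = "{v. \<exists>k. arrival v k \<in> {real s / 4<..real (Suc s) / 4}}"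
  have A: "?A = {v \<in> space clock_law. \<exists>k. arrival v k \<in> {real s / 4<..real (Suc s) / 4}}" by simp
  have mA[measurable]: "?A \<in> sets clock_law" unfolding A by measurable
  have "emeasure clock_law ?A = (\<integral>\<^sup>+v. indicator ?A v \<partial>clock_law)"
    by (rule nn_integral_indicator[symmetric]) measurable
  also have "\<dots> \<le> (\<integral>\<^sup>+v. (\<Sum>k. indicator {real s / 4<..real (Suc s) / 4} (arrival v k)) \<partial>clock_law)"
  proof (rule nn_integral_mono)
    fix v :: "nat \<Rightarrow> real"
    show "(indicator ?A v :: ennreal) \<le> (\<Sum>k. indicator {real s / 4<..real (Suc s) / 4} (arrival v k))"
    proof (cases "v \<in> ?A")
      case True
      then obtain k where "arrival v k \<in> {real s / 4<..real (Suc s) / 4}" by auto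
      then have "1 = (\<Sum>k\<in>{k}. indicator {real s / 4<..real (Suc s) / 4} (arrival v k) :: ennreal)" by simp
      also have "\<dots> \<le> (\<Sum>k. indicator {real s / 4<..real (Suc s) / 4} (arrival v k))"
        by (rule sum_le_suminf) auto
      finally show ?thesis using True by simp
    qed simp
  qed
  also have "\<dots> \<le> ennreal (real (Suc s) / 4 - real s / 4)"
    by (rule expected_arrivals_le) simp
  also have "real (Suc s) / 4 - real s / 4 = 1 / 4" by (subst diff_divide_distrib[symmetric]) simp
  finally have le: "emeasure clock_law ?A \<le> ennreal (1/4)" .
  have "{w. \<forall>v\<in>set xs. active w s v} = {w \<in> space (PiM UNIV (\<lambda>_. clock_law)). \<forall>v\<in>set xs. w v \<in> ?A}"
    by (auto simp: active_def space_PiM)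
  then have "emeasure clocks_law {w. \<forall>v\<in>set xs. active w s v} = (\<Prod>v\<in>set xs. emeasure clock_law ?A)"
    unfolding clocks_law_def by (simp only:) (rule P.emeasure_PiM_Collect, simp, simp, rule mA[unfolded clock_law_def[symmetric]])
  also have "\<dots> \<le> (\<Prod>v\<in>set xs. ennreal (1/4))"
    using le by (intro prod_mono_ennreal) auto
  also have "\<dots> = ennreal ((1/4) ^ length xs)"
    using assms by (simp add: distinct_card ennreal_power)
  finally show ?thesis .
qed

text \<open>First moment bound: at most \<open>3 ^ L\<close> self-avoiding paths, each active with
  probability at most \<open>(1/4) ^ Suc L\<close>.\<close>

lemma AE_no_infinite_active_path:
  "AE w in clocks_law. \<forall>a s. \<exists>L. \<forall>xs\<in>paths a L. distinct xs \<longrightarrow> (\<exists>v\<in>set xs. \<not> active w s v)"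
proof (intro AE_all_vertices)
  fix a
  have "AE w in clocks_law. \<exists>L. \<forall>xs\<in>paths a L. distinct xs \<longrightarrow> (\<exists>v\<in>set xs. \<not> active w s v)" for s
  proof -
    let ?B = "\<lambda>L. {w \<in> space clocks_law. \<exists>xs\<in>{xs\<in>paths a L. distinct xs}. \<forall>v\<in>set xs. active w s v}"
    have fin: "finite {xs\<in>paths a L. distinct xs}" for L using finite_card_paths by auto
    have B[measurable]: "?B L \<in> sets clocks_law" for L
      using fin by measurable
    have le: "emeasure clocks_law (?B L) \<le> ennreal ((3/4) ^ L)" for L
    proof -
      have "?B L = (\<Union>xs\<in>{xs\<in>paths a L. distinct xs}. {w. \<forall>v\<in>set xs. active w s v})" by auto
      also have "emeasure clocks_law \<dots> \<le> (\<Sum>xs\<in>{xs\<in>paths a L. distinct xs}. emeasure clocks_law {w. \<forall>v\<in>set xs. active w s v})"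
      proof (rule emeasure_subadditive_finite[OF fin])
        have "{w \<in> space clocks_law. \<forall>v\<in>set xs. active w s v} \<in> sets clocks_law" for xs by measurable
        then show "(\<lambda>xs. {w. \<forall>v\<in>set xs. active w s v}) ` {xs \<in> paths a L. distinct xs} \<subseteq> sets clocks_law" by auto
      qed
      also have "\<dots> \<le> (\<Sum>xs\<in>{xs\<in>paths a L. distinct xs}. ennreal ((1/4) ^ Suc L))"
      proof (rule sum_mono)
        fix xs assume "xs \<in> {xs\<in>paths a L. distinct xs}"
        then have xs: "length xs = Suc L" "distinct xs" by (auto simp: paths_def)
        from emeasure_active_path[OF xs(2), of s]
        show "emeasure clocks_law {w. \<forall>v\<in>set xs. active w s v} \<le> ennreal ((1/4) ^ Suc L)"
          by (simp only: xs(1))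
      qed
      also have "\<dots> = ennreal (\<Sum>xs\<in>{xs\<in>paths a L. distinct xs}. (1/4) ^ Suc L)"
        by (rule sum_ennreal) simp
      also have "(\<Sum>xs\<in>{xs\<in>paths a L. distinct xs}. (1/4) ^ Suc L)
          = real (card {xs\<in>paths a L. distinct xs}) * (1/4) ^ Suc L"
        by (rule sum_constant)
      also have "ennreal (real (card {xs\<in>paths a L. distinct xs}) * (1/4) ^ Suc L) \<le> ennreal ((3/4) ^ L)"
      proof (rule ennreal_leI)
        have "card {xs\<in>paths a L. distinct xs} \<le> 3 ^ L"
          by (rule order_trans[OF card_mono[OF conjunct1[OF finite_card_paths] Collect_restrict]
                conjunct2[OF finite_card_paths]])
        then have "real (card {xs\<in>paths a L. distinct xs}) \<le> real (3 ^ L)"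
          by (simp only: of_nat_le_iff)
        then have "real (card {xs\<in>paths a L. distinct xs}) \<le> 3 ^ L" by simp
        then have "real (card {xs\<in>paths a L. distinct xs}) * (1/4) ^ Suc L \<le> 3 ^ L * (1/4) ^ L"
          by (intro mult_mono) (auto simp: power_le_one)
        then show "real (card {xs\<in>paths a L. distinct xs}) * (1/4) ^ Suc L \<le> (3/4) ^ L"
          by (simp add: power_mult_distrib[symmetric])
      qed
      finally show ?thesis .
    qed
    have lim: "(\<lambda>L. ennreal ((3/4) ^ L)) \<longlonglongrightarrow> 0"
      using tendsto_ennrealI[OF LIMSEQ_realpow_zero[of "3/4 :: real"]] by simp
    have bnd: "emeasure clocks_law (\<Inter>L. ?B L) \<le> ennreal ((3/4) ^ L)" for L
      by (rule order_trans[OF emeasure_mono[OF _ B[of L]] le[of L]]) blast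
    have "emeasure clocks_law (\<Inter>L. ?B L) \<le> 0"
      by (rule LIMSEQ_le_const[OF lim], rule exI, intro allI impI, rule bnd)
    then have "emeasure clocks_law (\<Inter>L. ?B L) = 0"
      by (simp only: le_zero_eq)
    then show ?thesis
    proof (intro AE_I[where N="\<Inter>L. ?B L"])
      show "(\<Inter>L. ?B L) \<in> sets clocks_law" using B by (intro sets.countable_INT) auto
    qed auto
  qed
  then show "AE w in clocks_law. \<forall>s. \<exists>L. \<forall>xs\<in>paths a L. distinct xs \<longrightarrow> (\<exists>v\<in>set xs. \<not> active w s v)"
    by (simp add: AE_all_countable)
qed

text \<open>Loop erasure: when the walk returns to a vertex of the current path, the path is cut
  back to that vertex.\<close>

lemma distinct_path_to:
  assumes "(\<lambda>x y. E x y \<and> A y)\<^sup>*\<^sup>* a y" "A a"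
  shows "\<exists>xs. xs \<noteq> [] \<and> hd xs = a \<and> last xs = y \<and> distinct xs \<and> successively E xs \<and> (\<forall>v\<in>set xs. A v)"
  using assms(1)
proof (induction rule: rtranclp_induct)
  case base
  show ?case using assms(2) by (intro exI[of _ "[a]"]) simp
next
  case (step y z)
  then obtain xs where xs: "xs \<noteq> []" "hd xs = a" "last xs = y" "distinct xs" "successively E xs" "\<forall>v\<in>set xs. A v"
    by blast
  show ?case
  proof (cases "z \<in> set xs")
    case True
    then obtain us vs where "xs = us @ z # vs" by (auto simp: in_set_conv_decomp)
    then have e: "xs = (us @ [z]) @ vs" by simp
    then have "successively E (us @ [z])" using xs(5) by (metis successively_append_iff)
    moreover have "hd (us @ [z]) = a" using xs(2) e by (cases us) auto
    ultimately show ?thesis using xs e by (intro exI[of _ "us @ [z]"]) auto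
  next
    case False
    then show ?thesis using xs step
      by (intro exI[of _ "xs @ [z]"]) (auto simp: successively_append_iff)
  qed
qed

lemma finite_arrivals_le:
  assumes "regular_clock v" shows "finite {k. arrival v k \<le> t}"
proof -
  have "{k. arrival v k \<le> t} = {..<upto_time v t}" using less_upto_time_iff[OF assms] by auto
  then show ?thesis by simp
qed

text \<open>A non-terminating backward recursion visits rings at decreasing times, so it finally stays within
  one time slab of length \<open>1/4\<close>. There it walks along active vertices, infinitely many of them since
  each has finitely many rings, and so produces arbitrarily long self-avoiding active paths.\<close>

lemma ex_settled:
  assumes reg: "\<forall>x. regular_clock (w x)"
    and path: "\<forall>a s. \<exists>L. \<forall>xs\<in>paths a L. distinct xs \<longrightarrow> (\<exists>v\<in>set xs. \<not> active w s v)"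
  shows "\<exists>m. settled w m x n"
proof (rule ccontr)
  define bad where "bad z \<longleftrightarrow> (\<forall>m. \<not> settled w m (fst z) (snd z))" for z
  assume "\<nexists>m. settled w m x n"
  then have bad0: "bad (x, n)" by (simp add: bad_def)
  define step where "step z z' \<longleftrightarrow> (\<exists>k. snd z = Suc k \<and> E (fst z) (fst z') \<and>
      snd z' = before (w (fst z')) (arrival (w (fst z)) k))" for z z'
  have ex: "\<exists>z'. bad z' \<and> step z z'" if "bad z" for z
  proof -
    obtain v l where z: "z = (v, l)" by force
    have "l \<noteq> 0"
    proof
      assume "l = 0"
      then show False using that z settled.simps(2)[of w 0 v] unfolding bad_def by (metis fst_conv snd_conv)
    qed
    then obtain k where k: "l = Suc k" by (cases l) auto
    have "\<exists>y\<in>neighbours E v. \<forall>m. \<not> settled w m y (before (w y) (arrival (w v) k))"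
    proof (rule ccontr)
      assume "\<not> ?thesis"
      then obtain f where f: "\<forall>y\<in>neighbours E v. settled w (f y) y (before (w y) (arrival (w v) k))"
        by metis
      \<comment> \<open>There are finitely many neighbours, so the largest of their fuels would
        settle the vertex itself.\<close>
      define m where "m = Max (f ` neighbours E v)"
      have "f y \<le> m" if "y \<in> neighbours E v" for y
        unfolding m_def using that finite_neighbours by auto
      then have "settled w (Suc m) v (Suc k)" using f settled_mono by auto
      then show False using that z k by (simp add: bad_def del: settled.simps)
    qed
    then show ?thesis by (auto simp: bad_def step_def z k neighbours_def)
  qed
  obtain f where f: "f 0 = (x, n)" "\<And>j. bad (f j)" "\<And>j. step (f j) (f (Suc j))"
  proof -
    obtain g where g: "\<And>z. bad z \<Longrightarrow> bad (g z) \<and> step z (g z)" using ex by metis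
    have "bad ((g ^^ j) (x, n))" for j by (induction j) (auto simp: bad0 g)
    then show ?thesis using g by (intro that[of "\<lambda>j. (g ^^ j) (x, n)"]) auto
  qed
  define X where "X j = fst (f j)" for j
  define k where "k j = snd (f j) - 1" for j
  define t where "t j = arrival (w (X j)) (k j)" for j
  have sf: "snd (f j) = Suc (k j)" for j using f(3)[of j] by (auto simp: step_def k_def)
  have edge: "E (X j) (X (Suc j))" for j using f(3)[of j] by (auto simp: step_def X_def)
  have "Suc (k (Suc j)) = before (w (X (Suc j))) (t j)" for j
    using f(3)[of j] sf[of j] sf[of "Suc j"] by (auto simp: step_def X_def t_def)
  then have "k (Suc j) < before (w (X (Suc j))) (t j)" for j by (metis lessI)
  then have dec: "t (Suc j) < t j" for j
    using reg by (simp add: less_before_iff t_def[of "Suc j"])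
  have tpos: "0 < t j" for j using reg by (simp add: t_def arrival_pos)
  have tdec: "i < j \<Longrightarrow> t j < t i" for i j
    by (rule lift_Suc_mono_less[of "\<lambda>j. - t j", simplified]) (use dec in auto)
  \<comment> \<open>Index of the slab containing the ring time. Slabs are open on the left, hence
    the ceiling minus one; it is a natural number because the times are positive.\<close>
  define s where "s j = nat \<lceil>4 * t j\<rceil> - 1" for j
  have s: "real (s j) / 4 < t j \<and> t j \<le> real (Suc (s j)) / 4" for j
  proof -
    have c: "1 \<le> \<lceil>4 * t j\<rceil>" using tpos[of j] by simp
    have "int (s j) = \<lceil>4 * t j\<rceil> - 1" using c unfolding s_def by linarith
    then have "real (s j) = of_int \<lceil>4 * t j\<rceil> - 1" by (metis of_int_1 of_int_diff of_int_of_nat_eq)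
    then show ?thesis
      using ceiling_correct[of "4 * t j"] le_of_int_ceiling[of "4 * t j"] by (auto simp: field_simps)
  qed
  have sdec: "s j \<le> s i" if "i \<le> j" for i j
  proof (cases "i = j")
    case False
    then have "t j < t i" using that tdec by simp
    then have "real (s j) / 4 < real (Suc (s i)) / 4"
      using s[THEN conjunct1, of j] s[THEN conjunct2, of i] by (meson less_trans less_le_trans)
    then show ?thesis by (simp add: divide_less_cancel)
  qed simp
  \<comment> \<open>A nonincreasing sequence of natural numbers is constant once it has reached its
    minimum.\<close>
  obtain J where J: "\<And>j. s J \<le> s j" using exists_least_iff[of "\<lambda>m. \<exists>j. m = s j"] by (metis not_less)
  have sJ: "s j = s J" if "J \<le> j" for j using that sdec J by (simp add: le_antisym)
  define A where "A = active w (s J)"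
  have act: "A (X j)" if "J \<le> j" for j
    using s[of j] sJ[OF that] unfolding A_def active_def t_def by auto
  have reach: "(\<lambda>x y. E x y \<and> A y)\<^sup>*\<^sup>* (X J) (X j)" if "J \<le> j" for j
    using that
  proof (induction rule: dec_induct)
    case (step j)
    have "E (X j) (X (Suc j)) \<and> A (X (Suc j))" using edge[of j] act[of "Suc j"] step.hyps by simp
    with step.IH show ?case by (rule rtranclp.rtrancl_into_rtrancl)
  qed simp
  have inf: "infinite (X ` {J..})"
  proof
    assume "finite (X ` {J..})"
    then have "finite (\<Union>v\<in>X ` {J..}. arrival (w v) ` {k. arrival (w v) k \<le> t J})"
    proof (rule finite_UN_I)
      show "finite (arrival (w v) ` {k. arrival (w v) k \<le> t J})" for v
        using reg by (intro finite_imageI finite_arrivals_le) simp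
    qed
    moreover have "t ` {J..} \<subseteq> (\<Union>v\<in>X ` {J..}. arrival (w v) ` {k. arrival (w v) k \<le> t J})"
    proof
      fix r assume "r \<in> t ` {J..}"
      then obtain j where j: "J \<le> j" "r = t j" by auto
      then have "t j \<le> t J" using tdec[of J j] by (cases "j = J") auto
      then show "r \<in> (\<Union>v\<in>X ` {J..}. arrival (w v) ` {k. arrival (w v) k \<le> t J})"
        using j by (auto simp: t_def)
    qed
    ultimately have "finite (t ` {J..})" by (rule rev_finite_subset)
    moreover have "inj_on t {J..}" by (intro inj_onI) (metis less_irrefl linorder_neqE_nat tdec)
    ultimately have "finite {J..}" by (rule finite_imageD)
    then show False by (simp add: infinite_Ici)
  qed
  obtain L where L: "\<forall>xs\<in>paths (X J) L. distinct xs \<longrightarrow> (\<exists>v\<in>set xs. \<not> A v)"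
    using path unfolding A_def by blast
  have "X ` {J..} \<subseteq> last ` (\<Union>l\<le>L. paths (X J) l)"
  proof
    fix y assume "y \<in> X ` {J..}"
    then have "(\<lambda>x y. E x y \<and> A y)\<^sup>*\<^sup>* (X J) y" using reach by auto
    from distinct_path_to[OF this act[OF order_refl]] obtain xs where xs:
      "xs \<noteq> []" "hd xs = X J" "last xs = y" "distinct xs" "successively E xs" "\<forall>v\<in>set xs. A v" by blast
    have "length xs \<le> Suc L"
    proof (rule ccontr)
      assume len: "\<not> ?thesis"
      let ?ys = "take (Suc L) xs"
      have "?ys @ drop (Suc L) xs = xs" by simp
      then have "successively E ?ys" using xs(5) by (metis successively_append_iff)
      then have "?ys \<in> paths (X J) L" using xs len by (simp add: paths_def)
      moreover have "distinct ?ys" "\<forall>v\<in>set ?ys. A v" using xs by (auto dest: in_set_takeD)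
      ultimately show False using L by blast
    qed
    then have "xs \<in> (\<Union>l\<le>L. paths (X J) l)"
      using xs by (cases xs) (auto simp: paths_def)
    then show "y \<in> last ` (\<Union>l\<le>L. paths (X J) l)" using xs(3) by blast
  qed
  moreover have "finite (last ` (\<Union>l\<le>L. paths (X J) l))" using finite_card_paths by auto
  ultimately show False using inf finite_subset by blast
qed

theorem AE_good: "AE w in clocks_law. good w"
  using AE_regular_clocks AE_distinct_arrivals AE_no_infinite_active_path
  by eventually_elim (auto simp: good_def intro!: ex_settled)

end

section \<open>The median process and mass transport\<close>

definition unif :: "real measure" where
  "unif = uniform_measure lborel {0..1}"

lemma sets_unif[measurable_cong]: "sets unif = sets borel"
  by (simp add: unif_def)

lemma space_unif[simp]: "space unif = UNIV"
  by (simp add: unif_def)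

lemma prob_space_unif: "prob_space unif"
  unfolding unif_def by (rule prob_space_uniform_measure) auto

lemma AE_unif_iff: "(AE p in unif. P p) \<longleftrightarrow> (AE p in lborel. p \<in> {0..1} \<longrightarrow> P p)"
  unfolding unif_def by (subst AE_uniform_measure) auto

lemma AE_unif_neq: "AE p in unif. p \<noteq> c"
  unfolding AE_unif_iff using AE_lborel_singleton[of c] by eventually_elim simp

text \<open>The exceptional set is covered by a null rectangle, which handles arbitrary
  \<open>Q\<close>.\<close>

lemma AE_pair_snd:
  assumes "sigma_finite_measure N" "AE y in N. Q y" shows "AE z in M \<Otimes>\<^sub>M N. Q (snd z)"
proof -
  obtain A where A: "{y \<in> space N. \<not> Q y} \<subseteq> A" "A \<in> null_sets N"
    using assms(2) by (auto simp: eventually_ae_filter)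
  then have "space M \<times> A \<in> null_sets (M \<Otimes>\<^sub>M N)"
    using assms(1) by (auto simp: null_sets_def sigma_finite_measure.emeasure_pair_measure_Times)
  then show ?thesis
    using A(1) by (intro AE_I'[of "space M \<times> A"]) (auto simp: space_pair_measure)
qed

lemma AE_pair_fst:
  assumes "sigma_finite_measure N" "AE y in M. Q y" shows "AE z in M \<Otimes>\<^sub>M N. Q (fst z)"
proof -
  obtain A where A: "{y \<in> space M. \<not> Q y} \<subseteq> A" "A \<in> null_sets M"
    using assms(2) by (auto simp: eventually_ae_filter)
  then have "A \<times> space N \<in> null_sets (M \<Otimes>\<^sub>M N)"
    using assms(1) by (auto simp: null_sets_def sigma_finite_measure.emeasure_pair_measure_Times)
  then show ?thesis
    using A(1) by (intro AE_I'[of "A \<times> space N"]) (auto simp: space_pair_measure)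
qed

context cubic_tree
begin

definition values_law :: "('v \<Rightarrow> real) measure" where
  "values_law = PiM UNIV (\<lambda>_. unif)"

lemma sets_values_law[measurable_cong]: "sets values_law = sets (PiM UNIV (\<lambda>_. borel))"
  unfolding values_law_def by (intro sets_PiM_cong sets_unif refl)

lemma space_values_law[simp]: "space values_law = UNIV"
  by (simp add: values_law_def space_PiM)

lemma prob_space_values_law: "prob_space values_law"
  unfolding values_law_def by (intro prob_space_PiM prob_space_unif)

definition median_law :: "(('v \<Rightarrow> real) \<times> ('v \<Rightarrow> nat \<Rightarrow> real)) measure" where
  "median_law = values_law \<Otimes>\<^sub>M clocks_law"

lemma sets_median_law[measurable_cong]:
  "sets median_law = sets (PiM UNIV (\<lambda>_. borel) \<Otimes>\<^sub>M PiM UNIV (\<lambda>_. PiM UNIV (\<lambda>_. borel)))"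
  unfolding median_law_def by (intro sets_pair_measure_cong sets_values_law sets_clocks_law)

lemma space_median_law[simp]: "space median_law = UNIV"
  by (simp add: median_law_def space_pair_measure)

interpretation values_prob: prob_space values_law by (rule prob_space_values_law)
interpretation clocks_prob: prob_space clocks_law by (rule prob_space_clocks_law)
interpretation median_prob: pair_prob_space values_law clocks_law by unfold_locales

lemma prob_space_median_law: "prob_space median_law"
  unfolding median_law_def by (rule median_prob.prob_space_axioms)

lemma AE_good_median: "AE \<omega> in median_law. good (snd \<omega>)"
  unfolding median_law_def
  by (rule AE_pair_snd[OF clocks_prob.sigma_finite_measure_axioms AE_good])

lemma AE_inj_values: "AE i in values_law. inj i"
proof -
  have "AE i in values_law. i x \<noteq> i y" if "x \<noteq> y" for x y
    unfolding values_law_def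
    by (rule AE_PiM_neq[where f="\<lambda>a. a" and g="\<lambda>a. a"])
      (use that in \<open>auto simp: prob_space_unif AE_unif_neq measurable_ident_sets sets_unif\<close>)
  then have "AE i in values_law. x \<noteq> y \<longrightarrow> i x \<noteq> i y" for x y
    by (cases "x = y") auto
  then have "AE i in values_law. \<forall>x y. x \<noteq> y \<longrightarrow> i x \<noteq> i y"
    by (intro AE_all_vertices)
  then show ?thesis by eventually_elim (auto simp: inj_def)
qed

lemma AE_inj_median: "AE \<omega> in median_law. inj (fst \<omega>)"
  unfolding median_law_def
  by (rule AE_pair_fst[OF clocks_prob.sigma_finite_measure_axioms AE_inj_values])

section \<open>Measurability of the median process\<close>

lemma measurable_med[measurable (raw)]:
  assumes [measurable]: "\<And>y. (\<lambda>z. m z y) \<in> borel_measurable M"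
  shows "(\<lambda>z. med (m z) x :: real) \<in> borel_measurable M"
proof (rule nbrs_cases[of x])
  fix a b c assume N: "neighbours E x = {a, b, c}" "a \<noteq> b" "a \<noteq> c" "b \<noteq> c"
  show ?thesis unfolding med_eq[OF N] med3_def by measurable
qed

lemma measurable_state[measurable (raw)]:
  assumes [measurable]: "i \<in> measurable M (PiM UNIV (\<lambda>_. borel))" "w \<in> measurable M (PiM UNIV (\<lambda>_. PiM UNIV (\<lambda>_. borel)))"
  shows "(\<lambda>z. state med (i z) (w z) m x n :: real) \<in> borel_measurable M"
proof (induction m arbitrary: x n)
  case 0
  then show ?case by simp
next
  case (Suc m)
  show ?case
  proof (cases n)
    case (Suc k)
    have "(\<lambda>z. state med (i z) (w z) m y (before (w z y) (arrival (w z x) k))) \<in> borel_measurable M" for y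
      by (rule measurable_compose_countable[OF Suc.IH]) measurable
    then show ?thesis by (simp add: Suc) measurable
  qed simp
qed

lemma measurable_settled[measurable (raw)]:
  assumes [measurable]: "w \<in> measurable M (PiM UNIV (\<lambda>_. PiM UNIV (\<lambda>_. borel)))"
  shows "Measurable.pred M (\<lambda>z. settled (w z) m x n)"
proof (induction m arbitrary: x n)
  case 0
  then show ?case by simp
next
  case (Suc m)
  show ?case
  proof (cases n)
    case (Suc k)
    have "Measurable.pred M (\<lambda>z. settled (w z) m y (before (w z y) (arrival (w z x) k)))" for y
      by (rule measurable_compose_countable[OF Suc.IH]) measurable
    then show ?thesis
      unfolding Suc settled.simps using finite_neighbours by (intro pred_intros_finite)
  qed simp
qed

lemma measurable_depth[measurable (raw)]:
  assumes [measurable]: "w \<in> measurable M (PiM UNIV (\<lambda>_. PiM UNIV (\<lambda>_. borel)))"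
  shows "(\<lambda>z. depth (w z) x n) \<in> measurable M (count_space UNIV)"
  unfolding depth_def by measurable

lemma measurable_spin:
  assumes [measurable]: "i \<in> measurable M (PiM UNIV (\<lambda>_. borel))" "w \<in> measurable M (PiM UNIV (\<lambda>_. PiM UNIV (\<lambda>_. borel)))"
  shows "(\<lambda>z. spin med (i z) (w z) x n :: real) \<in> borel_measurable M"
  unfolding spin_def by (rule measurable_compose_countable[OF measurable_state]) measurable

lemma measurable_spin_index[measurable (raw)]:
  assumes [measurable]: "i \<in> measurable M (PiM UNIV (\<lambda>_. borel))" "w \<in> measurable M (PiM UNIV (\<lambda>_. PiM UNIV (\<lambda>_. borel)))"
    and [measurable]: "n \<in> measurable M (count_space UNIV)"
  shows "(\<lambda>z. spin med (i z) (w z) x (n z) :: real) \<in> borel_measurable M"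
  by (rule measurable_compose_countable[OF measurable_spin]) measurable

section \<open>Invariance of the law and mass transport\<close>

lemma distr_PiM_relabel:
  assumes "bij \<phi>" "prob_space N"
  shows "distr (PiM UNIV (\<lambda>_::'v. N)) (PiM UNIV (\<lambda>_. N)) (relabel \<phi>) = PiM UNIV (\<lambda>_. N)"
  using distr_PiM_reindex[of UNIV "\<lambda>_. N" \<phi> UNIV] assms
  by (simp add: relabel_def[abs_def] bij_is_inj restrict_def)

lemma measurable_relabel:
  "relabel \<phi> \<in> measurable (PiM UNIV (\<lambda>_::'v. N)) (PiM UNIV (\<lambda>_. N))"
  unfolding relabel_def[abs_def] by (rule measurable_PiM_single') (auto simp: space_PiM)

definition relabel2 where "relabel2 \<phi> \<omega> = (relabel \<phi> (fst \<omega>), relabel \<phi> (snd \<omega>))"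

lemma measurable_relabel2: "relabel2 \<phi> \<in> measurable median_law median_law"
  unfolding relabel2_def[abs_def] median_law_def values_law_def clocks_law_def
  by (intro measurable_Pair measurable_compose[OF measurable_fst measurable_relabel]
      measurable_compose[OF measurable_snd measurable_relabel])

lemma distr_relabel2:
  assumes "automorphism \<phi>"
  shows "distr median_law median_law (relabel2 \<phi>) = median_law"
proof -
  have b: "bij \<phi>" using assms by (simp add: automorphism_def)
  have v: "distr values_law values_law (relabel \<phi>) = values_law"
    unfolding values_law_def by (rule distr_PiM_relabel[OF b prob_space_unif])
  have c: "distr clocks_law clocks_law (relabel \<phi>) = clocks_law"
    unfolding clocks_law_def by (rule distr_PiM_relabel[OF b prob_space_clock_law])
  have "median_law = distr values_law values_law (relabel \<phi>) \<Otimes>\<^sub>M distr clocks_law clocks_law (relabel \<phi>)"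
    by (simp only: v c median_law_def)
  also have "\<dots> = distr (values_law \<Otimes>\<^sub>M clocks_law) (values_law \<Otimes>\<^sub>M clocks_law) (\<lambda>(x, y). (relabel \<phi> x, relabel \<phi> y))"
    by (rule pair_measure_distr) (auto simp: c values_law_def clocks_law_def measurable_relabel
        intro!: prob_space_imp_sigma_finite prob_space_PiM prob_space_clock_law simp: c[unfolded clocks_law_def])
  finally show ?thesis
    unfolding median_law_def relabel2_def[abs_def] case_prod_beta by (rule sym)
qed

text \<open>Diagonal invariance, as required of a transport function in the mass transport
  principle.\<close>

definition equivariant :: "('v \<Rightarrow> 'v \<Rightarrow> ('v \<Rightarrow> real) \<times> ('v \<Rightarrow> nat \<Rightarrow> real) \<Rightarrow> ennreal) \<Rightarrow> bool" where
  "equivariant G \<longleftrightarrow> (\<forall>\<phi> x y \<omega>. automorphism \<phi> \<longrightarrow> G (\<phi> x) (\<phi> y) \<omega> = G x y (relabel2 \<phi> \<omega>))"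

context
  fixes G :: "'v \<Rightarrow> 'v \<Rightarrow> ('v \<Rightarrow> real) \<times> ('v \<Rightarrow> nat \<Rightarrow> real) \<Rightarrow> ennreal"
  assumes G: "\<And>x y. G x y \<in> borel_measurable median_law" and eq: "equivariant G"
begin

lemma expectation_automorphism:
  assumes "automorphism \<phi>"
  shows "(\<integral>\<^sup>+\<omega>. G (\<phi> x) (\<phi> y) \<omega> \<partial>median_law) = (\<integral>\<^sup>+\<omega>. G x y \<omega> \<partial>median_law)"
proof -
  have "(\<integral>\<^sup>+\<omega>. G (\<phi> x) (\<phi> y) \<omega> \<partial>median_law) = (\<integral>\<^sup>+\<omega>. G x y (relabel2 \<phi> \<omega>) \<partial>median_law)"
  proof -
    have "G (\<phi> x) (\<phi> y) \<omega> = G x y (relabel2 \<phi> \<omega>)" for \<omega>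
      using eq assms unfolding equivariant_def by blast
    then show ?thesis by (simp only:)
  qed
  also have "\<dots> = (\<integral>\<^sup>+\<omega>. G x y \<omega> \<partial>distr median_law median_law (relabel2 \<phi>))"
    using G measurable_relabel2 by (subst nn_integral_distr) auto
  finally show ?thesis by (simp add: distr_relabel2[OF assms])
qed

lemma nn_integral_vertices_swap:
  assumes H: "\<And>y. H y \<in> borel_measurable median_law"
  shows "(\<integral>\<^sup>+\<omega>. (\<integral>\<^sup>+y. H (y::'v) \<omega> \<partial>count_space UNIV) \<partial>median_law)
       = (\<integral>\<^sup>+y. (\<integral>\<^sup>+\<omega>. H y \<omega> \<partial>median_law) \<partial>count_space UNIV)"
proof -
  interpret C: sigma_finite_measure "count_space (UNIV :: 'v set)"
    by (rule sigma_finite_measure_count_space_countable[OF countable_vertices])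
  interpret P: pair_sigma_finite median_law "count_space (UNIV :: 'v set)"
    by (intro pair_sigma_finite.intro C.sigma_finite_measure_axioms
      prob_space_imp_sigma_finite[OF prob_space_median_law])
  have "(\<lambda>z. H (snd z) (fst z)) \<in> borel_measurable (median_law \<Otimes>\<^sub>M count_space UNIV)"
    using countable_vertices H
    by (intro measurable_compose_countable'[where f="\<lambda>y z. H y (fst z)" and g=snd and I=UNIV])
      (auto intro: measurable_compose[OF measurable_fst])
  then show ?thesis
    using P.Fubini'[of "\<lambda>\<omega> y. H y \<omega>"] by (simp add: case_prod_beta)
qed

text \<open>\<open>A y\<close> turns the mean mass from \<open>r\<close> to \<open>y\<close> into
  that from \<open>\<iota> y\<close> to \<open>r\<close>; as \<iota> is a bijection, the sum over
  \<open>y\<close> is all the mass received by \<open>r\<close>.\<close>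

theorem mass_transport:
  "(\<integral>\<^sup>+\<omega>. (\<integral>\<^sup>+y. G r y \<omega> \<partial>count_space UNIV) \<partial>median_law)
 = (\<integral>\<^sup>+\<omega>. (\<integral>\<^sup>+y. G y r \<omega> \<partial>count_space UNIV) \<partial>median_law)"
proof -
  obtain \<iota> A where \<iota>: "bij \<iota>" and A: "\<And>y. automorphism (A y)" "\<And>y. A y r = \<iota> y" "\<And>y. A y y = r"
    using inversion[of r] by metis
  have e: "(\<integral>\<^sup>+\<omega>. G r y \<omega> \<partial>median_law) = (\<integral>\<^sup>+\<omega>. G (\<iota> y) r \<omega> \<partial>median_law)" for y
    using expectation_automorphism[OF A(1)[of y], of r y] by (simp add: A)
  have "(\<integral>\<^sup>+\<omega>. (\<integral>\<^sup>+y. G r y \<omega> \<partial>count_space UNIV) \<partial>median_law)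
      = (\<integral>\<^sup>+y. (\<integral>\<^sup>+\<omega>. G (\<iota> y) r \<omega> \<partial>median_law) \<partial>count_space UNIV)"
    by (subst nn_integral_vertices_swap) (auto simp: G e)
  also have "\<dots> = (\<integral>\<^sup>+y. (\<integral>\<^sup>+\<omega>. G y r \<omega> \<partial>median_law) \<partial>count_space UNIV)"
    by (rule nn_integral_bij_count_space[where g=\<iota> and A=UNIV and B=UNIV and f="\<lambda>y. \<integral>\<^sup>+\<omega>. G y r \<omega> \<partial>median_law"]) (use \<iota> in simp)
  also have "\<dots> = (\<integral>\<^sup>+\<omega>. (\<integral>\<^sup>+y. G y r \<omega> \<partial>count_space UNIV) \<partial>median_law)"
    by (subst nn_integral_vertices_swap) (auto simp: G)
  finally show ?thesis .
qed

text \<open>Some automorphism exchanges the two ends of the edge.\<close>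

lemma edge_exchange:
  assumes "E x y"
  shows "(\<integral>\<^sup>+\<omega>. G x y \<omega> \<partial>median_law) = (\<integral>\<^sup>+\<omega>. G y x \<omega> \<partial>median_law)"
proof -
  obtain \<iota> A where "\<And>y. automorphism (A y)" "\<And>y. A y x = \<iota> y" "\<And>y. A y y = x" "\<And>y. E x y \<Longrightarrow> \<iota> y = y"
    using inversion[of x] by metis
  then show ?thesis
    using expectation_automorphism[of "A y" x y] assms by simp
qed

end

end

section \<open>Agreement with neighbours\<close>

lemma finite_of_nn_integral_count_space:
  fixes f :: "'a \<Rightarrow> ennreal"
  assumes "(\<integral>\<^sup>+y. f y \<partial>count_space UNIV) < \<infinity>" and "\<And>y. y \<in> S \<Longrightarrow> 1 \<le> f y"
  shows "finite S"
proof (rule ccontr)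
  assume "infinite S"
  then have "\<infinity> = emeasure (count_space UNIV) S" by simp
  also have "\<dots> = (\<integral>\<^sup>+y. indicator S y \<partial>count_space UNIV)" by simp
  also have "\<dots> \<le> (\<integral>\<^sup>+y. f y \<partial>count_space UNIV)"
    using assms(2) by (intro nn_integral_mono) (auto simp: indicator_def)
  finally show False using assms(1) by (simp add: less_le top_unique)
qed

lemma finite_of_suminf_of_bool:
  assumes "(\<Sum>k. of_bool (P k) :: ennreal) < \<infinity>" shows "finite {k. P k}"
  by (rule finite_of_nn_integral_count_space[where f="\<lambda>k. of_bool (P k)"])
    (use assms in \<open>auto simp: nn_integral_count_space_nat\<close>)

lemma one_le_suminf_of_bool:
  assumes "\<exists>k. P k" shows "1 \<le> (\<Sum>k. of_bool (P k) :: ennreal)"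
proof -
  obtain k where "P k" using assms by blast
  then show ?thesis using sum_le_suminf[of "\<lambda>k. of_bool (P k) :: ennreal" "{k}"] by simp
qed

text \<open>After mass transport the sum runs over possible sources; distinct initial values leave
  at most one source for a given value.\<close>

lemma nn_integral_inj_le_1:
  assumes "inj f" shows "(\<integral>\<^sup>+y. of_bool (c = f y) \<partial>count_space UNIV) \<le> (1 :: ennreal)"
proof -
  have "(\<integral>\<^sup>+y. of_bool (c = f y) \<partial>count_space UNIV) = (\<integral>\<^sup>+y. indicator {y. c = f y} y \<partial>count_space UNIV :: ennreal)"
    by (intro nn_integral_cong) (auto simp: indicator_def)
  also have "\<dots> = emeasure (count_space UNIV) {y. c = f y}" by simp
  also have "\<dots> \<le> 1"
  proof (cases "\<exists>y. c = f y")
    case True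
    then obtain y where "c = f y" by auto
    then have "{z. c = f z} = {y}" using assms by (auto simp: inj_def)
    then show ?thesis by simp
  qed simp
  finally show ?thesis .
qed

context cubic_tree
begin

interpretation median_law: prob_space median_law by (rule prob_space_median_law)

type_synonym 'w sample = "('w \<Rightarrow> real) \<times> ('w \<Rightarrow> nat \<Rightarrow> real)"

definition val :: "'v sample \<Rightarrow> 'v \<Rightarrow> nat \<Rightarrow> real" where
  "val \<omega> x k = spin med (fst \<omega>) (snd \<omega>) x k"

definition arr :: "'v sample \<Rightarrow> 'v \<Rightarrow> nat \<Rightarrow> real" where
  "arr \<omega> x k = arrival (snd \<omega> x) k"

definition seen :: "'v sample \<Rightarrow> 'v \<Rightarrow> nat \<Rightarrow> 'v \<Rightarrow> real" where
  "seen \<omega> x k y = val \<omega> y (before (snd \<omega> y) (arr \<omega> x k))"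

definition lonely :: "'v sample \<Rightarrow> 'v \<Rightarrow> nat \<Rightarrow> bool" where
  "lonely \<omega> x k \<longleftrightarrow> (\<forall>y\<in>neighbours E x. seen \<omega> x k y \<noteq> val \<omega> x k)"

definition at_time :: "'v sample \<Rightarrow> real \<Rightarrow> 'v \<Rightarrow> real" where
  "at_time \<omega> t x = val \<omega> x (upto_time (snd \<omega> x) t)"

lemma val_0[simp]: "val \<omega> x 0 = fst \<omega> x"
  by (simp add: val_def)

lemma val_Suc: "good (snd \<omega>) \<Longrightarrow> val \<omega> x (Suc k) = med (seen \<omega> x k) x"
  unfolding val_def by (subst spin_Suc[OF local_rule_med]) (auto simp: seen_def[abs_def] val_def arr_def)

lemma measurable_fst_median[measurable]: "fst \<in> measurable median_law (PiM UNIV (\<lambda>_. borel))"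
  and measurable_snd_median[measurable]: "snd \<in> measurable median_law (PiM UNIV (\<lambda>_. PiM UNIV (\<lambda>_. borel)))"
  by measurable

lemma measurable_arr[measurable]: "(\<lambda>\<omega>. arr \<omega> x k) \<in> borel_measurable median_law"
  unfolding arr_def by measurable

lemma measurable_val[measurable]: "(\<lambda>\<omega>. val \<omega> x k) \<in> borel_measurable median_law"
  unfolding val_def by measurable

lemma measurable_seen[measurable]: "(\<lambda>\<omega>. seen \<omega> x k y) \<in> borel_measurable median_law"
  unfolding seen_def val_def by measurable

lemma measurable_at_time[measurable]: "(\<lambda>\<omega>. at_time \<omega> t y) \<in> borel_measurable median_law"
  unfolding at_time_def val_def by measurable

lemma measurable_initial[measurable]: "(\<lambda>\<omega>. fst \<omega> x) \<in> borel_measurable median_law"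
  by measurable

lemma pred_ball_neighbours[measurable (raw)]:
  "(\<And>y. Measurable.pred M (P y)) \<Longrightarrow> Measurable.pred M (\<lambda>\<omega>. \<forall>y\<in>neighbours E x. P y \<omega>)"
  "(\<And>y. Measurable.pred M (P y)) \<Longrightarrow> Measurable.pred M (\<lambda>\<omega>. \<exists>y\<in>neighbours E x. P y \<omega>)"
  using finite_neighbours by (auto intro: pred_intros_finite)

lemma measurable_lonely[measurable]: "Measurable.pred median_law (\<lambda>\<omega>. lonely \<omega> x k)"
  unfolding lonely_def by measurable

lemma arr_relabel: "arr (relabel2 \<phi> \<omega>) x k = arr \<omega> (\<phi> x) k"
  by (simp add: arr_def relabel2_def relabel_def)

lemma val_relabel: "automorphism \<phi> \<Longrightarrow> val (relabel2 \<phi> \<omega>) x k = val \<omega> (\<phi> x) k"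
  by (simp add: val_def relabel2_def spin_relabel)

lemma seen_relabel: "automorphism \<phi> \<Longrightarrow> seen (relabel2 \<phi> \<omega>) x k y = seen \<omega> (\<phi> x) k (\<phi> y)"
  by (simp add: seen_def val_relabel arr_relabel) (simp add: relabel2_def relabel_def)

lemma at_time_relabel: "automorphism \<phi> \<Longrightarrow> at_time (relabel2 \<phi> \<omega>) t y = at_time \<omega> t (\<phi> y)"
  by (simp add: at_time_def val_relabel) (simp add: relabel2_def relabel_def)

lemma lonely_relabel: "automorphism \<phi> \<Longrightarrow> lonely (relabel2 \<phi> \<omega>) x k = lonely \<omega> (\<phi> x) k"
  by (simp add: lonely_def val_relabel seen_relabel automorphism_neighbours)

lemma initial_relabel: "fst (relabel2 \<phi> \<omega>) x = fst \<omega> (\<phi> x)"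
  by (simp add: relabel2_def relabel_def)

lemma arr_distinct: "good (snd \<omega>) \<Longrightarrow> x \<noteq> y \<Longrightarrow> arr \<omega> x m \<noteq> arr \<omega> y n"
  by (auto simp: good_def arr_def)

lemma reg_clock: "good (snd \<omega>) \<Longrightarrow> regular_clock (snd \<omega> x)"
  by (auto simp: good_def)

text \<open>Telescoping of the agreement of \<open>x\<close> and \<open>y\<close> over the rings of both vertices, written without
  subtraction.\<close>

definition balanced :: "'v sample \<Rightarrow> 'v \<Rightarrow> 'v \<Rightarrow> real \<Rightarrow> bool" where
  "balanced \<omega> x y t \<longleftrightarrow>
     of_bool (val \<omega> x (before (snd \<omega> x) t) = val \<omega> y (before (snd \<omega> y) t))
       + ((\<Sum>k<before (snd \<omega> x) t. of_bool (val \<omega> x k = seen \<omega> x k y))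
       + (\<Sum>k<before (snd \<omega> y) t. of_bool (val \<omega> y k = seen \<omega> y k x)))
     = (\<Sum>k<before (snd \<omega> x) t. of_bool (val \<omega> x (Suc k) = seen \<omega> x k y))
       + (\<Sum>k<before (snd \<omega> y) t. of_bool (val \<omega> y (Suc k) = seen \<omega> y k x))
       + (of_bool (fst \<omega> x = fst \<omega> y) :: nat)"

lemma balanced_sym: "balanced \<omega> x y t \<Longrightarrow> balanced \<omega> y x t"
  unfolding balanced_def by (simp add: eq_commute add.commute)

text \<open>Ring \<open>a\<close> of \<open>x\<close> is the last ring of either vertex before
  \<open>t\<close>. Passing it replaces the agreement just before it by the agreement just after,
  and these are the two terms by which the sums grow.\<close>

lemma balanced_step:
  assumes good: "good (snd \<omega>)" and a: "before (snd \<omega> x) t = Suc a"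
    and last: "\<And>k. k < before (snd \<omega> y) t \<Longrightarrow> arr \<omega> y k < arr \<omega> x a"
  shows "before (snd \<omega> x) (arr \<omega> x a) = a" "before (snd \<omega> y) (arr \<omega> x a) = before (snd \<omega> y) t"
    and "balanced \<omega> x y (arr \<omega> x a) \<Longrightarrow> balanced \<omega> x y t"
proof -
  have reg: "regular_clock (snd \<omega> z)" for z by (rule reg_clock[OF good])
  show bx: "before (snd \<omega> x) (arr \<omega> x a) = a"
    unfolding arr_def by (rule before_arrival[OF reg])
  have "arr \<omega> x a < t"
    using a less_before_iff[OF reg, of a x t] by (simp add: arr_def)
  then have "k < before (snd \<omega> y) (arr \<omega> x a) \<longleftrightarrow> k < before (snd \<omega> y) t" for k
    using last[of k] by (auto simp: less_before_iff[OF reg] arr_def)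
  then show by': "before (snd \<omega> y) (arr \<omega> x a) = before (snd \<omega> y) t"
    by (metis linorder_neqE_nat less_irrefl)
  have seen: "seen \<omega> x a y = val \<omega> y (before (snd \<omega> y) t)"
    by (simp add: seen_def by')
  show "balanced \<omega> x y (arr \<omega> x a) \<Longrightarrow> balanced \<omega> x y t"
    unfolding balanced_def bx by' a sum.lessThan_Suc seen by linarith
qed

lemma agreement_balance:
  assumes good: "good (snd \<omega>)" and xy: "x \<noteq> y"
  shows "balanced \<omega> x y t"
  using xy
proof (induction "before (snd \<omega> x) t + before (snd \<omega> y) t" arbitrary: t x y rule: less_induct)
  case less
  have reg: "regular_clock (snd \<omega> z)" for z by (rule reg_clock[OF good])
  have mono: "j \<le> k \<Longrightarrow> arr \<omega> z j \<le> arr \<omega> z k" for z j k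
    using strict_mono_less_eq[OF strict_mono_arrival[OF reg]] by (simp add: arr_def)
  have step: "balanced \<omega> x' y' t"
    if "{x', y'} = {x, y}" "x' \<noteq> y'" "before (snd \<omega> x') t = Suc a"
      and last: "\<And>k. k < before (snd \<omega> y') t \<Longrightarrow> arr \<omega> y' k < arr \<omega> x' a" for x' y' a
  proof (rule balanced_step(3)[OF good that(3) last])
    have "before (snd \<omega> x') t + before (snd \<omega> y') t = before (snd \<omega> x) t + before (snd \<omega> y) t"
      using that(1,2) by (auto simp: doubleton_eq_iff)
    then show "balanced \<omega> x' y' (arr \<omega> x' a)"
      using balanced_step(1,2)[OF good that(3) last] that(2,3) by (intro less.hyps) auto
  qed
  show ?case
  proof (cases "before (snd \<omega> x) t")
    case 0
    show ?thesis
    proof (cases "before (snd \<omega> y) t")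
      case 0
      with \<open>before (snd \<omega> x) t = 0\<close> show ?thesis by (simp add: balanced_def)
    next
      case (Suc b)
      then show ?thesis using step[of y x b] 0 less.prems by (intro balanced_sym[of \<omega> y x]) auto
    qed
  next
    case (Suc a)
    show ?thesis
    \<comment> \<open>Decides which of the two clocks rang last; they never ring
      simultaneously.\<close>
    proof (cases "\<forall>k<before (snd \<omega> y) t. arr \<omega> y k < arr \<omega> x a")
      case True
      then show ?thesis using step[of x y a] Suc less.prems by auto
    next
      case False
      then obtain k where k: "k < before (snd \<omega> y) t" "arr \<omega> x a \<le> arr \<omega> y k" by (auto simp: not_less)
      then obtain b where b: "before (snd \<omega> y) t = Suc b" by (cases "before (snd \<omega> y) t") auto
      have "arr \<omega> x j < arr \<omega> y b" if "j < before (snd \<omega> x) t" for j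
      proof -
        have "arr \<omega> x j \<le> arr \<omega> x a" using that Suc by (intro mono) simp
        also have "\<dots> < arr \<omega> y k" using k(2) arr_distinct[OF good less.prems, of a k] by simp
        also have "\<dots> \<le> arr \<omega> y b" using k(1) b by (intro mono) simp
        finally show ?thesis .
      qed
      then show ?thesis using step[of y x b] b less.prems by (intro balanced_sym[of \<omega> y x]) auto
    qed
  qed
qed

lemma measurable_nn_integral_vertices:
  assumes H: "\<And>y. H y \<in> borel_measurable median_law"
  shows "(\<lambda>\<omega>. \<integral>\<^sup>+y. H (y::'v) \<omega> \<partial>count_space UNIV) \<in> borel_measurable median_law"
proof -
  interpret C: sigma_finite_measure "count_space (UNIV :: 'v set)"
    by (rule sigma_finite_measure_count_space_countable[OF countable_vertices])
  have "(\<lambda>z. H (snd z) (fst z)) \<in> borel_measurable (median_law \<Otimes>\<^sub>M count_space UNIV)"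
    using countable_vertices H
    by (intro measurable_compose_countable'[where f="\<lambda>y z. H y (fst z)" and g=snd and I=UNIV])
      (auto intro: measurable_compose[OF measurable_fst])
  then show ?thesis
    by (intro C.borel_measurable_nn_integral) (simp add: case_prod_beta)
qed

lemma suminf_before:
  assumes "good (snd \<omega>)"
  shows "(\<Sum>k. of_bool (arr \<omega> x k < t \<and> Q k) :: ennreal) = of_nat (\<Sum>k<before (snd \<omega> x) t. of_bool (Q k))"
proof -
  have "(\<Sum>k. of_bool (arr \<omega> x k < t \<and> Q k) :: ennreal) = (\<Sum>k<before (snd \<omega> x) t. of_bool (arr \<omega> x k < t \<and> Q k))"
    by (rule suminf_finite) (auto simp: less_before_iff[OF reg_clock[OF assms]] arr_def)
  also have "\<dots> = (\<Sum>k<before (snd \<omega> x) t. of_bool (Q k))"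
    by (intro sum.cong) (auto simp: less_before_iff[OF reg_clock[OF assms]] arr_def)
  finally show ?thesis by simp
qed

text \<open>Agreement of \<open>x\<close> with \<open>y\<close> just after its rings, to be compared
  with agreement just before them in \<open>loss\<close>. Two nonnegative sums stand in for their
  signed difference.\<close>

definition gain :: "real \<Rightarrow> 'v \<Rightarrow> 'v \<Rightarrow> 'v sample \<Rightarrow> ennreal" where
  "gain t x y \<omega> = (\<Sum>k. of_bool (arr \<omega> x k < t \<and> val \<omega> x (Suc k) = seen \<omega> x k y))"

definition loss :: "real \<Rightarrow> 'v \<Rightarrow> 'v \<Rightarrow> 'v sample \<Rightarrow> ennreal" where
  "loss t x y \<omega> = (\<Sum>k. of_bool (arr \<omega> x k < t \<and> val \<omega> x k = seen \<omega> x k y))"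

lemma measurable_gain[measurable]: "gain t x y \<in> borel_measurable median_law"
  and measurable_loss[measurable]: "loss t x y \<in> borel_measurable median_law"
  unfolding gain_def[abs_def] loss_def[abs_def] by measurable

lemma equivariant_gain: "equivariant (gain t)" and equivariant_loss: "equivariant (loss t)"
  unfolding equivariant_def by (simp_all add: gain_def loss_def arr_relabel val_relabel seen_relabel)

lemma expected_rings:
  assumes "0 \<le> t"
  shows "(\<integral>\<^sup>+\<omega>. (\<Sum>k. of_bool (arr \<omega> x k \<le> t)) \<partial>median_law) \<le> ennreal t"
proof -
  have "(\<integral>\<^sup>+\<omega>. (\<Sum>k. of_bool (arr \<omega> x k \<le> t)) \<partial>median_law)
      = (\<integral>\<^sup>+\<omega>. (\<Sum>k. indicator {0<..t} (arrival (snd \<omega> x) k)) \<partial>median_law)"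
  proof (rule nn_integral_cong_AE[OF eventually_mono[OF AE_good_median]])
    fix \<omega> :: "'v sample" assume "good (snd \<omega>)"
    then have "0 < arrival (snd \<omega> x) k" for k by (intro arrival_pos reg_clock)
    then show "(\<Sum>k. of_bool (arr \<omega> x k \<le> t)) = (\<Sum>k. indicator {0<..t} (arrival (snd \<omega> x) k) :: ennreal)"
      by (intro suminf_cong) (simp add: arr_def indicator_def)
  qed
  also have "\<dots> = (\<integral>\<^sup>+v. (\<Sum>k. indicator {0<..t} (arrival v k)) \<partial>distr median_law clock_law (\<lambda>\<omega>. snd \<omega> x))"
    by (subst nn_integral_distr) auto
  also have "distr median_law clock_law (\<lambda>\<omega>. snd \<omega> x) = clock_law"
  proof -
    interpret clocks: prob_space clocks_law by (rule prob_space_clocks_law)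
    interpret vprob: prob_space values_law by (rule prob_space_values_law)
    interpret pair_prob_space values_law clocks_law by unfold_locales
    have "distr median_law clocks_law snd = clocks_law"
    proof (rule measure_eqI)
      fix A assume "A \<in> sets (distr median_law clocks_law snd)"
      then have A: "A \<in> sets clocks_law" by simp
      have "snd -` A \<inter> space median_law = space values_law \<times> A"
        by (auto simp: space_pair_measure)
      then show "emeasure (distr median_law clocks_law snd) A = emeasure clocks_law A"
        using A clocks.emeasure_pair_measure_Times[OF sets.top[of values_law] A]
          vprob.emeasure_space_1 by (subst emeasure_distr) (simp_all add: median_law_def)
    qed simp
    then have "distr (distr median_law clocks_law snd) clock_law (\<lambda>w. w x) = clock_law"
      using distr_PiM_component[of UNIV "\<lambda>_. clock_law" x] prob_space_clock_law by (simp add: clocks_law_def)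
    then show ?thesis
      by (subst (asm) distr_distr) (auto simp: comp_def median_law_def clocks_law_def)
  qed
  also have "(\<integral>\<^sup>+v. (\<Sum>k. indicator {0<..t} (arrival v k)) \<partial>clock_law) \<le> ennreal (t - 0)"
    by (rule expected_arrivals_le[OF assms])
  finally show ?thesis by simp
qed

text \<open>Energy argument edge by edge: the balance bounds the gains at both ends by the losses
  plus 1, and \<open>edge_exchange\<close> makes the two ends equal in mean. At a vertex the gains
  exceed the losses by at least one per lonely ring. The constant 3 is the degree of
  \<open>x\<close>.\<close>

lemma expected_lonely_before:
  assumes t: "0 \<le> t"
  shows "(\<integral>\<^sup>+\<omega>. (\<Sum>k. of_bool (arr \<omega> x k < t \<and> lonely \<omega> x k)) \<partial>median_law) \<le> 3"
proof -
  let ?I = "\<lambda>f. (\<integral>\<^sup>+\<omega>. f \<omega> \<partial>median_law)"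
  let ?L = "\<lambda>\<omega>. \<Sum>k. of_bool (arr \<omega> x k < t \<and> lonely \<omega> x k) :: ennreal"
  have fin: "?I (loss t x y) < \<infinity>" for y
  proof -
    have "?I (loss t x y) \<le> ?I (\<lambda>\<omega>. \<Sum>k. of_bool (arr \<omega> x k \<le> t))"
      unfolding loss_def by (intro nn_integral_mono suminf_le) auto
    also have "\<dots> < \<infinity>" using expected_rings[OF t, of x] by (auto simp: less_top[symmetric] top_unique)
    finally show ?thesis .
  qed
  have edge: "2 * ?I (gain t x y) \<le> 1 + 2 * ?I (loss t x y)" if y: "y \<in> neighbours E x" for y
  proof -
    have E: "E x y" using y by (simp add: neighbours_def)
    then have xy: "x \<noteq> y" using edge_irrefl by auto
    have "AE \<omega> in median_law. gain t x y \<omega> + gain t y x \<omega> \<le> 1 + (loss t x y \<omega> + loss t y x \<omega>)"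
      using AE_good_median
    proof eventually_elim
      case (elim \<omega>)
      have "(\<Sum>k<before (snd \<omega> x) t. of_bool (val \<omega> x (Suc k) = seen \<omega> x k y))
          + (\<Sum>k<before (snd \<omega> y) t. of_bool (val \<omega> y (Suc k) = seen \<omega> y k x))
        \<le> 1 + ((\<Sum>k<before (snd \<omega> x) t. of_bool (val \<omega> x k = seen \<omega> x k y))
          + (\<Sum>k<before (snd \<omega> y) t. of_bool (val \<omega> y k = seen \<omega> y k x)) :: nat)" (is "?a \<le> ?b")
      proof -
        have "of_bool (val \<omega> x (before (snd \<omega> x) t) = val \<omega> y (before (snd \<omega> y) t)) \<le> (1 :: nat)" by simp
        then show ?thesis using agreement_balance[OF elim xy, of t] unfolding balanced_def by linarith
      qed
      then have "(of_nat ?a :: ennreal) \<le> of_nat ?b" by (rule of_nat_mono)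
      then show ?case
        unfolding gain_def loss_def suminf_before[OF elim] by simp
    qed
    then have "?I (\<lambda>\<omega>. gain t x y \<omega> + gain t y x \<omega>) \<le> ?I (\<lambda>\<omega>. 1 + (loss t x y \<omega> + loss t y x \<omega>))"
      by (rule nn_integral_mono_AE)
    then have "?I (gain t x y) + ?I (gain t y x) \<le> 1 + (?I (loss t x y) + ?I (loss t y x))"
      by (simp add: nn_integral_add median_law.emeasure_space_1[simplified])
    then show ?thesis
      using edge_exchange[OF measurable_gain equivariant_gain E] edge_exchange[OF measurable_loss equivariant_loss E]
      by (simp add: mult_2)
  qed
  have "AE \<omega> in median_law. (\<Sum>y\<in>neighbours E x. loss t x y \<omega>) + ?L \<omega> \<le> (\<Sum>y\<in>neighbours E x. gain t x y \<omega>)"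
    using AE_good_median
  proof eventually_elim
    case (elim \<omega>)
    let ?n = "before (snd \<omega> x) t"
    have card: "card {y \<in> neighbours E x. P y} = (\<Sum>y\<in>neighbours E x. of_bool (P y))" for P
      using finite_neighbours by (simp add: of_bool_def sum.If_cases Int_def)
    have "(\<Sum>k<?n. (\<Sum>y\<in>neighbours E x. of_bool (val \<omega> x k = seen \<omega> x k y)) + of_bool (lonely \<omega> x k))
        \<le> (\<Sum>k<?n. \<Sum>y\<in>neighbours E x. of_bool (val \<omega> x (Suc k) = seen \<omega> x k y) :: nat)"
    proof (rule sum_mono)
      fix k
      show "(\<Sum>y\<in>neighbours E x. of_bool (val \<omega> x k = seen \<omega> x k y)) + of_bool (lonely \<omega> x k)
          \<le> (\<Sum>y\<in>neighbours E x. of_bool (val \<omega> x (Suc k) = seen \<omega> x k y) :: nat)"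
        using card_agree_med[of x "seen \<omega> x k" "val \<omega> x k"]
        unfolding val_Suc[OF elim] lonely_def card by (simp add: eq_commute)
    qed
    then have "(\<Sum>y\<in>neighbours E x. \<Sum>k<?n. of_bool (val \<omega> x k = seen \<omega> x k y)) + (\<Sum>k<?n. of_bool (lonely \<omega> x k))
        \<le> (\<Sum>y\<in>neighbours E x. \<Sum>k<?n. of_bool (val \<omega> x (Suc k) = seen \<omega> x k y) :: nat)" (is "?a \<le> ?b")
      by (simp only: sum.distrib sum.swap[of _ "neighbours E x" "{..<?n}"])
    then have "(of_nat ?a :: ennreal) \<le> of_nat ?b" by (rule of_nat_mono)
    then show ?case
      unfolding gain_def loss_def suminf_before[OF elim] by simp
  qed
  then have "?I (\<lambda>\<omega>. (\<Sum>y\<in>neighbours E x. loss t x y \<omega>) + ?L \<omega>) \<le> ?I (\<lambda>\<omega>. \<Sum>y\<in>neighbours E x. gain t x y \<omega>)"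
    by (rule nn_integral_mono_AE)
  then have A: "(\<Sum>y\<in>neighbours E x. ?I (loss t x y)) + ?I ?L \<le> (\<Sum>y\<in>neighbours E x. ?I (gain t x y))"
    by (simp add: nn_integral_add nn_integral_sum)
  let ?l = "\<Sum>y\<in>neighbours E x. ?I (loss t x y)"
  \<comment> \<open>One of the two copies of \<open>?I ?L\<close> is dropped, which gives 3 instead
    of 3/2.\<close>
  have "2 * ?l + ?I ?L \<le> 2 * (?l + ?I ?L)"
    by (simp add: distrib_left add_left_mono mult_2)
  also have "\<dots> \<le> 2 * (\<Sum>y\<in>neighbours E x. ?I (gain t x y))"
    by (rule mult_left_mono[OF A]) simp
  also have "\<dots> \<le> (\<Sum>y\<in>neighbours E x. 1 + 2 * ?I (loss t x y))"
    unfolding sum_distrib_left by (rule sum_mono) (rule edge)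
  also have "\<dots> = 2 * ?l + 3"
    by (simp add: sum.distrib sum_distrib_left card_neighbours add.commute)
  finally have "2 * ?l + ?I ?L \<le> 2 * ?l + 3" .
  \<comment> \<open>Cancelling the losses requires them to be finite; the horizon \<open>t\<close>
    provides this.\<close>
  moreover have "2 * ?l < \<infinity>"
    using fin by (simp add: ennreal_mult_less_top finite_neighbours)
  ultimately show ?thesis
    by (subst (asm) ennreal_add_left_cancel_le) auto
qed

text \<open>The horizon kept the cancelled losses finite; as the bound does not depend on it,
  monotone convergence removes it.\<close>

lemma expected_lonely: "(\<integral>\<^sup>+\<omega>. (\<Sum>k. of_bool (lonely \<omega> x k)) \<partial>median_law) \<le> 3"
proof -
  let ?f = "\<lambda>n \<omega>. \<Sum>k. of_bool (arr \<omega> x k < real n \<and> lonely \<omega> x k) :: ennreal"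
  have "(\<integral>\<^sup>+\<omega>. (\<Sum>k. of_bool (lonely \<omega> x k)) \<partial>median_law) \<le> (\<integral>\<^sup>+\<omega>. (SUP n. ?f n \<omega>) \<partial>median_law)"
  proof (rule nn_integral_mono)
    fix \<omega>
    show "(\<Sum>k. of_bool (lonely \<omega> x k) :: ennreal) \<le> (SUP n. ?f n \<omega>)"
    proof (rule suminf_le_const)
      fix K
      obtain n where n: "Max (insert 0 ((\<lambda>k. arr \<omega> x k) ` {..<K})) < real n" using reals_Archimedean2 by blast
      have "(\<Sum>k<K. of_bool (lonely \<omega> x k) :: ennreal) = (\<Sum>k<K. of_bool (arr \<omega> x k < real n \<and> lonely \<omega> x k))"
        using n by (intro sum.cong) auto
      also have "\<dots> \<le> ?f n \<omega>" by (rule sum_le_suminf) auto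
      also have "\<dots> \<le> (SUP n. ?f n \<omega>)" by (rule SUP_upper) simp
      finally show "(\<Sum>k<K. of_bool (lonely \<omega> x k) :: ennreal) \<le> (SUP n. ?f n \<omega>)" .
    qed simp
  qed
  also have "\<dots> = (SUP n. \<integral>\<^sup>+\<omega>. ?f n \<omega> \<partial>median_law)"
  proof (rule nn_integral_monotone_convergence_SUP)
    show "incseq ?f"
      by (intro incseq_SucI le_funI suminf_le) auto
  qed measurable
  also have "\<dots> \<le> 3"
    by (intro SUP_least expected_lonely_before) simp
  finally show ?thesis .
qed

section \<open>Mass transport applied to the trace\<close>

lemma nn_integral_count_suminf:
  "(\<integral>\<^sup>+y. (\<Sum>k. f k y) \<partial>count_space UNIV) = (\<Sum>k. \<integral>\<^sup>+y. f k y \<partial>count_space UNIV)"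
  by (rule nn_integral_suminf) simp

text \<open>Every source sends mass one to each vertex carrying its value at time \<open>t\<close>;
  a vertex receives at most one, because initial values are distinct.\<close>

lemma expected_at_time:
  "(\<integral>\<^sup>+\<omega>. (\<integral>\<^sup>+y. of_bool (at_time \<omega> t y = fst \<omega> r) \<partial>count_space UNIV) \<partial>median_law) \<le> 1"
proof -
  have "(\<integral>\<^sup>+\<omega>. (\<integral>\<^sup>+y. of_bool (at_time \<omega> t y = fst \<omega> r) \<partial>count_space UNIV) \<partial>median_law)
      = (\<integral>\<^sup>+\<omega>. (\<integral>\<^sup>+y. of_bool (at_time \<omega> t r = fst \<omega> y) \<partial>count_space UNIV) \<partial>median_law)"
  proof (rule mass_transport[where G="\<lambda>x y \<omega>. of_bool (at_time \<omega> t y = fst \<omega> x)"])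
    show "equivariant (\<lambda>x y \<omega>. of_bool (at_time \<omega> t y = fst \<omega> x))"
      by (simp add: equivariant_def at_time_relabel initial_relabel)
  qed measurable
  also have "\<dots> \<le> (\<integral>\<^sup>+\<omega>. 1 \<partial>median_law)"
    using AE_inj_median
    by (intro nn_integral_mono_AE) (auto elim!: eventually_mono intro: nn_integral_inj_le_1)
  finally show ?thesis by (simp add: median_law.emeasure_space_1[simplified])
qed

text \<open>The trace over a time interval is a union over a continuum of times, beyond the reach of
  bounds at fixed times. Counted instead are the rings that produce the value; by mass transport
  their mean is at most the mean number of rings of one vertex.\<close>

lemma AE_finite_events_before:
  assumes t: "0 \<le> t"
  shows "AE \<omega> in median_law. finite {y. \<exists>k. arr \<omega> y k \<le> t \<and> val \<omega> y (Suc k) = fst \<omega> r}"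
proof -
  let ?G = "\<lambda>x y \<omega>. \<Sum>k. of_bool (arr \<omega> y k \<le> t \<and> val \<omega> y (Suc k) = fst \<omega> x) :: ennreal"
  have G[measurable]: "?G x y \<in> borel_measurable median_law" for x y by measurable
  have "(\<integral>\<^sup>+\<omega>. (\<integral>\<^sup>+y. ?G r y \<omega> \<partial>count_space UNIV) \<partial>median_law) = (\<integral>\<^sup>+\<omega>. (\<integral>\<^sup>+y. ?G y r \<omega> \<partial>count_space UNIV) \<partial>median_law)"
  proof (rule mass_transport[where G="?G"])
    show "equivariant ?G"
      by (simp add: equivariant_def arr_relabel val_relabel initial_relabel)
  qed measurable
  also have "\<dots> \<le> (\<integral>\<^sup>+\<omega>. (\<Sum>k. of_bool (arr \<omega> r k \<le> t)) \<partial>median_law)"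
  proof (rule nn_integral_mono_AE[OF eventually_mono[OF AE_inj_median]])
    fix \<omega> :: "'v sample" assume elim: "inj (fst \<omega>)"
    have "(\<integral>\<^sup>+y. ?G y r \<omega> \<partial>count_space UNIV)
        = (\<Sum>k. \<integral>\<^sup>+y. of_bool (arr \<omega> r k \<le> t) * of_bool (val \<omega> r (Suc k) = fst \<omega> y) \<partial>count_space UNIV)"
      by (simp add: nn_integral_count_suminf of_bool_conj)
    also have "\<dots> \<le> (\<Sum>k. of_bool (arr \<omega> r k \<le> t))"
      using nn_integral_inj_le_1[OF elim]
      by (intro suminf_le) (auto simp: nn_integral_cmult)
    finally show "(\<integral>\<^sup>+y. ?G y r \<omega> \<partial>count_space UNIV) \<le> (\<Sum>k. of_bool (arr \<omega> r k \<le> t))" .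
  qed
  also have "\<dots> < \<infinity>" using expected_rings[OF t, of r] by (auto simp: less_top[symmetric] top_unique)
  finally have "AE \<omega> in median_law. (\<integral>\<^sup>+y. ?G r y \<omega> \<partial>count_space UNIV) \<noteq> \<infinity>"
    by (intro nn_integral_PInf_AE measurable_nn_integral_vertices G) simp
  then show ?thesis
  proof eventually_elim
    case (elim \<omega>)
    then show ?case
      by (intro finite_of_nn_integral_count_space[where f="\<lambda>y. ?G r y \<omega>"])
        (auto simp: less_top intro!: one_le_suminf_of_bool)
  qed
qed

text \<open>A lonely ring receives mass from every source whose value is held by a neighbour, hence
  from at most three. Finite expectation leaves finitely many such rings, so their times are
  bounded.\<close>

lemma AE_lonely_bounded:
  "AE \<omega> in median_law. \<exists>T. \<forall>y k. lonely \<omega> y k \<and> (\<exists>z\<in>neighbours E y. seen \<omega> y k z = fst \<omega> r) \<longrightarrow> arr \<omega> y k \<le> T"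
proof -
  let ?P = "\<lambda>x y \<omega> k. lonely \<omega> y k \<and> (\<exists>z\<in>neighbours E y. seen \<omega> y k z = fst \<omega> x)"
  let ?G = "\<lambda>x y \<omega>. \<Sum>k. of_bool (?P x y \<omega> k) :: ennreal"
  have G[measurable]: "?G x y \<in> borel_measurable median_law" for x y by measurable
  have "(\<integral>\<^sup>+\<omega>. (\<integral>\<^sup>+y. ?G r y \<omega> \<partial>count_space UNIV) \<partial>median_law) = (\<integral>\<^sup>+\<omega>. (\<integral>\<^sup>+y. ?G y r \<omega> \<partial>count_space UNIV) \<partial>median_law)"
  proof (rule mass_transport[where G="?G"])
    show "equivariant ?G"
      by (simp add: equivariant_def lonely_relabel seen_relabel initial_relabel automorphism_neighbours)
  qed measurable
  also have "\<dots> \<le> (\<integral>\<^sup>+\<omega>. (\<Sum>k. 3 * of_bool (lonely \<omega> r k)) \<partial>median_law)"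
  proof (rule nn_integral_mono_AE[OF eventually_mono[OF AE_inj_median]])
    fix \<omega> :: "'v sample" assume elim: "inj (fst \<omega>)"
    have "(\<integral>\<^sup>+y. ?G y r \<omega> \<partial>count_space UNIV) = (\<Sum>k. \<integral>\<^sup>+y. of_bool (?P y r \<omega> k) \<partial>count_space UNIV)"
      by (rule nn_integral_count_suminf)
    also have "\<dots> \<le> (\<Sum>k. 3 * of_bool (lonely \<omega> r k))"
    proof (intro suminf_le)
      fix k
      have "(\<integral>\<^sup>+y. of_bool (?P y r \<omega> k) \<partial>count_space UNIV :: ennreal)
          \<le> (\<integral>\<^sup>+y. of_bool (lonely \<omega> r k) * (\<Sum>z\<in>neighbours E r. of_bool (seen \<omega> r k z = fst \<omega> y)) \<partial>count_space UNIV)"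
      proof (rule nn_integral_mono)
        fix y
        show "of_bool (?P y r \<omega> k) \<le> (of_bool (lonely \<omega> r k) * (\<Sum>z\<in>neighbours E r. of_bool (seen \<omega> r k z = fst \<omega> y)) :: ennreal)"
        proof (cases "?P y r \<omega> k")
          case True
          then obtain z where z: "z \<in> neighbours E r" "seen \<omega> r k z = fst \<omega> y" by auto
          then have "(1::ennreal) \<le> (\<Sum>z\<in>neighbours E r. of_bool (seen \<omega> r k z = fst \<omega> y))"
            using member_le_sum[of z "neighbours E r" "\<lambda>z. of_bool (seen \<omega> r k z = fst \<omega> y) :: ennreal"] finite_neighbours
            by simp
          then show ?thesis using True by simp
        qed simp
      qed
      also have "\<dots> = of_bool (lonely \<omega> r k) * (\<Sum>z\<in>neighbours E r. \<integral>\<^sup>+y. of_bool (seen \<omega> r k z = fst \<omega> y) \<partial>count_space UNIV)"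
        by (simp add: nn_integral_cmult nn_integral_sum)
      also have "\<dots> \<le> of_bool (lonely \<omega> r k) * (\<Sum>z\<in>neighbours E r. 1)"
        using nn_integral_inj_le_1[OF elim] by (intro mult_left_mono sum_mono) auto
      finally show "(\<integral>\<^sup>+y. of_bool (?P y r \<omega> k) \<partial>count_space UNIV :: ennreal) \<le> 3 * of_bool (lonely \<omega> r k)"
        by (simp add: card_neighbours mult.commute)
    qed auto
    finally show "(\<integral>\<^sup>+y. ?G y r \<omega> \<partial>count_space UNIV) \<le> (\<Sum>k. 3 * of_bool (lonely \<omega> r k))" .
  qed
  also have "\<dots> = 3 * (\<integral>\<^sup>+\<omega>. (\<Sum>k. of_bool (lonely \<omega> r k)) \<partial>median_law)"
    by (simp add: nn_integral_cmult)
  \<comment> \<open>One factor counts the neighbours that may hold the value, the other bounds the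
    lonely rings in mean.\<close>
  also have "\<dots> \<le> 3 * 3"
    by (rule mult_left_mono[OF expected_lonely]) simp
  also have "(3 * 3 :: ennreal) < \<infinity>" by (simp add: ennreal_mult_less_top)
  finally have "AE \<omega> in median_law. (\<integral>\<^sup>+y. ?G r y \<omega> \<partial>count_space UNIV) \<noteq> \<infinity>"
    by (intro nn_integral_PInf_AE measurable_nn_integral_vertices G) simp
  then show ?thesis
  proof eventually_elim
    case (elim \<omega>)
    have "finite {y. \<exists>k. ?P r y \<omega> k}"
      using elim by (intro finite_of_nn_integral_count_space[where f="\<lambda>y. ?G r y \<omega>"])
        (auto simp: less_top intro!: one_le_suminf_of_bool)
    moreover have "finite {k. ?P r y \<omega> k}" for y
    proof (rule finite_of_suminf_of_bool)
      have "?G r y \<omega> \<le> (\<integral>\<^sup>+y. ?G r y \<omega> \<partial>count_space UNIV)"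
        by (rule nn_integral_ge_point) simp
      then show "?G r y \<omega> < \<infinity>" using elim by (auto simp: less_top top_unique)
    qed
    ultimately have fin: "finite (\<Union>y\<in>{y. \<exists>k. ?P r y \<omega> k}. arr \<omega> y ` {k. ?P r y \<omega> k})" by auto
    have "arr \<omega> y k \<le> Max (\<Union>y\<in>{y. \<exists>k. ?P r y \<omega> k}. arr \<omega> y ` {k. ?P r y \<omega> k})" if "?P r y \<omega> k" for y k
      using that by (intro Max_ge[OF fin]) auto
    then show ?case by blast
  qed
qed

end

section \<open>Growth of a stuck trace\<close>

context cubic_tree
begin

definition stuck :: "'v sample \<Rightarrow> 'v \<Rightarrow> real \<Rightarrow> bool" where
  "stuck \<omega> r t \<longleftrightarrow> (\<forall>z. at_time \<omega> t z = fst \<omega> r \<longrightarrow> med (at_time \<omega> t) z = fst \<omega> r)"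

definition calm :: "'v sample \<Rightarrow> 'v \<Rightarrow> real \<Rightarrow> bool" where
  "calm \<omega> r t \<longleftrightarrow> (\<forall>y k. t < arr \<omega> y k \<and> (\<exists>z\<in>neighbours E y. seen \<omega> y k z = fst \<omega> r) \<longrightarrow> \<not> lonely \<omega> y k)"

lemma arr_le_iff: "good (snd \<omega>) \<Longrightarrow> arr \<omega> x j \<le> arr \<omega> x k \<longleftrightarrow> j \<le> k"
  using strict_mono_less_eq[OF strict_mono_arrival[OF reg_clock]] by (simp add: arr_def)

lemma arr_less_iff: "good (snd \<omega>) \<Longrightarrow> arr \<omega> x j < arr \<omega> x k \<longleftrightarrow> j < k"
  using strict_mono_less[OF strict_mono_arrival[OF reg_clock]] by (simp add: arr_def)

lemma before_gt: "good (snd \<omega>) \<Longrightarrow> k < before (snd \<omega> x) t \<longleftrightarrow> arr \<omega> x k < t"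
  by (simp add: less_before_iff reg_clock arr_def)

lemma upto_gt: "good (snd \<omega>) \<Longrightarrow> k < upto_time (snd \<omega> x) t \<longleftrightarrow> arr \<omega> x k \<le> t"
  by (simp add: less_upto_time_iff reg_clock arr_def)

lemma nat_eq_if_less_iff: "(\<And>k::nat. k < a \<longleftrightarrow> k < b) \<Longrightarrow> a = b"
  by (metis linorder_neqE_nat less_irrefl)

text \<open>At the previous ring of \<open>x\<close>, or at \<open>t0\<close> by stuckness, the
  median around \<open>x\<close> was the root's value. Until ring \<open>k\<close> no neighbour
  crosses that value: one that holds it keeps it by induction, and any other cannot ring lonely
  while \<open>x\<close> holds it. Hence the median is still the root's value.\<close>

lemma trace_value_persists:
  assumes good: "good (snd \<omega>)" and stuck: "stuck \<omega> r t0" and calm: "calm \<omega> r t0"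
    and "t0 < arr \<omega> x k" "val \<omega> x k = fst \<omega> r"
  shows "val \<omega> x (Suc k) = fst \<omega> r"
proof -
  let ?u = "fst \<omega> r"
  \<comment> \<open>Ring \<open>k\<close> produces ring count \<open>Suc k\<close>, the index on
    which the induction runs.\<close>
  have "\<forall>k. l = Suc k \<longrightarrow> t0 < arr \<omega> x k \<longrightarrow> val \<omega> x k = ?u \<longrightarrow> val \<omega> x (Suc k) = ?u" for l
    using good
  proof (induction x l rule: good_induct)
    case (Suc x l)
    show ?case
    proof (intro allI impI)
      fix k assume "Suc l = Suc k" and k: "t0 < arr \<omega> x k" "val \<omega> x k = ?u"
      then have lk: "l = k" by simp
      have IH: "val \<omega> y (Suc j) = ?u"
        if "y \<in> neighbours E x" "Suc j \<le> before (snd \<omega> y) (arr \<omega> x k)" "t0 < arr \<omega> y j" "val \<omega> y j = ?u" for y j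
        using Suc[of y "Suc j"] that lk by (auto simp: arr_def)
      \<comment> \<open>The latest moment, not before \<open>t0\<close>, at which the median around
        \<open>x\<close> is known; \<open>l0\<close> records the ring counts of the other vertices
        at that moment.\<close>
      define t' where "t' = (if 0 < k \<and> t0 < arr \<omega> x (k - 1) then arr \<omega> x (k - 1) else t0)"
      define l0 where "l0 y = (if 0 < k \<and> t0 < arr \<omega> x (k - 1) then before (snd \<omega> y) (arr \<omega> x (k - 1))
                               else upto_time (snd \<omega> y) t0)" for y
      have t': "t0 \<le> t'" "t' < arr \<omega> x k"
        using k arr_less_iff[OF good, of x "k - 1" k] by (auto simp: t'_def)
      have prev: "arr \<omega> x j \<le> t'" if "j < k" for j
      proof -
        have "arr \<omega> x j \<le> arr \<omega> x (k - 1)" using that arr_le_iff[OF good] by simp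
        then show ?thesis using that by (auto simp: t'_def)
      qed
      have after: "t' < arr \<omega> y j" if "l0 y \<le> j" "y \<noteq> x" for y j
      proof (cases "0 < k \<and> t0 < arr \<omega> x (k - 1)")
        case True
        then have "\<not> arr \<omega> y j < arr \<omega> x (k - 1)"
          using that before_gt[OF good, of j y "arr \<omega> x (k - 1)"] by (simp add: l0_def)
        then show ?thesis using arr_distinct[OF good that(2), of j "k - 1"] True by (simp add: t'_def)
      next
        case False
        then show ?thesis using that upto_gt[OF good, of j y t0] by (auto simp: l0_def t'_def)
      qed
      have med0: "med (\<lambda>y. val \<omega> y (l0 y)) x = ?u"
      proof (cases "0 < k \<and> t0 < arr \<omega> x (k - 1)")
        case True
        then obtain k1 where k1: "k = Suc k1" by (cases k) auto
        then show ?thesis using True k by (simp add: val_Suc[OF good] l0_def seen_def[abs_def])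
      next
        case False
        have "upto_time (snd \<omega> x) t0 = k"
        proof (rule nat_eq_if_less_iff)
          fix j
          show "j < upto_time (snd \<omega> x) t0 \<longleftrightarrow> j < k"
            using False k prev[of j] arr_le_iff[OF good, of x k j]
            by (auto simp: upto_gt[OF good] t'_def)
        qed
        then have "at_time \<omega> t0 x = ?u" using k by (simp add: at_time_def)
        then have "med (at_time \<omega> t0) x = ?u" using stuck by (auto simp: stuck_def)
        moreover have "l0 y = upto_time (snd \<omega> y) t0" for y
          unfolding l0_def by (rule if_not_P[OF False])
        ultimately show ?thesis by (simp add: at_time_def[abs_def])
      qed
      have rel: "l0 y \<le> j \<Longrightarrow> j \<le> before (snd \<omega> y) (arr \<omega> x k) \<Longrightarrow>
          (val \<omega> y (l0 y) \<le> ?u \<longrightarrow> val \<omega> y j \<le> ?u) \<and> (?u \<le> val \<omega> y (l0 y) \<longrightarrow> ?u \<le> val \<omega> y j)"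
        if y: "y \<in> neighbours E x" for y j
      proof (induction j rule: dec_induct)
        case (step j)
        have yx: "y \<noteq> x" using y edge_irrefl by (auto simp: neighbours_def)
        have xy: "x \<in> neighbours E y" using y edge_sym by (auto simp: neighbours_def)
        have tj: "t' < arr \<omega> y j" by (rule after[OF step.hyps(1) yx])
        have jt: "arr \<omega> y j < arr \<omega> x k" using step.prems before_gt[OF good, of j y "arr \<omega> x k"] by simp
        \<comment> \<open>\<open>x\<close> does not ring between \<open>t'\<close> and this ring of
          \<open>y\<close>, so \<open>y\<close> still sees the root's value at
          \<open>x\<close>.\<close>
        have "before (snd \<omega> x) (arr \<omega> y j) = k"
        proof (rule nat_eq_if_less_iff)
          fix m
          show "m < before (snd \<omega> x) (arr \<omega> y j) \<longleftrightarrow> m < k"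
            using prev[of m] tj jt arr_le_iff[OF good, of x k m]
            by (auto simp: before_gt[OF good])
        qed
        then have seen: "seen \<omega> y j x = ?u" using k by (simp add: seen_def)
        have t0j: "t0 < arr \<omega> y j" using t' tj by simp
        show ?case
        proof (cases "val \<omega> y j = ?u")
          case True
          then show ?thesis using IH[OF y step.prems t0j] by simp
        next
          case False
          \<comment> \<open>Calmness supplies another neighbour sharing the value of
            \<open>y\<close>; the new value lies between that value and the root's, hence on the
            same side.\<close>
          have "\<not> lonely \<omega> y j"
            using calm t0j xy seen unfolding calm_def by blast
          then obtain z where z: "z \<in> neighbours E y" "seen \<omega> y j z = val \<omega> y j" by (auto simp: lonely_def)
          have "min (seen \<omega> y j z) (seen \<omega> y j x) \<le> val \<omega> y (Suc j) \<and> val \<omega> y (Suc j) \<le> max (seen \<omega> y j z) (seen \<omega> y j x)"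
            unfolding val_Suc[OF good] using z xy seen False by (intro med_between) auto
          then show ?thesis using step False seen z by (auto simp: min_def max_def split: if_splits)
        qed
      qed simp
      have le: "l0 y \<le> before (snd \<omega> y) (arr \<omega> x k)" for y
      proof -
        have "j < before (snd \<omega> y) (arr \<omega> x k)" if "j < l0 y" for j
          using that k arr_less_iff[OF good, of x "k - 1" k]
          by (auto simp: l0_def before_gt[OF good] upto_gt[OF good] split: if_splits)
        from this[of "before (snd \<omega> y) (arr \<omega> x k)"] show ?thesis by (meson less_irrefl not_le)
      qed
      have "med (seen \<omega> x k) x = ?u"
        using med0 by (rule med_stable) (use rel[OF _ le order_refl] in \<open>auto simp: seen_def\<close>)
      then show "val \<omega> x (Suc k) = ?u" by (simp add: val_Suc[OF good])
    qed
  qed simp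
  then show ?thesis using assms(4,5) by blast
qed

lemma trace_grows:
  assumes good: "good (snd \<omega>)" and stuck: "stuck \<omega> r t0" and calm: "calm \<omega> r t0"
    and t: "t0 \<le> s" "s \<le> t" and s: "at_time \<omega> s z = fst \<omega> r"
  shows "at_time \<omega> t z = fst \<omega> r"
proof -
  have le: "upto_time (snd \<omega> z) s \<le> upto_time (snd \<omega> z) t"
  proof -
    have "j < upto_time (snd \<omega> z) t" if "j < upto_time (snd \<omega> z) s" for j
      using that t by (simp add: upto_gt[OF good])
    from this[of "upto_time (snd \<omega> z) t"] show ?thesis by (meson less_irrefl not_le)
  qed
  have "val \<omega> z j = fst \<omega> r" if "upto_time (snd \<omega> z) s \<le> j" for j
    using that
  proof (induction j rule: dec_induct)
    case base
    then show ?case using s by (simp add: at_time_def)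
  next
    case (step j)
    have "t0 < arr \<omega> z j" using step.hyps(1) t upto_gt[OF good, of j z s] by simp
    then show ?case using step.IH by (rule trace_value_persists[OF good stuck calm])
  qed
  then show ?thesis using le by (simp add: at_time_def)
qed

text \<open>A stuck integer time \<open>n\<close> past the last lonely ring near the trace divides
  the times. Up to \<open>n\<close>, finitely many vertices ever receive the value; after
  \<open>n\<close> the trace increases, so its union is no larger than the liminf of its
  sizes.\<close>

lemma finite_trace_if_stuck:
  assumes good: "good (snd \<omega>)" and inj: "inj (fst \<omega>)"
    and io: "\<And>N. \<exists>n\<ge>N. stuck \<omega> r (real n)"
    and early: "\<And>n. finite {y. \<exists>k. arr \<omega> y k \<le> real n \<and> val \<omega> y (Suc k) = fst \<omega> r}"
    and lonely: "\<exists>T. \<forall>y k. lonely \<omega> y k \<and> (\<exists>z\<in>neighbours E y. seen \<omega> y k z = fst \<omega> r) \<longrightarrow> arr \<omega> y k \<le> T"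
    and size: "liminf (\<lambda>n. \<integral>\<^sup>+y. of_bool (at_time \<omega> (real n) y = fst \<omega> r) \<partial>count_space UNIV) < (\<infinity> :: ennreal)"
  shows "finite {y. \<exists>t\<ge>0. at_time \<omega> t y = fst \<omega> r}"
proof -
  obtain T where T: "\<And>y k. lonely \<omega> y k \<Longrightarrow> (\<exists>z\<in>neighbours E y. seen \<omega> y k z = fst \<omega> r) \<Longrightarrow> arr \<omega> y k \<le> T"
    using lonely by blast
  obtain M where M: "T < real M" using reals_Archimedean2 by blast
  obtain n where n: "M \<le> n" "stuck \<omega> r (real n)" using io by blast
  have calm: "calm \<omega> r (real n)" unfolding calm_def
  proof (intro allI impI notI)
    fix y k assume "real n < arr \<omega> y k \<and> (\<exists>z\<in>neighbours E y. seen \<omega> y k z = fst \<omega> r)" "lonely \<omega> y k"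
    then have "arr \<omega> y k \<le> T" "real n < arr \<omega> y k" using T by auto
    then show False using M n(1) by linarith
  qed
  define D where "D m = {y. at_time \<omega> (real m) y = fst \<omega> r}" for m :: nat
  have mono: "D m \<subseteq> D m'" if "n \<le> m" "m \<le> m'" for m m'
    unfolding D_def using trace_grows[OF good n(2) calm, of "real m" "real m'"] that by auto
  have fin: "finite (\<Union>m\<in>{n..}. D m)"
  proof -
    have "emeasure (count_space UNIV) (\<Union>m. D (n + m)) = (SUP m. emeasure (count_space UNIV) (D (n + m)))"
      by (rule SUP_emeasure_incseq[symmetric]) (simp, intro incseq_SucI mono, simp_all)
    also have "\<dots> \<le> liminf (\<lambda>m. emeasure (count_space UNIV) (D m))"
    proof (rule SUP_least)
      fix m
      show "emeasure (count_space UNIV) (D (n + m)) \<le> liminf (\<lambda>m. emeasure (count_space UNIV) (D m))"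
      proof (rule Liminf_bounded)
        show "\<forall>\<^sub>F m' in sequentially. emeasure (count_space UNIV) (D (n + m)) \<le> emeasure (count_space UNIV) (D m')"
          using eventually_ge_at_top[of "n + m"] by eventually_elim (intro emeasure_mono mono, simp_all)
      qed
    qed
    also have "(\<lambda>m. emeasure (count_space UNIV) (D m))
        = (\<lambda>m. \<integral>\<^sup>+y. of_bool (at_time \<omega> (real m) y = fst \<omega> r) \<partial>count_space UNIV)"
    proof
      fix m
      have "emeasure (count_space UNIV) (D m) = (\<integral>\<^sup>+y. indicator (D m) y \<partial>count_space UNIV)" by simp
      also have "\<dots> = (\<integral>\<^sup>+y. of_bool (at_time \<omega> (real m) y = fst \<omega> r) \<partial>count_space UNIV)"
        by (intro nn_integral_cong) (simp add: D_def indicator_def)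
      finally show "emeasure (count_space UNIV) (D m) = (\<integral>\<^sup>+y. of_bool (at_time \<omega> (real m) y = fst \<omega> r) \<partial>count_space UNIV)" .
    qed
    also have "liminf \<dots> < \<infinity>" by (rule size)
    finally have "finite (\<Union>m. D (n + m))"
      by (auto simp: emeasure_count_space split: if_splits)
    moreover have "(\<Union>m\<in>{n..}. D m) = (\<Union>m. D (n + m))"
    proof (intro equalityI subsetI)
      fix y assume "y \<in> (\<Union>m\<in>{n..}. D m)"
      then obtain m where "n \<le> m" "y \<in> D m" by auto
      then show "y \<in> (\<Union>m. D (n + m))" by (intro UN_I[of "m - n"]) auto
    qed auto
    ultimately show ?thesis by simp
  qed
  have "{y. \<exists>t\<ge>0. at_time \<omega> t y = fst \<omega> r}
      \<subseteq> {r} \<union> {y. \<exists>k. arr \<omega> y k \<le> real n \<and> val \<omega> y (Suc k) = fst \<omega> r} \<union> (\<Union>m\<in>{n..}. D m)"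
  proof
    fix y assume "y \<in> {y. \<exists>t\<ge>0. at_time \<omega> t y = fst \<omega> r}"
    then obtain t where t: "0 \<le> t" "at_time \<omega> t y = fst \<omega> r" by auto
    show "y \<in> {r} \<union> {y. \<exists>k. arr \<omega> y k \<le> real n \<and> val \<omega> y (Suc k) = fst \<omega> r} \<union> (\<Union>m\<in>{n..}. D m)"
    proof (cases "t \<le> real n")
      case True
      show ?thesis
      proof (cases "upto_time (snd \<omega> y) t")
        \<comment> \<open>Without a ring the value is the initial one, and initial values are
          distinct.\<close>
        case 0
        then have "y = r" using t inj by (simp add: at_time_def inj_eq)
        then show ?thesis by simp
      next
        case (Suc k)
        then have "arr \<omega> y k \<le> t" using upto_gt[OF good, of k y t] by simp
        then have "arr \<omega> y k \<le> real n" using True by simp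
        moreover have "val \<omega> y (Suc k) = fst \<omega> r" using t Suc by (simp add: at_time_def)
        ultimately show ?thesis by blast
      qed
    next
      case False
      \<comment> \<open>Growth allows rounding \<open>t\<close> up to an integer time.\<close>
      obtain m where m: "t \<le> real m" using real_arch_simple by blast
      then have "y \<in> D m"
        using trace_grows[OF good n(2) calm, of t "real m" y] t False by (simp add: D_def)
      moreover have "n \<le> m" using m False by linarith
      ultimately show ?thesis by auto
    qed
  qed
  then show ?thesis using fin early[of n] by (auto dest: finite_subset)
qed

lemma AE_liminf_size:
  "AE \<omega> in median_law. liminf (\<lambda>n. \<integral>\<^sup>+y. of_bool (at_time \<omega> (real n) y = fst \<omega> r) \<partial>count_space UNIV) < (\<infinity> :: ennreal)"
proof -
  let ?f = "\<lambda>n \<omega>. \<integral>\<^sup>+y. of_bool (at_time \<omega> (real n) y = fst \<omega> r) \<partial>count_space UNIV :: ennreal"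
  have [measurable]: "?f n \<in> borel_measurable median_law" for n
    by (rule measurable_nn_integral_vertices) measurable
  have "(\<integral>\<^sup>+\<omega>. liminf (\<lambda>n. ?f n \<omega>) \<partial>median_law) \<le> liminf (\<lambda>n. \<integral>\<^sup>+\<omega>. ?f n \<omega> \<partial>median_law)"
    by (rule nn_integral_liminf) measurable
  also have "\<dots> \<le> liminf (\<lambda>n. 1)"
    by (intro Liminf_mono always_eventually allI expected_at_time)
  also have "\<dots> = 1" by (simp add: Liminf_const)
  finally have "(\<integral>\<^sup>+\<omega>. liminf (\<lambda>n. ?f n \<omega>) \<partial>median_law) \<noteq> \<infinity>" by (auto simp: top_unique)
  then have "AE \<omega> in median_law. liminf (\<lambda>n. ?f n \<omega>) \<noteq> \<infinity>"
    by (intro nn_integral_PInf_AE) measurable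
  then show ?thesis by eventually_elim (simp add: less_top)
qed

end

section \<open>Peeling the trace\<close>

lemma emeasure_expo_Ioc_pos:
  assumes "0 \<le> a" "a < b" shows "0 < emeasure expo {a<..b}"
proof -
  have "0 < ennreal (exp (- b) * (b - a))" using assms by simp
  also have "\<dots> = (\<integral>\<^sup>+x. ennreal (exp (- b)) * indicator {a<..b} x \<partial>lborel)"
    using assms by (simp add: nn_integral_cmult_indicator ennreal_mult)
  also have "\<dots> \<le> (\<integral>\<^sup>+x. ennreal (exponential_density 1 x) * indicator {a<..b} x \<partial>lborel)"
    using assms by (intro nn_integral_mono) (auto simp: indicator_def exponential_density_def intro!: ennreal_leI)
  also have "\<dots> = emeasure expo {a<..b}" by (simp add: emeasure_density)
  finally show ?thesis .
qed

text \<open>The first ring falls into slot \<open>j\<close> of \<open>K\<close> equal slots of the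
  unit interval, and the second waiting time alone exceeds the interval. The upper bound 2 keeps all
  conditions of the form treated in \<open>emeasure_expo_Ioc_pos\<close>.\<close>

definition ring_once :: "nat \<Rightarrow> nat \<Rightarrow> (nat \<Rightarrow> real) set" where
  "ring_once K j = {v. v 0 \<in> {real j / real K<..real (Suc j) / real K} \<and> v 1 \<in> {1<..2}}"

definition ring_late :: "(nat \<Rightarrow> real) set" where
  "ring_late = {v. v 0 \<in> {1<..2}}"

lemma ring_once_pos:
  assumes "0 < K" shows "ring_once K j \<in> sets clock_law \<and> 0 < emeasure clock_law (ring_once K j)"
proof -
  define I1 I2 where "I1 = {real j / real K<..real (Suc j) / real K}" and "I2 = {1<..2::real}"
  let ?A = "\<lambda>n::nat. if n = 0 then I1 else I2"
  have e: "ring_once K j = {v \<in> space (PiM UNIV (\<lambda>_. expo)). \<forall>n\<in>{0,1}. v n \<in> ?A n}"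
    by (auto simp: ring_once_def space_PiM I1_def I2_def)
  have "emeasure clock_law (ring_once K j) = (\<Prod>n\<in>{0,1}. emeasure expo (?A n))"
    unfolding e clock_law_eq by (rule clock.emeasure_PiM_Collect) (auto simp: I1_def I2_def)
  moreover have "0 < emeasure expo I1" unfolding I1_def
    by (rule emeasure_expo_Ioc_pos) (use assms in \<open>simp_all add: divide_strict_right_mono\<close>)
  moreover have "0 < emeasure expo I2" unfolding I2_def by (rule emeasure_expo_Ioc_pos) simp_all
  moreover have "ring_once K j = {v \<in> space clock_law. v 0 \<in> {real j / real K<..real (Suc j) / real K} \<and> v 1 \<in> {1<..2}}"
    by (simp add: ring_once_def)
  then have "ring_once K j \<in> sets clock_law" by (simp only:) measurable
  ultimately show ?thesis by (simp add: zero_less_iff_neq_zero)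
qed

lemma ring_late_pos: "ring_late \<in> sets clock_law \<and> 0 < emeasure clock_law ring_late"
proof -
  have e: "ring_late = {v \<in> space (PiM UNIV (\<lambda>_. expo)). \<forall>n\<in>{0::nat}. v n \<in> {1<..2}}"
    by (auto simp: ring_late_def space_PiM)
  have "emeasure clock_law ring_late = (\<Prod>n\<in>{0::nat}. emeasure expo {1<..2})"
    unfolding e clock_law_eq by (rule clock.emeasure_PiM_Collect) auto
  moreover have "{v \<in> space clock_law. v 0 \<in> {1<..2}} \<in> sets clock_law" by measurable
  then have "ring_late \<in> sets clock_law" by (simp add: ring_late_def)
  ultimately show ?thesis using emeasure_expo_Ioc_pos[of 1 2] by simp
qed

lemma ex_ring_bound:
  assumes "0 < K"
  obtains q where "0 < q" "q \<le> 1" "ennreal q \<le> emeasure clock_law ring_late"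
    "\<And>j. j < K \<Longrightarrow> ennreal q \<le> emeasure clock_law (ring_once K j)"
proof -
  interpret C: prob_space clock_law by (rule prob_space_clock_law)
  \<comment> \<open>The entry 1 ensures \<open>q \<le> 1\<close>, so that an upper bound on the
    number of vertices gives a lower bound on a power of \<open>q\<close>.\<close>
  define S where "S = insert 1 (insert (measure clock_law ring_late) ((\<lambda>j. measure clock_law (ring_once K j)) ` {..<K}))"
  have fin: "finite S" "S \<noteq> {}" by (auto simp: S_def)
  have "\<And>s. s \<in> S \<Longrightarrow> 0 < s"
    using ring_late_pos ring_once_pos[OF assms] by (auto simp: S_def C.emeasure_eq_measure)
  then have "0 < Min S" using fin by auto
  moreover have "Min S \<le> s" if "s \<in> S" for s using fin that by auto
  ultimately show ?thesis
    by (intro that[of "Min S"]) (auto simp: S_def C.emeasure_eq_measure intro!: ennreal_leI simp del: Min_insert Min_le_iff)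
qed

context cubic_tree
begin

fun run :: "('v \<Rightarrow> real) \<Rightarrow> 'v list \<Rightarrow> 'v \<Rightarrow> real" where
  "run c [] = c"
| "run c (y # ys) = run (c(y := med c y)) ys"

lemma run_append: "run c (xs @ ys) = run (run c xs) ys"
  by (induction xs arbitrary: c) auto

text \<open>Updating unstable vertices of the trace one after the other only shrinks it, so it ends in a
  configuration in which every remaining vertex of the trace is stable.\<close>

lemma ex_peeling:
  assumes "finite {z. c z = u}"
  shows "\<exists>ys. distinct ys \<and> set ys \<subseteq> {z. c z = u} \<and> (\<forall>z. run c ys z = u \<longrightarrow> med (run c ys) z = u)"
  using assms
proof (induction "card {z. c z = u}" arbitrary: c rule: less_induct)
  case less
  show ?case
  proof (cases "\<forall>z. c z = u \<longrightarrow> med c z = u")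
    case True
    then show ?thesis by (intro exI[of _ "[]"]) simp
  next
    case False
    then obtain y where y: "c y = u" "med c y \<noteq> u" by auto
    let ?c = "c(y := med c y)"
    \<comment> \<open>The new value of \<open>y\<close> differs from \<open>u\<close>, so the update
      deletes exactly \<open>y\<close>, which therefore does not recur in the list.\<close>
    have e: "{z. ?c z = u} = {z. c z = u} - {y}" using y by auto
    then have "card {z. ?c z = u} < card {z. c z = u}"
      using less.prems y by (metis card_Diff1_less mem_Collect_eq)
    moreover have "finite {z. ?c z = u}" using less.prems unfolding e by (rule finite_Diff)
    ultimately obtain ys where ys: "distinct ys" "set ys \<subseteq> {z. ?c z = u}"
      "\<forall>z. run ?c ys z = u \<longrightarrow> med (run ?c ys) z = u" using less.hyps[of ?c] by blast
    then show ?thesis using y e by (intro exI[of _ "y # ys"]) auto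
  qed
qed

section \<open>Resampling all clocks after a fixed time\<close>

definition refresh_all :: "real \<Rightarrow> ('v \<Rightarrow> nat \<Rightarrow> real) \<Rightarrow> ('v \<Rightarrow> nat \<Rightarrow> real) \<Rightarrow> 'v \<Rightarrow> nat \<Rightarrow> real" where
  "refresh_all t w w' = (\<lambda>x. refresh t (w x) (w' x))"

context
  fixes t :: real and w w' :: "'v \<Rightarrow> nat \<Rightarrow> real" and i :: "'v \<Rightarrow> real"
  assumes t: "0 \<le> t" and good: "good w" and reg': "\<And>x. regular_clock (w' x)"
    and good': "good (refresh_all t w w')"
begin

lemma reg_w: "regular_clock (w x)"
  using good by (simp add: good_def)

text \<open>The value at ring count \<open>k\<close> depends on the clocks only up to ring
  \<open>k - 1\<close>, hence the condition on that ring.\<close>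

lemma spin_refresh:
  "k = 0 \<or> arrival (w x) (k - 1) \<le> t \<Longrightarrow> spin med i (refresh_all t w w') x k = spin med i w x k"
  using good
proof (induction x k rule: good_induct)
  case (Suc x n)
  then have n: "arrival (w x) n \<le> t" by simp
  then have "n < upto_time (w x) t" by (simp add: less_upto_time_iff reg_w)
  then have a: "arrival (refresh_all t w w' x) n = arrival (w x) n"
    unfolding refresh_all_def by (rule arrival_refresh_less[OF t reg_w reg'])
  have b: "before (refresh_all t w w' y) (arrival (w x) n) = before (w y) (arrival (w x) n)" for y
    unfolding refresh_all_def by (rule before_refresh[OF t reg_w reg' n])
  have "spin med i (refresh_all t w w') y (before (w y) (arrival (w x) n)) = spin med i w y (before (w y) (arrival (w x) n))"
    if y: "y \<in> neighbours E x" for y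
  proof (rule Suc(1)[OF y order_refl])
    have "arrival (w y) (before (w y) (arrival (w x) n) - 1) < arrival (w x) n" if "before (w y) (arrival (w x) n) \<noteq> 0"
      using that less_before_iff[OF reg_w[of y], of "before (w y) (arrival (w x) n) - 1" "arrival (w x) n"] by simp
    then show "before (w y) (arrival (w x) n) = 0 \<or> arrival (w y) (before (w y) (arrival (w x) n) - 1) \<le> t"
      using n by fastforce
  qed
  then show ?case
    unfolding spin_Suc[OF local_rule_med good] spin_Suc[OF local_rule_med good'] a b by (intro med_cong)
qed simp

lemma at_time_refresh: "s \<le> t \<Longrightarrow> at_time (i, refresh_all t w w') s x = at_time (i, w) s x"
proof -
  assume s: "s \<le> t"
  have u: "upto_time (refresh_all t w w' x) s = upto_time (w x) s"
    unfolding refresh_all_def by (rule upto_time_refresh[OF t reg_w reg' s])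
  have "arrival (w x) (upto_time (w x) s - 1) \<le> s" if "upto_time (w x) s \<noteq> 0"
    using that less_upto_time_iff[OF reg_w[of x], of "upto_time (w x) s - 1" s] by simp
  then have "upto_time (w x) s = 0 \<or> arrival (w x) (upto_time (w x) s - 1) \<le> t" using s by fastforce
  then show ?thesis unfolding at_time_def val_def by (simp add: u spin_refresh)
qed

text \<open>The clocks force the updates \<open>ys\<close> in this order within the unit interval
  and silence the rest of \<open>ND\<close>. Clocks outside \<open>ND\<close> are free, because a
  vertex there has no neighbour in \<open>D\<close>; so the value cannot leave \<open>D\<close>, and
  on \<open>ND\<close> the final configuration is \<open>run c ys\<close>.\<close>

lemma stuck_after_peeling:
  fixes r :: 'v and ys :: "'v list" and K :: nat
  defines "u \<equiv> i r" and "c \<equiv> at_time (i, w) t"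
  defines "D \<equiv> {z. c z = u}"
  defines "ND \<equiv> D \<union> (\<Union>y\<in>D. neighbours E y)"
  assumes K: "length ys \<le> K" "0 < K" and ys: "distinct ys" "set ys \<subseteq> D"
    and peeled: "\<And>z. run c ys z = u \<Longrightarrow> med (run c ys) z = u"
    and once: "\<And>j. j < length ys \<Longrightarrow> w' (ys ! j) \<in> ring_once K j"
    and late: "\<And>z. z \<in> ND \<Longrightarrow> z \<notin> set ys \<Longrightarrow> w' z \<in> ring_late"
  shows "stuck (i, refresh_all t w w') r (t + 1)"
proof -
  let ?W = "refresh_all t w w'"
  let ?\<omega> = "(i, ?W)"
  have g: "good (snd ?\<omega>)" using good' by simp
  have regW: "regular_clock (?W z)" for z using good' by (simp add: good_def)
  define b where "b z = upto_time (w z) t" for z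
  have arrW: "arrival (?W z) (b z + j) = t + arrival (w' z) j" for z j
    unfolding refresh_all_def b_def by (rule arrival_refresh_add[OF t reg_w reg'])
  have uptoW: "upto_time (?W z) t = b z" for z
    unfolding refresh_all_def b_def by (rule upto_time_refresh[OF t reg_w reg' order_refl])
  have le_t: "arrival (?W z) k \<le> t \<longleftrightarrow> k < b z" for z k
    using less_upto_time_iff[OF regW, of k z t] by (simp add: uptoW)
  have val_b: "val ?\<omega> z (b z) = c z" for z
    using at_time_refresh[OF order_refl, of z] by (simp add: at_time_def uptoW c_def)
  have first: "arrival (?W z) (b z) = t + w' z 0" for z using arrW[of z 0] by simp
  have second: "arrival (?W z) (Suc (b z)) = t + w' z 0 + w' z 1" for z
    using arrW[of z 1] by (simp add: arrival_Suc[of _ 0, simplified])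
  have pos: "0 < w' z n" for z n using reg'[of z] by (simp add: regular_clock_def)
  \<comment> \<open>Time of the only ring of \<open>ys ! j\<close> within one unit after
    \<open>t\<close>; the slots order these times as in \<open>ys\<close>.\<close>
  define T where "T j = t + w' (ys ! j) 0" for j
  have T: "t + real j / real K < T j" "T j \<le> t + real (Suc j) / real K" "1 < w' (ys ! j) 1" if "j < length ys" for j
    using once[OF that] by (auto simp: T_def ring_once_def)
  have T_le: "T j \<le> t + 1" if "j < length ys" for j
  proof -
    have "real (Suc j) / real K \<le> 1" using that K by (simp add: field_simps)
    then show ?thesis using T(2)[OF that] by linarith
  qed
  have T_gt: "t < T j" for j using pos[of "ys ! j" 0] by (simp add: T_def)
  have T_mono: "T j < T l" if "j < l" "l < length ys" for j l
  proof -
    have "real (Suc j) / real K \<le> real l / real K" using that by (intro divide_right_mono) auto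
    then show ?thesis using T(2)[of j] T(1)[of l] that by linarith
  qed
  have before_late: "before (?W z) s = b z" "upto_time (?W z) s = b z"
    if "z \<in> ND" "z \<notin> set ys" "t < s" "s \<le> t + 1" for z s
  proof -
    have "1 < w' z 0" using late[OF that(1,2)] by (simp add: ring_late_def)
    then have "\<not> arrival (?W z) (b z) \<le> s" using that(4) by (simp add: first)
    then have "k < b z \<longleftrightarrow> arrival (?W z) k \<le> s" for k
      using that(3) le_t[of z k] strict_mono_less_eq[OF strict_mono_arrival[OF regW[of z]], of "b z" k]
      by (meson less_imp_le not_le order_trans)
    moreover from this have "k < b z \<longleftrightarrow> arrival (?W z) k < s" for k
      using that(3) le_t[of z k] by (meson le_less_trans less_imp_le)
    ultimately show "before (?W z) s = b z" "upto_time (?W z) s = b z"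
      by (intro nat_eq_if_less_iff; simp add: less_before_iff less_upto_time_iff regW)+
  qed
  have upto_once: "upto_time (?W (ys ! l)) s = (if T l \<le> s then Suc (b (ys ! l)) else b (ys ! l))"
    and before_once: "before (?W (ys ! l)) s = (if T l < s then Suc (b (ys ! l)) else b (ys ! l))"
    if l: "l < length ys" and s: "t < s" "s \<le> t + 1" for l s
  proof -
    let ?z = "ys ! l"
    have f: "arrival (?W ?z) (b ?z) = T l" by (simp add: first T_def)
    have "t + 1 < arrival (?W ?z) (Suc (b ?z))"
      using T(3)[OF l] pos[of ?z 0] by (simp add: second)
    then have big: "s < arrival (?W ?z) k" if "b ?z < k" for k
      using that s strict_mono_less_eq[OF strict_mono_arrival[OF regW[of ?z]], of "Suc (b ?z)" k] by force
    have small: "arrival (?W ?z) k < s" if "k < b ?z" for k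
      using that le_t[of ?z k] s by simp
    have "k < (if T l \<le> s then Suc (b ?z) else b ?z) \<longleftrightarrow> arrival (?W ?z) k \<le> s" for k
      using big[of k] small[of k] f by (cases k "b ?z" rule: linorder_cases) auto
    then show "upto_time (?W ?z) s = (if T l \<le> s then Suc (b ?z) else b ?z)"
      by (intro nat_eq_if_less_iff) (simp add: less_upto_time_iff regW)
    have "k < (if T l < s then Suc (b ?z) else b ?z) \<longleftrightarrow> arrival (?W ?z) k < s" for k
      using big[of k] small[of k] f by (cases k "b ?z" rule: linorder_cases) auto
    then show "before (?W ?z) s = (if T l < s then Suc (b ?z) else b ?z)"
      by (intro nat_eq_if_less_iff) (simp add: less_before_iff regW)
  qed
  have sim: "j \<le> length ys \<Longrightarrow> z \<in> ND \<Longrightarrow>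
      val ?\<omega> z (if z \<in> set (take j ys) then Suc (b z) else b z) = run c (take j ys) z" for j z
  proof (induction j arbitrary: z)
    case 0
    then show ?case by (simp add: val_b)
  next
    case (Suc j)
    let ?y = "ys ! j"
    have j: "j < length ys" using Suc.prems by simp
    have tk: "take (Suc j) ys = take j ys @ [?y]" using j by (rule take_Suc_conv_app_nth)
    have yD: "?y \<in> D" using ys(2) j by auto
    have ynot: "?y \<notin> set (take j ys)"
      using ys(1) j by (metis distinct_take not_distinct_conv_prefix tk distinct_append disjoint_insert(1) list.simps(15))
    \<comment> \<open>The neighbours of \<open>ys ! j\<close> lie in \<open>ND\<close>, and among
      them exactly those in the first \<open>j\<close> entries have rung before
      \<open>T j\<close>.\<close>
    have seen: "seen ?\<omega> ?y (b ?y) x = run c (take j ys) x" if x: "x \<in> neighbours E ?y" for x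
    proof -
      have xND: "x \<in> ND" using x yD by (auto simp: ND_def)
      have aT: "arr ?\<omega> ?y (b ?y) = T j" by (simp add: arr_def first T_def)
      have "before (?W x) (T j) = (if x \<in> set (take j ys) then Suc (b x) else b x)"
      proof (cases "x \<in> set ys")
        case True
        then obtain l where l: "l < length ys" "x = ys ! l" by (auto simp: in_set_conv_nth)
        have "x \<in> set (take j ys) \<longleftrightarrow> l < j"
          using l j ys(1) by (auto simp: in_set_conv_nth nth_eq_iff_index_eq)
        moreover have "T l < T j \<longleftrightarrow> l < j"
          using T_mono[of l j] T_mono[of j l] l j by (cases l j rule: linorder_cases) auto
        ultimately show ?thesis using before_once[OF l(1) T_gt T_le[OF j]] l(2) by simp
      next
        case False
        then show ?thesis using before_late(1)[OF xND False T_gt T_le[OF j]] by (auto dest: in_set_takeD)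
      qed
      then show ?thesis using Suc.IH[of x] xND j by (simp add: seen_def aT)
    qed
    have "val ?\<omega> ?y (Suc (b ?y)) = med (run c (take j ys)) ?y"
      unfolding val_Suc[OF g] by (rule med_cong) (rule seen)
    moreover have "run c (take (Suc j) ys) = (run c (take j ys))(?y := med (run c (take j ys)) ?y)"
      by (simp add: tk run_append)
    ultimately show ?case
      using Suc.IH[of z] Suc.prems ynot by (auto simp: tk)
  qed
  have now: "at_time ?\<omega> (t + 1) z = run c ys z" if z: "z \<in> ND" for z
  proof -
    have "upto_time (?W z) (t + 1) = (if z \<in> set ys then Suc (b z) else b z)"
    proof (cases "z \<in> set ys")
      case True
      then obtain l where l: "l < length ys" "z = ys ! l" by (auto simp: in_set_conv_nth)
      then show ?thesis using upto_once[OF l(1), of "t + 1"] T_le[OF l(1)] by simp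
    next
      case False
      then show ?thesis using before_late(2)[OF z False, of "t + 1"] by simp
    qed
    then show ?thesis using sim[of "length ys" z] z by (simp add: at_time_def)
  qed
  \<comment> \<open>Induction over rings: inside \<open>ND\<close> but outside \<open>D\<close>
    nothing rings, and elsewhere all neighbours are outside \<open>D\<close>. Counts start at
    \<open>b z\<close>, the state at time \<open>t\<close>.\<close>
  have outside: "z \<notin> D \<longrightarrow> b z \<le> l \<longrightarrow> l \<le> upto_time (?W z) (t + 1) \<longrightarrow> val ?\<omega> z l \<noteq> u" for z l
    using good'
  proof (induction z l rule: good_induct)
    case (0 z)
    then show ?case using val_b[of z] by (auto simp: D_def)
  next
    case (Suc z m)
    show ?case
    proof (intro impI)
      assume z: "z \<notin> D" "b z \<le> Suc m" "Suc m \<le> upto_time (?W z) (t + 1)"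
      show "val ?\<omega> z (Suc m) \<noteq> u"
      proof (cases "Suc m = b z")
        case True
        then show ?thesis using val_b[of z] z(1) by (auto simp: D_def)
      next
        case False
        then have m: "b z \<le> m" using z(2) by simp
        let ?s = "arrival (?W z) m"
        have s: "t < ?s" "?s \<le> t + 1"
          using le_t[of z m] m less_upto_time_iff[OF regW, of m z "t + 1"] z(3) by auto
        have "z \<notin> ND"
        proof
          assume "z \<in> ND"
          moreover have "z \<notin> set ys" using z(1) ys(2) by auto
          ultimately have "upto_time (?W z) (t + 1) = b z" by (intro before_late(2)) auto
          then show False using z(3) m by simp
        qed
        have "val ?\<omega> y (before (?W y) ?s) \<noteq> u" if y: "y \<in> neighbours E z" for y
        proof -
          have "y \<notin> D" using y \<open>z \<notin> ND\<close> edge_sym by (auto simp: ND_def neighbours_def)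
          moreover have "b y \<le> before (?W y) ?s"
          proof (rule ccontr)
            assume "\<not> ?thesis"
            then have "arrival (?W y) (before (?W y) ?s) \<le> t" by (simp add: le_t)
            then have "arrival (?W y) (before (?W y) ?s) < ?s" using s by simp
            then show False using less_before_iff[OF regW, of "before (?W y) ?s" y ?s] by simp
          qed
          moreover have "before (?W y) ?s \<le> upto_time (?W y) (t + 1)"
          proof (rule ccontr)
            assume "\<not> ?thesis"
            then have "arrival (?W y) (upto_time (?W y) (t + 1)) < ?s"
              using less_before_iff[OF regW, of "upto_time (?W y) (t + 1)" y ?s] by simp
            then have "arrival (?W y) (upto_time (?W y) (t + 1)) \<le> t + 1" using s by simp
            then show False using less_upto_time_iff[OF regW, of "upto_time (?W y) (t + 1)" y "t + 1"] by simp
          qed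
          ultimately show ?thesis using Suc[OF y order_refl] by blast
        qed
        moreover obtain y where "y \<in> neighbours E z" "val ?\<omega> z (Suc m) = seen ?\<omega> z m y"
          using med_in[of z "seen ?\<omega> z m"] val_Suc[OF g, of z m] by auto
        ultimately show ?thesis by (simp add: seen_def arr_def)
      qed
    qed
  qed
  show ?thesis unfolding stuck_def
  proof (intro allI impI)
    fix z assume "at_time ?\<omega> (t + 1) z = fst ?\<omega> r"
    then have z: "at_time ?\<omega> (t + 1) z = u" by (simp add: u_def)
    have zD: "z \<in> D"
    proof (rule ccontr)
      assume "z \<notin> D"
      moreover have "b z \<le> upto_time (?W z) (t + 1)"
      proof (rule ccontr)
        assume "\<not> ?thesis"
        then have "arrival (?W z) (upto_time (?W z) (t + 1)) \<le> t" by (simp add: le_t)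
        then show False using less_upto_time_iff[OF regW, of "upto_time (?W z) (t + 1)" z "t + 1"] by simp
      qed
      ultimately have "at_time ?\<omega> (t + 1) z \<noteq> u" using outside[of z "upto_time (?W z) (t + 1)"] by (simp add: at_time_def)
      then show False using z by simp
    qed
    then have "z \<in> ND" by (simp add: ND_def)
    \<comment> \<open>The neighbours of a vertex of \<open>D\<close> lie in \<open>ND\<close>, so
      this is the median of the peeled configuration.\<close>
    have "med (at_time ?\<omega> (t + 1)) z = med (run c ys) z"
      using zD by (intro med_cong now) (auto simp: ND_def)
    also have "\<dots> = u" using peeled z now[OF \<open>z \<in> ND\<close>] by simp
    finally show "med (at_time ?\<omega> (t + 1)) z = fst ?\<omega> r" by (simp add: u_def)
  qed
qed

end

end

section \<open>The trace gets stuck\<close>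

context cubic_tree
begin

interpretation clocks_prob: prob_space clocks_law by (rule prob_space_clocks_law)
interpretation median_prob: prob_space median_law by (rule prob_space_median_law)

lemma measurable_refresh_all:
  "(\<lambda>(w, w'). refresh_all t w w') \<in> measurable (clocks_law \<Otimes>\<^sub>M clocks_law) clocks_law"
proof -
  have r: "(\<lambda>z. refresh t (fst z x) (snd z x)) \<in> measurable (clocks_law \<Otimes>\<^sub>M clocks_law) clock_law" for x :: 'v
  proof -
    have "(\<lambda>z. (fst z x, snd z x)) \<in> measurable (clocks_law \<Otimes>\<^sub>M clocks_law) (clock_law \<Otimes>\<^sub>M clock_law)"
      unfolding clocks_law_def by measurable
    from measurable_compose[OF this measurable_refresh] show ?thesis by simp
  qed
  show ?thesis
    unfolding case_prod_beta refresh_all_def clocks_law_def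
    by (rule measurable_PiM_single') (use r in \<open>auto simp: clocks_law_def\<close>)
qed

lemma distr_refresh_all:
  "0 \<le> t \<Longrightarrow> distr (clocks_law \<Otimes>\<^sub>M clocks_law) clocks_law (\<lambda>(w, w'). refresh_all t w w') = clocks_law"
  unfolding clocks_law_def refresh_all_def
  by (rule distr_PiM_pairwise[OF prob_space_clock_law prob_space_clock_law prob_space_clock_law
        measurable_refresh distr_refresh])

text \<open>Markov property at time \<open>t\<close>: \<open>w\<close> supplies the past and the
  independent \<open>w'\<close> drives the future.\<close>

lemma nn_integral_refresh:
  assumes t: "0 \<le> t" and f: "f \<in> borel_measurable median_law"
  shows "(\<integral>\<^sup>+\<omega>. f \<omega> \<partial>median_law)
    = (\<integral>\<^sup>+i. \<integral>\<^sup>+w. \<integral>\<^sup>+w'. f (i, refresh_all t w w') \<partial>clocks_law \<partial>clocks_law \<partial>values_law)"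
proof -
  have "(\<integral>\<^sup>+\<omega>. f \<omega> \<partial>median_law) = (\<integral>\<^sup>+i. \<integral>\<^sup>+w. f (i, w) \<partial>clocks_law \<partial>values_law)"
    unfolding median_law_def using f by (subst clocks_prob.nn_integral_fst[symmetric]) (auto simp: median_law_def)
  also have "\<dots> = (\<integral>\<^sup>+i. \<integral>\<^sup>+w. \<integral>\<^sup>+w'. f (i, refresh_all t w w') \<partial>clocks_law \<partial>clocks_law \<partial>values_law)"
  proof (rule nn_integral_cong)
    fix i
    have fi: "(\<lambda>w. f (i, w)) \<in> borel_measurable clocks_law"
      using f unfolding median_law_def by (rule measurable_Pair_compose_split[OF _ measurable_const measurable_ident_sets, of "\<lambda>i w. f (i, w)", simplified]) auto
    have "(\<integral>\<^sup>+w. f (i, w) \<partial>clocks_law)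
        = (\<integral>\<^sup>+w. f (i, w) \<partial>distr (clocks_law \<Otimes>\<^sub>M clocks_law) clocks_law (\<lambda>(w, w'). refresh_all t w w'))"
      by (simp add: distr_refresh_all[OF t])
    also have "\<dots> = (\<integral>\<^sup>+z. f (i, refresh_all t (fst z) (snd z)) \<partial>(clocks_law \<Otimes>\<^sub>M clocks_law))"
      using fi measurable_refresh_all by (subst nn_integral_distr) (auto simp: case_prod_beta)
    also have "\<dots> = (\<integral>\<^sup>+w. \<integral>\<^sup>+w'. f (i, refresh_all t w w') \<partial>clocks_law \<partial>clocks_law)"
      using measurable_compose[OF measurable_refresh_all[of t] fi]
      by (subst clocks_prob.nn_integral_fst[symmetric]) (auto simp: case_prod_beta)
    finally show "(\<integral>\<^sup>+w. f (i, w) \<partial>clocks_law)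
      = (\<integral>\<^sup>+w. \<integral>\<^sup>+w'. f (i, refresh_all t w w') \<partial>clocks_law \<partial>clocks_law)" .
  qed
  finally show ?thesis .
qed

lemma AE_refresh_good:
  assumes t: "0 \<le> t"
  shows "AE w in clocks_law. AE w' in clocks_law. good (refresh_all t w w')"
proof -
  interpret P: pair_sigma_finite clocks_law clocks_law
    by (intro pair_sigma_finite.intro clocks_prob.sigma_finite_measure_axioms)
  have "AE z in clocks_law \<Otimes>\<^sub>M clocks_law. good (case z of (w, w') \<Rightarrow> refresh_all t w w')"
    by (rule AE_distrD[OF measurable_refresh_all], subst distr_refresh_all[OF t], rule AE_good)
  from P.AE_pair[OF this] show ?thesis by simp
qed

definition trace_size :: "'v \<Rightarrow> real \<Rightarrow> 'v sample \<Rightarrow> ennreal" where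
  "trace_size r t \<omega> = (\<integral>\<^sup>+y. of_bool (at_time \<omega> t y = fst \<omega> r) \<partial>count_space UNIV)"

text \<open>Integer times match the unit intervals in which peeling is attempted.\<close>

definition unstuck :: "'v \<Rightarrow> nat \<Rightarrow> nat \<Rightarrow> 'v sample \<Rightarrow> bool" where
  "unstuck r N n \<omega> \<longleftrightarrow> (\<forall>m\<in>{N..n}. \<not> stuck \<omega> r (real m))"

lemma measurable_trace_size[measurable]: "trace_size r t \<in> borel_measurable median_law"
  unfolding trace_size_def[abs_def] by (rule measurable_nn_integral_vertices) measurable

lemma measurable_stuck[measurable]: "Measurable.pred median_law (\<lambda>\<omega>. stuck \<omega> r t)"
proof -
  have surj: "range (from_nat_into (UNIV :: 'v set)) = UNIV"
    by (rule range_from_nat_into[OF UNIV_not_empty countable_vertices])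
  have "stuck \<omega> r t \<longleftrightarrow> (\<forall>n. at_time \<omega> t (from_nat_into UNIV n) = fst \<omega> r \<longrightarrow>
      med (at_time \<omega> t) (from_nat_into UNIV n) = fst \<omega> r)" for \<omega>
    unfolding stuck_def using surj by (metis rangeE UNIV_I)
  then show ?thesis by (simp only:) measurable
qed

lemma measurable_unstuck[measurable]: "Measurable.pred median_law (unstuck r N n)"
  unfolding unstuck_def[abs_def] by measurable

text \<open>The clocks are independent over \<open>ND\<close>, and each vertex is asked for an event
  of probability at least \<open>q\<close>.\<close>

lemma emeasure_peeling_event:
  fixes ys :: "'v list"
  assumes K: "length ys \<le> K" "0 < K" and ys: "distinct ys" and ND: "finite ND" "card ND \<le> M"
    and q: "0 < q" "q \<le> 1" "ennreal q \<le> emeasure clock_law ring_late"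
      "\<And>j. j < K \<Longrightarrow> ennreal q \<le> emeasure clock_law (ring_once K j)"
    and sub: "set ys \<subseteq> ND"
  obtains F where "F \<in> sets clocks_law" "ennreal (q ^ M) \<le> emeasure clocks_law F"
    "\<And>w' j. w' \<in> F \<Longrightarrow> j < length ys \<Longrightarrow> w' (ys ! j) \<in> ring_once K j"
    "\<And>w' z. w' \<in> F \<Longrightarrow> z \<in> ND \<Longrightarrow> z \<notin> set ys \<Longrightarrow> w' z \<in> ring_late"
proof -
  interpret P: product_prob_space "\<lambda>_. clock_law" "UNIV :: 'v set"
    by (intro product_prob_spaceI prob_space_clock_law)
  define idx where "idx z = (THE j. j < length ys \<and> ys ! j = z)" for z
  have idx: "idx (ys ! j) = j" if "j < length ys" for j
    unfolding idx_def using that ys by (intro the_equality) (auto simp: nth_eq_iff_index_eq)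
  define S where "S z = (if z \<in> set ys then ring_once K (idx z) else ring_late)" for z
  have S: "S z \<in> sets clock_law" "ennreal q \<le> emeasure clock_law (S z)" for z
  proof -
    have "idx z < K" if "z \<in> set ys" using that idx K by (auto simp: in_set_conv_nth)
    then show "S z \<in> sets clock_law" "ennreal q \<le> emeasure clock_law (S z)"
      using q ring_late_pos ring_once_pos[OF K(2)] by (auto simp: S_def)
  qed
  define F where "F = {w' \<in> space (PiM UNIV (\<lambda>_. clock_law)). \<forall>z\<in>ND. w' z \<in> S z}"
  have "emeasure clocks_law F = (\<Prod>z\<in>ND. emeasure clock_law (S z))"
    unfolding F_def clocks_law_def using ND S by (intro P.emeasure_PiM_Collect) auto
  moreover have "(\<Prod>z\<in>ND. ennreal q) \<le> (\<Prod>z\<in>ND. emeasure clock_law (S z))"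
    using S by (intro prod_mono_ennreal) auto
  moreover have "ennreal (q ^ M) \<le> (\<Prod>z\<in>ND. ennreal q)"
    using q ND by (simp add: ennreal_power ennreal_leI power_decreasing)
  ultimately have le: "ennreal (q ^ M) \<le> emeasure clocks_law F" by simp
  have "F \<in> sets clocks_law"
  proof -
    have "Measurable.pred clocks_law (\<lambda>w'. w' z \<in> S z)" for z
      unfolding clocks_law_def by (rule pred_sets2[OF S(1)]) (rule measurable_component_singleton, simp)
    then have "Measurable.pred clocks_law (\<lambda>w'. \<forall>z\<in>ND. w' z \<in> S z)"
      using ND by (intro pred_intros_finite) auto
    then show ?thesis by (simp add: F_def pred_def clocks_law_def)
  qed
  moreover have "w' (ys ! j) \<in> ring_once K j" if "w' \<in> F" "j < length ys" for w' j
  proof -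
    have "ys ! j \<in> ND" using that sub by auto
    then have "w' (ys ! j) \<in> S (ys ! j)" using that by (simp add: F_def)
    then show ?thesis using that idx by (simp add: S_def)
  qed
  moreover have "w' z \<in> ring_late" if "w' \<in> F" "z \<in> ND" "z \<notin> set ys" for w' z
    using that by (force simp: F_def S_def)
  ultimately show ?thesis using le that by blast
qed

text \<open>Given the past up to \<open>n\<close>, a trace of size at most \<open>k\<close> is
  peeled with a probability bounded below in terms of \<open>k\<close> alone. The other two
  conditions concern times up to \<open>n\<close> and survive the resampling of the later
  clocks.\<close>

lemma stuck_probability:
  obtains c where "0 < c" "\<And>N n. ennreal c * emeasure median_law {\<omega>. unstuck r N n \<omega> \<and> trace_size r (real n) \<omega> \<le> of_nat k}
      \<le> emeasure median_law {\<omega>. unstuck r N n \<omega> \<and> trace_size r (real n) \<omega> \<le> of_nat k \<and> stuck \<omega> r (real (Suc n))}"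
proof -
  \<comment> \<open>A peeling list has length at most \<open>k\<close>; the successor keeps the
    number of slots positive when \<open>k = 0\<close>.\<close>
  define K where "K = Suc k"
  have K: "0 < K" by (simp add: K_def)
  obtain q where q: "0 < q" "q \<le> 1" "ennreal q \<le> emeasure clock_law ring_late"
      "\<And>j. j < K \<Longrightarrow> ennreal q \<le> emeasure clock_law (ring_once K j)"
    using ex_ring_bound[OF K] by blast
  \<comment> \<open>At most \<open>k\<close> vertices of the trace, each with three
    neighbours.\<close>
  define c where "c = q ^ (4 * k)"
  have main: "ennreal c * emeasure median_law {\<omega>. unstuck r N n \<omega> \<and> trace_size r (real n) \<omega> \<le> of_nat k}
      \<le> emeasure median_law {\<omega>. unstuck r N n \<omega> \<and> trace_size r (real n) \<omega> \<le> of_nat k \<and> stuck \<omega> r (real (Suc n))}" for N n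
  proof -
    let ?A = "{\<omega>. unstuck r N n \<omega> \<and> trace_size r (real n) \<omega> \<le> of_nat k}"
    let ?B = "{\<omega>. unstuck r N n \<omega> \<and> trace_size r (real n) \<omega> \<le> of_nat k \<and> stuck \<omega> r (real (Suc n))}"
    have "{\<omega> \<in> space median_law. unstuck r N n \<omega> \<and> trace_size r (real n) \<omega> \<le> of_nat k} \<in> sets median_law"
      by measurable
    then have A: "?A \<in> sets median_law" by simp
    have "{\<omega> \<in> space median_law. unstuck r N n \<omega> \<and> trace_size r (real n) \<omega> \<le> of_nat k \<and> stuck \<omega> r (real (Suc n))} \<in> sets median_law"
      by measurable
    then have B: "?B \<in> sets median_law" by simp
    have n: "0 \<le> real n" by simp
    have reg: "AE w' in clocks_law. \<forall>x. regular_clock (w' x)" by (rule AE_regular_clocks)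
    have point: "ennreal c * indicator ?A (i, w) \<le> (\<integral>\<^sup>+w'. indicator ?B (i, refresh_all (real n) w w') \<partial>clocks_law)"
      if w: "good w" and gr: "AE w' in clocks_law. good (refresh_all (real n) w w')" for i w
    proof (cases "(i, w) \<in> ?A")
      case True
      define D where "D = {z. at_time (i, w) (real n) z = i r}"
      define ND where "ND = D \<union> (\<Union>y\<in>D. neighbours E y)"
      have "emeasure (count_space UNIV) D = (\<integral>\<^sup>+y. indicator D y \<partial>count_space UNIV)" by simp
      also have "\<dots> = trace_size r (real n) (i, w)"
        unfolding trace_size_def by (intro nn_integral_cong) (simp add: D_def indicator_def)
      also have "\<dots> \<le> of_nat k" using True by simp
      finally have eD: "emeasure (count_space UNIV) D \<le> of_nat k" .
      have finD: "finite D"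
      proof (rule ccontr)
        assume "infinite D"
        then show False using eD by (simp add: top_unique)
      qed
      then have cD: "card D \<le> k" using eD by simp
      have finND: "finite ND" using finD finite_neighbours by (simp add: ND_def)
      have "card ND \<le> card D + card (\<Union>y\<in>D. neighbours E y)" unfolding ND_def by (rule card_Un_le)
      also have "card (\<Union>y\<in>D. neighbours E y) \<le> (\<Sum>y\<in>D. card (neighbours E y))" by (rule card_UN_le[OF finD])
      finally have cND: "card ND \<le> 4 * k" using cD by (simp add: card_neighbours)
      obtain ys where ys: "distinct ys" "set ys \<subseteq> D"
        "\<forall>z. run (at_time (i, w) (real n)) ys z = i r \<longrightarrow> med (run (at_time (i, w) (real n)) ys) z = i r"
        using ex_peeling[of "at_time (i, w) (real n)" "i r"] finD unfolding D_def by blast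
      have "length ys \<le> K"
        using ys card_mono[OF finD ys(2)] cD by (simp add: distinct_card K_def)
      moreover have "set ys \<subseteq> ND" using ys(2) by (auto simp: ND_def)
      ultimately obtain F where F: "F \<in> sets clocks_law" "ennreal (q ^ (4 * k)) \<le> emeasure clocks_law F"
        "\<And>w' j. w' \<in> F \<Longrightarrow> j < length ys \<Longrightarrow> w' (ys ! j) \<in> ring_once K j"
        "\<And>w' z. w' \<in> F \<Longrightarrow> z \<in> ND \<Longrightarrow> z \<notin> set ys \<Longrightarrow> w' z \<in> ring_late"
        using emeasure_peeling_event[of ys K ND "4 * k" q] K ys(1) finND cND q by metis
      have "AE w' in clocks_law. indicator F w' \<le> (indicator ?B (i, refresh_all (real n) w w') :: ennreal)"
        using gr reg
      proof eventually_elim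
        case (elim w')
        show ?case
        proof (cases "w' \<in> F")
          case True
          have reg: "\<And>x. regular_clock (w' x)" using elim by simp
          note ctx = n w reg elim(1)
          have same: "at_time (i, refresh_all (real n) w w') s = at_time (i, w) s" if "s \<le> real n" for s
            by (rule ext, rule at_time_refresh[OF ctx that])
          have "stuck (i, refresh_all (real n) w w') r (real n + 1)"
          proof (rule stuck_after_peeling[OF ctx, where ys=ys and K=K and r=r])
            show "length ys \<le> K" "0 < K" by fact+
            show "set ys \<subseteq> {z. at_time (i, w) (real n) z = i r}" using ys(2) by (simp add: D_def)
            show "w' (ys ! j) \<in> ring_once K j" if "j < length ys" for j by (rule F(3)[OF True that])
            show "w' z \<in> ring_late" if "z \<in> {z. at_time (i, w) (real n) z = i r} \<union> (\<Union>y\<in>{z. at_time (i, w) (real n) z = i r}. neighbours E y)" "z \<notin> set ys" for z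
              using F(4)[OF True _ that(2)] that(1) by (simp add: ND_def D_def)
          qed (use ys in auto)
          then have "stuck (i, refresh_all (real n) w w') r (real (Suc n))" by (simp add: add.commute)
          moreover have "unstuck r N n (i, refresh_all (real n) w w')"
            using \<open>(i, w) \<in> ?A\<close> same by (simp add: unstuck_def stuck_def)
          moreover have "trace_size r (real n) (i, refresh_all (real n) w w') \<le> of_nat k"
            using \<open>(i, w) \<in> ?A\<close> same by (simp add: trace_size_def)
          ultimately show ?thesis using True by simp
        qed simp
      qed
      then have "(\<integral>\<^sup>+w'. indicator F w' \<partial>clocks_law) \<le> (\<integral>\<^sup>+w'. indicator ?B (i, refresh_all (real n) w w') \<partial>clocks_law)"
        by (rule nn_integral_mono_AE)
      then have "emeasure clocks_law F \<le> (\<integral>\<^sup>+w'. indicator ?B (i, refresh_all (real n) w w') \<partial>clocks_law)"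
        by (simp only: nn_integral_indicator[OF F(1)])
      then have "ennreal c \<le> (\<integral>\<^sup>+w'. indicator ?B (i, refresh_all (real n) w w') \<partial>clocks_law)"
        unfolding c_def by (rule order_trans[OF F(2)])
      then show ?thesis using True by (simp only: indicator_simps mult_1_right)
    qed simp
    have "ennreal c * emeasure median_law ?A = (\<integral>\<^sup>+\<omega>. ennreal c * indicator ?A \<omega> \<partial>median_law)"
      using A by (subst nn_integral_cmult) auto
    also have "\<dots> = (\<integral>\<^sup>+i. \<integral>\<^sup>+w. ennreal c * indicator ?A (i, w) \<partial>clocks_law \<partial>values_law)"
      unfolding median_law_def using A[unfolded median_law_def]
      by (subst clocks_prob.nn_integral_fst[symmetric]) auto
    also have "\<dots> \<le> (\<integral>\<^sup>+i. \<integral>\<^sup>+w. \<integral>\<^sup>+w'. indicator ?B (i, refresh_all (real n) w w') \<partial>clocks_law \<partial>clocks_law \<partial>values_law)"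
    proof (rule nn_integral_mono, rule nn_integral_mono_AE)
      fix i
      show "AE w in clocks_law. ennreal c * indicator ?A (i, w) \<le> (\<integral>\<^sup>+w'. indicator ?B (i, refresh_all (real n) w w') \<partial>clocks_law)"
        using AE_good AE_refresh_good[OF n] by eventually_elim (rule point)
    qed
    also have "\<dots> = (\<integral>\<^sup>+\<omega>. indicator ?B \<omega> \<partial>median_law)"
      using B by (intro nn_integral_refresh[OF n, symmetric]) auto
    also have "\<dots> = emeasure median_law ?B" using B by simp
    finally show ?thesis .
  qed
  have "0 < c" using q by (simp add: c_def)
  then show ?thesis using main by (rule that)
qed

lemma prob_trace_size_gt:
  assumes "0 < k"
  shows "measure median_law {\<omega>. \<not> trace_size r t \<omega> \<le> of_nat k} \<le> 1 / real k"
proof -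
  have m: "{\<omega> \<in> space median_law. 1 \<le> ennreal (1 / real k) * trace_size r t \<omega>} \<in> sets median_law" by measurable
  have "{\<omega>. \<not> trace_size r t \<omega> \<le> of_nat k} \<subseteq> {\<omega> \<in> space median_law. 1 \<le> ennreal (1 / real k) * trace_size r t \<omega>}"
  proof
    fix \<omega> assume "\<omega> \<in> {\<omega>. \<not> trace_size r t \<omega> \<le> of_nat k}"
    then have "ennreal (1 / real k) * ennreal (real k) \<le> ennreal (1 / real k) * trace_size r t \<omega>"
      by (intro mult_left_mono) (auto simp: ennreal_of_nat_eq_real_of_nat)
    then show "\<omega> \<in> {\<omega> \<in> space median_law. 1 \<le> ennreal (1 / real k) * trace_size r t \<omega>}"
      using assms by (simp add: ennreal_mult[symmetric])
  qed
  then have "emeasure median_law {\<omega>. \<not> trace_size r t \<omega> \<le> of_nat k}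
      \<le> emeasure median_law {\<omega> \<in> space median_law. 1 \<le> ennreal (1 / real k) * trace_size r t \<omega>}"
    by (rule emeasure_mono[OF _ m])
  also have "\<dots> \<le> ennreal (1 / real k) * (\<integral>\<^sup>+\<omega>. trace_size r t \<omega> * indicator (space median_law) \<omega> \<partial>median_law)"
    by (rule nn_integral_Markov_inequality) measurable
  also have "\<dots> \<le> ennreal (1 / real k) * 1"
    using expected_at_time[of t r] by (intro mult_left_mono) (simp_all add: trace_size_def)
  finally show ?thesis
    by (simp add: median_prob.emeasure_eq_measure)
qed

text \<open>Being unstuck through \<open>n\<close>, small at \<open>n\<close> and stuck at
  \<open>n + 1\<close> are disjoint events for different \<open>n\<close>, so their probabilities
  are summable. Hence being unstuck and small has probability tending to 0, and a large trace
  contributes at most \<open>1 / k\<close>.\<close>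

lemma AE_stuck_infinitely_often: "AE \<omega> in median_law. \<forall>N. \<exists>n\<ge>N. stuck \<omega> r (real n)"
proof -
  have "AE \<omega> in median_law. \<exists>n\<ge>N. stuck \<omega> r (real n)" for N
  proof -
    let ?\<mu> = "measure median_law"
    define H where "H n = {\<omega>. unstuck r N n \<omega>}" for n
    define Z where "Z = {\<omega>. \<forall>n\<ge>N. \<not> stuck \<omega> r (real n)}"
    have "{\<omega> \<in> space median_law. unstuck r N n \<omega>} \<in> sets median_law" for n by measurable
    then have H[measurable]: "H n \<in> sets median_law" for n by (simp add: H_def)
    have "{\<omega> \<in> space median_law. \<forall>n\<ge>N. \<not> stuck \<omega> r (real n)} \<in> sets median_law" by measurable
    then have Z: "Z \<in> sets median_law" by (simp add: Z_def)
    have bound: "?\<mu> Z \<le> 1 / real k" if k: "0 < k" for k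
    proof -
      obtain c where c: "0 < c" "\<And>N n. ennreal c * emeasure median_law {\<omega>. unstuck r N n \<omega> \<and> trace_size r (real n) \<omega> \<le> of_nat k}
        \<le> emeasure median_law {\<omega>. unstuck r N n \<omega> \<and> trace_size r (real n) \<omega> \<le> of_nat k \<and> stuck \<omega> r (real (Suc n))}"
        using stuck_probability[of r k] by blast
      define A where "A n = {\<omega>. unstuck r N n \<omega> \<and> trace_size r (real n) \<omega> \<le> of_nat k}" for n
      define B where "B n = {\<omega>. unstuck r N n \<omega> \<and> trace_size r (real n) \<omega> \<le> of_nat k \<and> stuck \<omega> r (real (Suc n))}" for n
      define G where "G n = {\<omega>. \<not> trace_size r (real n) \<omega> \<le> of_nat k}" for n
      have "{\<omega> \<in> space median_law. unstuck r N n \<omega> \<and> trace_size r (real n) \<omega> \<le> of_nat k} \<in> sets median_law" for n by measurable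
      then have A[measurable]: "A n \<in> sets median_law" for n by (simp add: A_def)
      have "{\<omega> \<in> space median_law. unstuck r N n \<omega> \<and> trace_size r (real n) \<omega> \<le> of_nat k \<and> stuck \<omega> r (real (Suc n))} \<in> sets median_law" for n by measurable
      then have B[measurable]: "B n \<in> sets median_law" for n by (simp add: B_def)
      have "{\<omega> \<in> space median_law. \<not> trace_size r (real n) \<omega> \<le> of_nat k} \<in> sets median_law" for n by measurable
      then have G[measurable]: "G n \<in> sets median_law" for n by (simp add: G_def)
      have cA: "c * ?\<mu> (A n) \<le> ?\<mu> (B n)" for n
      proof -
        have "ennreal (c * ?\<mu> (A n)) \<le> ennreal (?\<mu> (B n))"
          using c(2)[of N n] c(1) by (simp add: A_def B_def median_prob.emeasure_eq_measure ennreal_mult)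
        then show ?thesis by (simp add: ennreal_le_iff)
      qed
      have step: "?\<mu> (B (N + m)) + ?\<mu> (H (N + Suc m)) \<le> ?\<mu> (H (N + m))" for m
      proof -
        have i: "{N..N + Suc m} = insert (Suc (N + m)) {N..N + m}" by auto
        have "H (N + Suc m) = H (N + m) \<inter> {\<omega>. \<not> stuck \<omega> r (real (Suc (N + m)))}"
          unfolding H_def unstuck_def i by blast
        then have "B (N + m) \<inter> H (N + Suc m) = {}" "B (N + m) \<union> H (N + Suc m) \<subseteq> H (N + m)"
          by (auto simp: B_def H_def)
        then show ?thesis
          by (subst median_prob.finite_measure_Union[symmetric]) (auto intro!: median_prob.finite_measure_mono)
      qed
      have sums: "(\<Sum>m<M. c * ?\<mu> (A (N + m))) \<le> ?\<mu> (H N) - ?\<mu> (H (N + M))" for M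
      proof (induction M)
        case (Suc M)
        then show ?case using step[of M] cA[of "N + M"] by simp
      qed simp
      have "summable (\<lambda>m. c * ?\<mu> (A (N + m)))"
      proof (rule summableI_nonneg_bounded[where x=1])
        show "0 \<le> c * ?\<mu> (A (N + m))" for m using c(1) by simp
        show "(\<Sum>m<M. c * ?\<mu> (A (N + m))) \<le> 1" for M
          using sums[of M] median_prob.prob_le_1[of "H N"] measure_nonneg[of median_law "H (N + M)"] by linarith
      qed
      then have "(\<lambda>m. c * ?\<mu> (A (N + m))) \<longlonglongrightarrow> 0" by (rule summable_LIMSEQ_zero)
      then have "(\<lambda>m. (c * ?\<mu> (A (N + m))) / c) \<longlonglongrightarrow> 0 / c" by (rule tendsto_divide) (use c in auto)
      then have lim: "(\<lambda>m. ?\<mu> (A (N + m)) + 1 / real k) \<longlonglongrightarrow> 0 + 1 / real k"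
        using c(1) by (intro tendsto_add) auto
      have le: "?\<mu> Z \<le> ?\<mu> (A (N + m)) + 1 / real k" for m
      proof -
        have "?\<mu> Z \<le> ?\<mu> (A (N + m) \<union> G (N + m))"
          by (rule median_prob.finite_measure_mono[OF _ sets.Un[OF A G]]) (auto simp: Z_def A_def G_def unstuck_def)
        also have "\<dots> \<le> ?\<mu> (A (N + m)) + ?\<mu> (G (N + m))"
          by (rule measure_Un_le) measurable
        also have "?\<mu> (G (N + m)) \<le> 1 / real k"
          unfolding G_def by (rule prob_trace_size_gt[OF k])
        finally show ?thesis by simp
      qed
      show ?thesis using LIMSEQ_le_const[OF lim] le by auto
    qed
    have "(\<lambda>k. 1 / real (Suc k)) \<longlonglongrightarrow> 0" using LIMSEQ_Suc[OF lim_1_over_n] by simp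
    then have "?\<mu> Z \<le> 0"
      by (rule LIMSEQ_le_const, intro exI[of _ 0] allI impI bound) simp
    then have "emeasure median_law Z = 0"
      by (simp add: median_prob.emeasure_eq_measure measure_le_0_iff)
    then show ?thesis
      using Z by (intro AE_I[where N=Z]) (auto simp: Z_def)
  qed
  then show ?thesis by (simp add: AE_all_countable)
qed

theorem AE_finite_trace: "AE \<omega> in median_law. finite {y. \<exists>t\<ge>0. at_time \<omega> t y = fst \<omega> r}"
proof -
  have "AE \<omega> in median_law. \<forall>n. finite {y. \<exists>k. arr \<omega> y k \<le> real n \<and> val \<omega> y (Suc k) = fst \<omega> r}"
    using AE_finite_events_before by (simp add: AE_all_countable)
  with AE_good_median AE_inj_median AE_stuck_infinitely_often[of r] show ?thesis
    using AE_lonely_bounded[of r] AE_liminf_size[of r]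
    by eventually_elim (rule finite_trace_if_stuck, auto)
qed

end

section \<open>Back to majority dynamics\<close>

text \<open>Stated on product measures because an iterated almost-sure statement can only be turned into one
  about the product if the set in question is measurable.\<close>

lemma distr_pair_spectator:
  assumes "prob_space A" "prob_space B" "prob_space C" "prob_space D"
    and g[measurable]: "(\<lambda>(a, b). g a b) \<in> measurable (A \<Otimes>\<^sub>M B) C"
    and eq: "distr (A \<Otimes>\<^sub>M B) C (\<lambda>(a, b). g a b) = C"
  shows "(\<lambda>z. (g (fst (fst z)) (snd z), snd (fst z))) \<in> measurable ((A \<Otimes>\<^sub>M D) \<Otimes>\<^sub>M B) (C \<Otimes>\<^sub>M D)"
    and "distr ((A \<Otimes>\<^sub>M D) \<Otimes>\<^sub>M B) (C \<Otimes>\<^sub>M D) (\<lambda>z. (g (fst (fst z)) (snd z), snd (fst z))) = C \<Otimes>\<^sub>M D"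
proof -
  interpret A: prob_space A by fact
  interpret B: prob_space B by fact
  interpret C: prob_space C by fact
  interpret D: prob_space D by fact
  interpret AB: pair_prob_space A B by unfold_locales
  interpret AD: pair_prob_space A D by unfold_locales
  interpret BD: pair_prob_space B D by unfold_locales
  have g': "(\<lambda>z. g (u z) (v z)) \<in> measurable M C" if "u \<in> measurable M A" "v \<in> measurable M B" for u v and M :: "'z measure"
    using measurable_compose[OF measurable_Pair[OF that] g] by simp
  show h: "(\<lambda>z. (g (fst (fst z)) (snd z), snd (fst z))) \<in> measurable ((A \<Otimes>\<^sub>M D) \<Otimes>\<^sub>M B) (C \<Otimes>\<^sub>M D)"
    by (intro measurable_Pair g') measurable
  show "distr ((A \<Otimes>\<^sub>M D) \<Otimes>\<^sub>M B) (C \<Otimes>\<^sub>M D) (\<lambda>z. (g (fst (fst z)) (snd z), snd (fst z))) = C \<Otimes>\<^sub>M D" (is "?L = _")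
  proof (rule measure_eqI)
    fix S assume "S \<in> sets ?L"
    then have S: "S \<in> sets (C \<Otimes>\<^sub>M D)" by simp
    let ?f = "\<lambda>a b d. indicator S (g a b, d) :: ennreal"
    have i: "(\<lambda>z. indicator S z :: ennreal) \<in> borel_measurable (C \<Otimes>\<^sub>M D)" using S by simp
    have "emeasure ?L S = (\<integral>\<^sup>+z. indicator S z \<partial>?L)" using S by simp
    also have "\<dots> = (\<integral>\<^sup>+z. ?f (fst (fst z)) (snd z) (snd (fst z)) \<partial>((A \<Otimes>\<^sub>M D) \<Otimes>\<^sub>M B))"
      by (rule nn_integral_distr[OF h]) (use S in simp)
    also have "\<dots> = (\<integral>\<^sup>+y. \<integral>\<^sup>+b. ?f (fst y) b (snd y) \<partial>B \<partial>(A \<Otimes>\<^sub>M D))"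
      using measurable_compose[OF h i] by (subst B.nn_integral_fst[symmetric]) simp_all
    also have "\<dots> = (\<integral>\<^sup>+a. \<integral>\<^sup>+d. \<integral>\<^sup>+b. ?f a b d \<partial>B \<partial>D \<partial>A)"
    proof -
      have "(\<lambda>y. \<integral>\<^sup>+b. ?f (fst y) b (snd y) \<partial>B) \<in> borel_measurable (A \<Otimes>\<^sub>M D)"
        using measurable_compose[OF h i] by (intro B.borel_measurable_nn_integral) (simp add: case_prod_beta)
      then show ?thesis by (subst D.nn_integral_fst[symmetric]) simp_all
    qed
    also have "\<dots> = (\<integral>\<^sup>+a. \<integral>\<^sup>+b. \<integral>\<^sup>+d. ?f a b d \<partial>D \<partial>B \<partial>A)"
    proof (rule nn_integral_cong)
      fix a assume a: "a \<in> space A"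
      have "(\<lambda>z. (g a (fst z), snd z)) \<in> measurable (B \<Otimes>\<^sub>M D) (C \<Otimes>\<^sub>M D)"
        using a by (intro measurable_Pair g') auto
      from measurable_compose[OF this i]
      show "(\<integral>\<^sup>+d. \<integral>\<^sup>+b. ?f a b d \<partial>B \<partial>D) = (\<integral>\<^sup>+b. \<integral>\<^sup>+d. ?f a b d \<partial>D \<partial>B)"
        by (intro BD.Fubini') (simp add: case_prod_beta)
    qed
    also have "\<dots> = (\<integral>\<^sup>+z. (\<integral>\<^sup>+d. indicator S (case z of (a, b) \<Rightarrow> g a b, d) \<partial>D) \<partial>(A \<Otimes>\<^sub>M B))"
    proof -
      have "(\<lambda>z. ((case fst z of (a, b) \<Rightarrow> g a b), snd z)) \<in> measurable ((A \<Otimes>\<^sub>M B) \<Otimes>\<^sub>M D) (C \<Otimes>\<^sub>M D)"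
        by (intro measurable_Pair measurable_compose[OF measurable_fst g]) measurable
      from measurable_compose[OF this i]
      have "(\<lambda>z. \<integral>\<^sup>+d. indicator S (case z of (a, b) \<Rightarrow> g a b, d) \<partial>D :: ennreal) \<in> borel_measurable (A \<Otimes>\<^sub>M B)"
        by (intro D.borel_measurable_nn_integral) (simp add: case_prod_beta)
      then show ?thesis by (subst B.nn_integral_fst[symmetric]) simp_all
    qed
    also have "\<dots> = (\<integral>\<^sup>+c. \<integral>\<^sup>+d. indicator S (c, d) \<partial>D \<partial>distr (A \<Otimes>\<^sub>M B) C (\<lambda>(a, b). g a b))"
    proof -
      have "(\<lambda>c. \<integral>\<^sup>+d. indicator S (c, d) \<partial>D :: ennreal) \<in> borel_measurable C"
        using i by (intro D.borel_measurable_nn_integral) (simp add: case_prod_beta)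
      then show ?thesis by (subst nn_integral_distr[OF g]) simp_all
    qed
    also have "\<dots> = emeasure (C \<Otimes>\<^sub>M D) S"
      unfolding eq using S by (subst D.emeasure_pair_measure) simp_all
    finally show "emeasure ?L S = emeasure (C \<Otimes>\<^sub>M D) S" .
  qed simp
qed

text \<open>\<open>D\<close> is carried along unchanged while \<open>g\<close> builds the new
  coordinate. With the clocks as \<open>D\<close>, it serves to insert the level at the root and to
  build the values from spins.\<close>

lemma AE_pair_spectator:
  assumes "prob_space A" "prob_space B" "prob_space C" "prob_space D"
    and "(\<lambda>(a, b). g a b) \<in> measurable (A \<Otimes>\<^sub>M B) C"
    and "distr (A \<Otimes>\<^sub>M B) C (\<lambda>(a, b). g a b) = C"
    and AE: "AE z in C \<Otimes>\<^sub>M D. Q (fst z) (snd z)"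
  shows "AE z in (A \<Otimes>\<^sub>M D) \<Otimes>\<^sub>M B. Q (g (fst (fst z)) (snd z)) (snd (fst z))"
proof -
  note m = distr_pair_spectator(1)[OF assms(1-6)]
  have "AE z in distr ((A \<Otimes>\<^sub>M D) \<Otimes>\<^sub>M B) (C \<Otimes>\<^sub>M D) (\<lambda>z. (g (fst (fst z)) (snd z), snd (fst z))). Q (fst z) (snd z)"
    using AE by (simp only: distr_pair_spectator(2)[OF assms(1-6)])
  from AE_distrD[OF m this] show ?thesis by simp
qed

lemma AE_pair_swap:
  assumes "sigma_finite_measure M" "sigma_finite_measure N" and "AE z in M \<Otimes>\<^sub>M N. Q z"
  shows "AE z in N \<Otimes>\<^sub>M M. Q (snd z, fst z)"
proof -
  interpret P: pair_sigma_finite M N using assms by (simp add: pair_sigma_finite_def)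
  have "AE z in distr (N \<Otimes>\<^sub>M M) (M \<Otimes>\<^sub>M N) (\<lambda>(x, y). (y, x)). Q z"
    using assms(3) by (subst P.distr_pair_swap[symmetric])
  from AE_distrD[OF measurable_pair_swap' this] show ?thesis by (simp add: case_prod_beta)
qed

section \<open>Uniform values built from spins\<close>

lemma nn_integral_unif:
  assumes [measurable]: "f \<in> borel_measurable borel"
  shows "(\<integral>\<^sup>+x. f x \<partial>unif) = (\<integral>\<^sup>+x. f x * indicator {0..1} x \<partial>lborel)"
  unfolding unif_def by (subst nn_integral_uniform_measure) (simp_all add: divide_ennreal_def)

text \<open>Reverses thresholding: applied to a uniform \<open>v\<close>, the result is uniform on
  \<open>{0..p}\<close> for spin 1 and on \<open>{p..1}\<close> for spin -1.\<close>

definition merge_spin :: "real \<Rightarrow> int \<Rightarrow> real \<Rightarrow> real" where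
  "merge_spin p s v = (if s = 1 then p * v else p + (1 - p) * v)"

lemma measurable_merge_spin:
  "(\<lambda>(s, v). merge_spin p s v) \<in> measurable (measure_pmf (spin_law p) \<Otimes>\<^sub>M unif) unif"
  unfolding merge_spin_def case_prod_beta by measurable

lemma distr_merge_spin:
  assumes p: "0 < p" "p < 1"
  shows "distr (measure_pmf (spin_law p) \<Otimes>\<^sub>M unif) unif (\<lambda>(s, v). merge_spin p s v) = unif"
proof (rule measure_eqI)
  interpret U: prob_space unif by (rule prob_space_unif)
  fix S assume "S \<in> sets (distr (measure_pmf (spin_law p) \<Otimes>\<^sub>M unif) unif (\<lambda>(s, v). merge_spin p s v))"
  then have S[measurable]: "S \<in> sets borel" by (simp add: sets_unif)
  then have S': "S \<in> sets unif" by (simp add: sets_unif)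
  let ?i = "indicator S :: real \<Rightarrow> ennreal"
  have "emeasure (distr (measure_pmf (spin_law p) \<Otimes>\<^sub>M unif) unif (\<lambda>(s, v). merge_spin p s v)) S
      = (\<integral>\<^sup>+z. ?i z \<partial>distr (measure_pmf (spin_law p) \<Otimes>\<^sub>M unif) unif (\<lambda>(s, v). merge_spin p s v))"
    using S' by simp
  also have "\<dots> = (\<integral>\<^sup>+z. ?i (merge_spin p (fst z) (snd z)) \<partial>(measure_pmf (spin_law p) \<Otimes>\<^sub>M unif))"
    by (subst nn_integral_distr[OF measurable_merge_spin]) (use S' in \<open>simp_all add: case_prod_beta\<close>)
  also have "\<dots> = (\<integral>\<^sup>+s. \<integral>\<^sup>+v. ?i (merge_spin p s v) \<partial>unif \<partial>measure_pmf (spin_law p))"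
  proof -
    have "(\<lambda>z. ?i (merge_spin p (fst z) (snd z))) \<in> borel_measurable (measure_pmf (spin_law p) \<Otimes>\<^sub>M unif)"
      using measurable_compose[OF measurable_merge_spin, of ?i] S' by (simp add: case_prod_beta)
    then show ?thesis by (subst U.nn_integral_fst[symmetric]) simp_all
  qed
  also have "\<dots> = (\<integral>\<^sup>+b. \<integral>\<^sup>+v. ?i (merge_spin p (if b then 1 else - 1) v) \<partial>unif \<partial>measure_pmf (bernoulli_pmf p))"
    unfolding spin_law_def by (subst nn_integral_map_pmf) simp
  also have "\<dots> = (\<integral>\<^sup>+v. ?i (p * v) \<partial>unif) * ennreal p + (\<integral>\<^sup>+v. ?i (p + (1 - p) * v) \<partial>unif) * ennreal (1 - p)"
    using p by (simp add: merge_spin_def)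
  \<comment> \<open>Substitution \<open>x = p * v\<close>; the probability \<open>p\<close> of the
    spin is the Jacobian.\<close>
  also have "(\<integral>\<^sup>+v. ?i (p * v) \<partial>unif) * ennreal p = (\<integral>\<^sup>+x. ?i x * indicator {0..p} x \<partial>lborel)"
  proof -
    have e: "indicator {0..p} (p * v) = (indicator {0..1} v :: ennreal)" for v
      using p by (auto simp: indicator_def zero_le_mult_iff mult_le_cancel_left1)
    have "(\<integral>\<^sup>+x. ?i x * indicator {0..p} x \<partial>lborel) = ennreal \<bar>p\<bar> * (\<integral>\<^sup>+v. ?i (0 + p * v) * indicator {0..p} (0 + p * v) \<partial>lborel)"
      using p by (intro nn_integral_real_affine) auto
    then show ?thesis using p by (simp add: nn_integral_unif e mult.commute[of _ "ennreal p"])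
  qed
  also have "(\<integral>\<^sup>+v. ?i (p + (1 - p) * v) \<partial>unif) * ennreal (1 - p) = (\<integral>\<^sup>+x. ?i x * indicator {p..1} x \<partial>lborel)"
  proof -
    have e: "indicator {p..1} (p + (1 - p) * v) = (indicator {0..1} v :: ennreal)" for v
    proof -
      have "p \<le> p + (1 - p) * v \<longleftrightarrow> 0 \<le> v" using p by (simp add: zero_le_mult_iff)
      moreover have "p + (1 - p) * v \<le> 1 \<longleftrightarrow> (1 - p) * v \<le> (1 - p) * 1" by (simp add: algebra_simps)
      moreover have "(1 - p) * v \<le> (1 - p) * 1 \<longleftrightarrow> v \<le> 1" using p by (subst mult_le_cancel_left_pos) auto
      ultimately show ?thesis by (simp add: indicator_def)
    qed
    have "(\<integral>\<^sup>+x. ?i x * indicator {p..1} x \<partial>lborel) = ennreal \<bar>1 - p\<bar> * (\<integral>\<^sup>+v. ?i (p + (1 - p) * v) * indicator {p..1} (p + (1 - p) * v) \<partial>lborel)"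
      using p by (intro nn_integral_real_affine) auto
    then show ?thesis using p by (simp add: nn_integral_unif e mult.commute[of _ "ennreal (1 - p)"])
  qed
  also have "(\<integral>\<^sup>+x. ?i x * indicator {0..p} x \<partial>lborel) + (\<integral>\<^sup>+x. ?i x * indicator {p..1} x \<partial>lborel)
      = (\<integral>\<^sup>+x. ?i x * indicator {0..p} x + ?i x * indicator {p..1} x \<partial>lborel)"
    by (rule nn_integral_add[symmetric]) measurable
  also have "\<dots> = (\<integral>\<^sup>+x. ?i x * indicator {0..1} x \<partial>lborel)"
  proof (rule nn_integral_cong_AE)
    \<comment> \<open>Both intervals contain \<open>p\<close>, which is counted twice.\<close>
    show "AE x in lborel. ?i x * indicator {0..p} x + ?i x * indicator {p..1} x = ?i x * indicator {0..1} x"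
      using AE_lborel_singleton[of p] by eventually_elim (use p in \<open>auto simp: indicator_def\<close>)
  qed
  also have "\<dots> = (\<integral>\<^sup>+x. ?i x \<partial>unif)" by (rule nn_integral_unif[symmetric]) measurable
  also have "\<dots> = emeasure unif S" using S' by simp
  finally show "emeasure (distr (measure_pmf (spin_law p) \<Otimes>\<^sub>M unif) unif (\<lambda>(s, v). merge_spin p s v)) S = emeasure unif S" .
qed simp

context cubic_tree
begin

text \<open>Injectivity excludes the value \<open>p\<close> away from the root, so the weak and
  strict thresholds recover the same initial spins there and differ only at the root. Later they
  differ exactly where the value is \<open>p\<close>.\<close>

lemma disagreement_subset_trace:
  assumes w: "good w" and s: "\<And>x. s x = 1 \<or> s x = - 1" and v: "\<And>x. 0 \<le> v x \<and> v x \<le> 1" and p: "0 < p" "p < 1"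
    and inj: "inj ((\<lambda>x. merge_spin p (s x) (v x))(r := p))"
  shows "disagreement_set (glauber E w (s(r := 1))) (glauber E w (s(r := - 1)))
    \<subseteq> {y. \<exists>t\<ge>0. at_time ((\<lambda>x. merge_spin p (s x) (v x))(r := p), w) t y = p}"
proof -
  define i where "i = (\<lambda>x. merge_spin p (s x) (v x))(r := p)"
  have neq: "i x \<noteq> p" if "x \<noteq> r" for x
  proof
    assume "i x = p"
    then have "i x = i r" by (simp add: i_def)
    then show False using inj that unfolding i_def[symmetric] by (simp add: inj_eq)
  qed
  have le: "i x \<le> p" if "x \<noteq> r" "s x = 1" for x
    using that v[of x] p by (simp add: i_def merge_spin_def mult_le_cancel_left1)
  have ge: "p \<le> i x" if "x \<noteq> r" "s x = - 1" for x
    using that v[of x] p by (simp add: i_def merge_spin_def)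
  have plus: "s(r := 1) = (\<lambda>x. if i x \<le> p then 1 else - 1)"
  proof
    fix x
    show "(s(r := 1)) x = (if i x \<le> p then 1 else - 1)"
      using le[of x] ge[of x] neq[of x] s[of x] by (cases "x = r") (auto simp: i_def)
  qed
  have minus: "s(r := - 1) = (\<lambda>x. if i x < p then 1 else - 1)"
  proof
    fix x
    show "(s(r := - 1)) x = (if i x < p then 1 else - 1)"
      using le[of x] ge[of x] neq[of x] s[of x] by (cases "x = r") (auto simp: i_def)
  qed
  have P: "glauber E w (s(r := 1)) y t = (if at_time (i, w) t y \<le> p then 1 else - 1)" for y t
    unfolding plus glauber_eq_spin[OF w] at_time_def val_def fst_conv snd_conv
    by (rule spin_threshold[OF w, where P="\<lambda>a. a \<le> p"]) simp
  have M: "glauber E w (s(r := - 1)) y t = (if at_time (i, w) t y < p then 1 else - 1)" for y t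
    unfolding minus glauber_eq_spin[OF w] at_time_def val_def fst_conv snd_conv
    by (rule spin_threshold[OF w, where P="\<lambda>a. a < p"]) simp
  show ?thesis
    unfolding disagreement_set_def P M i_def[symmetric] by (auto split: if_splits)
qed

theorem AE_finite_disagreement:
  "AE p in lborel. p \<in> {0..1} \<longrightarrow>
     (AE (s, w) in glauber_law p. finite (disagreement_set (glauber E w (s(r := 1))) (glauber E w (s(r := - 1)))))"
proof -
  define nice where "nice i w \<longleftrightarrow> finite {y. \<exists>t\<ge>0. at_time (i, w) t y = i r} \<and> inj i \<and> good w"
    for i :: "'v \<Rightarrow> real" and w
  have nice: "AE \<omega> in values_law \<Otimes>\<^sub>M clocks_law. nice (fst \<omega>) (snd \<omega>)"
    using AE_finite_trace[of r] AE_inj_median AE_good_median unfolding median_law_def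
    by eventually_elim (simp add: nice_def)
  interpret V: prob_space values_law by (rule prob_space_values_law)
  interpret C: prob_space clocks_law by (rule prob_space_clocks_law)
  interpret U: prob_space unif by (rule prob_space_unif)
  interpret VC: pair_prob_space values_law clocks_law by unfold_locales
  interpret VU: pair_prob_space values_law unif by unfold_locales
  interpret UVC: pair_prob_space unif "values_law \<Otimes>\<^sub>M clocks_law" by unfold_locales
  have um: "(\<lambda>(i, p). i(r := p)) \<in> measurable (values_law \<Otimes>\<^sub>M unif) values_law"
    using measurable_compose[OF measurable_pair_swap' measurable_PiM_update[of r unif]]
    unfolding values_law_def by (simp add: case_prod_beta)
  have ud: "distr (values_law \<Otimes>\<^sub>M unif) values_law (\<lambda>(i, p). i(r := p)) = values_law"
  proof -
    have "distr (values_law \<Otimes>\<^sub>M unif) values_law (\<lambda>(i, p). i(r := p))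
        = distr (distr (values_law \<Otimes>\<^sub>M unif) (unif \<Otimes>\<^sub>M values_law) (\<lambda>(x, y). (y, x))) values_law (\<lambda>(p, i). i(r := p))"
    proof -
      have "(\<lambda>(p, i). i(r := p)) \<in> measurable (unif \<Otimes>\<^sub>M values_law) values_law"
        unfolding values_law_def by (rule measurable_PiM_update)
      moreover have "(\<lambda>(p, i :: 'v \<Rightarrow> real). i(r := p)) \<circ> (\<lambda>(x, y). (y, x)) = (\<lambda>(i, p). i(r := p))"
        by (auto simp: fun_eq_iff)
      ultimately show ?thesis by (simp only: distr_distr[OF _ measurable_pair_swap'])
    qed
    also have "distr (values_law \<Otimes>\<^sub>M unif) (unif \<Otimes>\<^sub>M values_law) (\<lambda>(x, y). (y, x)) = unif \<Otimes>\<^sub>M values_law"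
      using pair_sigma_finite.distr_pair_swap[of unif values_law]
      by (simp add: pair_sigma_finite_def U.sigma_finite_measure_axioms V.sigma_finite_measure_axioms)
    also have "distr (unif \<Otimes>\<^sub>M values_law) values_law (\<lambda>(p, i). i(r := p)) = values_law"
      unfolding values_law_def by (rule distr_PiM_update[OF prob_space_unif])
    finally show ?thesis .
  qed
  \<comment> \<open>Replacing the root's value by an independent uniform \<open>p\<close> preserves
    the law; Fubini then allows \<open>p\<close> to be fixed.\<close>
  have "AE z in (values_law \<Otimes>\<^sub>M clocks_law) \<Otimes>\<^sub>M unif. nice ((fst (fst z))(r := snd z)) (snd (fst z))"
    by (rule AE_pair_spectator[OF V.prob_space_axioms U.prob_space_axioms V.prob_space_axioms C.prob_space_axioms um ud nice])
  from AE_pair_swap[OF VC.sigma_finite_measure_axioms U.sigma_finite_measure_axioms this]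
  have "AE p in unif. AE \<omega> in values_law \<Otimes>\<^sub>M clocks_law. nice ((fst \<omega>)(r := p)) (snd \<omega>)"
    using UVC.AE_pair by fastforce
  moreover have "AE p in unif. 0 < p \<and> p < 1"
  proof -
    have "AE p in unif. p \<in> {0..1}" unfolding AE_unif_iff by simp
    then show ?thesis using AE_unif_neq[of 0] AE_unif_neq[of 1] by eventually_elim auto
  qed
  ultimately have "AE p in unif. AE (s, w) in glauber_law p.
      finite (disagreement_set (glauber E w (s(r := 1))) (glauber E w (s(r := - 1))))"
  proof eventually_elim
    case (elim p)
    define spins where "spins = PiM UNIV (\<lambda>_::'v. measure_pmf (spin_law p))"
    have spins: "prob_space spins"
      unfolding spins_def by (intro prob_space_PiM measure_pmf.prob_space_axioms)
    interpret S: prob_space spins by (rule spins)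
    interpret SC: pair_prob_space spins clocks_law by unfold_locales
    interpret SCV: pair_prob_space "spins \<Otimes>\<^sub>M clocks_law" values_law by unfold_locales
    let ?g = "\<lambda>s v x. merge_spin p (s x) (v x)"
    have gm: "(\<lambda>(s, v). ?g s v) \<in> measurable (spins \<Otimes>\<^sub>M values_law) values_law"
    proof -
      have "(\<lambda>z. merge_spin p (fst z x) (snd z x)) \<in> measurable (spins \<Otimes>\<^sub>M values_law) unif" for x
      proof -
        have "(\<lambda>z. (fst z x, snd z x)) \<in> measurable (spins \<Otimes>\<^sub>M values_law) (measure_pmf (spin_law p) \<Otimes>\<^sub>M unif)"
          unfolding spins_def values_law_def by measurable
        from measurable_compose[OF this measurable_merge_spin] show ?thesis by simp
      qed
      then show ?thesis
        unfolding case_prod_beta values_law_def by (intro measurable_PiM_single') auto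
    qed
    have gd: "distr (spins \<Otimes>\<^sub>M values_law) values_law (\<lambda>(s, v). ?g s v) = values_law"
      unfolding spins_def values_law_def
      by (rule distr_PiM_pairwise[OF measure_pmf.prob_space_axioms prob_space_unif prob_space_unif
            measurable_merge_spin distr_merge_spin]) (use elim in auto)
    \<comment> \<open>At a fixed level the uniform values are rebuilt from the spins, with
      \<open>values_law\<close> as a source of auxiliary uniforms.\<close>
    have "AE z in (spins \<Otimes>\<^sub>M clocks_law) \<Otimes>\<^sub>M values_law.
        nice ((?g (fst (fst z)) (snd z))(r := p)) (snd (fst z))"
      by (rule AE_pair_spectator[OF spins V.prob_space_axioms V.prob_space_axioms C.prob_space_axioms gm gd elim(1)])
    moreover have "AE z in (spins \<Otimes>\<^sub>M clocks_law) \<Otimes>\<^sub>M values_law. \<forall>x. 0 \<le> snd z x \<and> snd z x \<le> 1"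
    proof (rule AE_pair_snd[OF V.sigma_finite_measure_axioms])
      have "AE a in unif. 0 \<le> a \<and> a \<le> 1" unfolding AE_unif_iff by simp
      then show "AE v in values_law. \<forall>x. 0 \<le> v x \<and> v x \<le> 1"
        unfolding values_law_def
        by (intro AE_all_vertices AE_PiM_component[where P="\<lambda>a. 0 \<le> a \<and> a \<le> 1"] prob_space_unif) auto
    qed
    moreover have "AE z in (spins \<Otimes>\<^sub>M clocks_law) \<Otimes>\<^sub>M values_law. \<forall>x. fst (fst z) x = 1 \<or> fst (fst z) x = - 1"
    proof (rule AE_pair_fst[OF V.sigma_finite_measure_axioms AE_pair_fst[OF C.sigma_finite_measure_axioms]])
      have "AE a in measure_pmf (spin_law p). a = 1 \<or> a = - 1"
        unfolding AE_measure_pmf_iff by (auto simp: spin_law_def)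
      then show "AE s in spins. \<forall>x. s x = 1 \<or> s x = - 1"
        unfolding spins_def
        by (intro AE_all_vertices AE_PiM_component[where P="\<lambda>a. a = 1 \<or> a = - 1"] measure_pmf.prob_space_axioms) auto
    qed
    ultimately have "AE z in (spins \<Otimes>\<^sub>M clocks_law) \<Otimes>\<^sub>M values_law.
        finite (disagreement_set (glauber E (snd (fst z)) ((fst (fst z))(r := 1))) (glauber E (snd (fst z)) ((fst (fst z))(r := - 1))))"
    proof eventually_elim
      case (elim z)
      show ?case
        by (rule finite_subset[OF disagreement_subset_trace[where p=p and v="snd z"]])
          (use elim \<open>0 < p \<and> p < 1\<close> in \<open>auto simp: nice_def\<close>)
    qed
    \<comment> \<open>The event no longer involves the auxiliary uniforms, which are integrated
      out.\<close>
    from SCV.AE_pair[OF this]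
    have "AE y in spins \<Otimes>\<^sub>M clocks_law.
        finite (disagreement_set (glauber E (snd y) ((fst y)(r := 1))) (glauber E (snd y) ((fst y)(r := - 1))))"
      by (simp add: V.AE_const)
    then show ?case
      unfolding glauber_law_def spins_def clocks_law_def case_prod_beta .
  qed
  then show ?thesis unfolding AE_unif_iff .
qed

end

theorem theorem1p3:
  fixes E :: "'v \<Rightarrow> 'v \<Rightarrow> bool" and root :: 'v
  assumes "three_regular_tree E"
  shows "AE p in lborel. p \<in> {0..1} \<longrightarrow>
           (AE (s, w) in glauber_law p.
              finite (disagreement_set (glauber E w (s(root := 1)))
                                       (glauber E w (s(root := - 1)))))"
proof -
  interpret cubic_tree E by unfold_locales (rule assms)
  show ?thesis by (rule AE_finite_disagreement)
qed

end
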